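(* Let $\mu$ be a finite positive Borel measure on $[0,1)$ and let $1<p<\infty$. Then the operator $\mathcal{H}_\mu$ is well defined in $\Lambda^p_{1/p}$ and, furthermore, it is a bounded operator from $\Lambda^p_{1/p}$ into itself if and only if $\mu$ is a $1$-logarithmic $1$-Carleson measure.
   Context: $\mathbb{D}$ is the open unit disc in $\mathbb{C}$, and $\mathrm{Hol}(\mathbb{D})$ is the space of analytic functions in $\mathbb{D}$. $H^p$ is the Hardy space on $\mathbb{D}$, with norm $\|f\|_{H^p}=\sup_{0<r<1}\left(\frac{1}{2\pi}\int_{-\pi}^{\pi}|f(re^{i\theta})|^p\,d\theta\right)^{1/p}$. The equivalence is between "$\mathcal{H}_\mu$ is well defined in $\Lambda^p_{1/p}$ and bounded from $\Lambda^p_{1/p}$ into itself" and the condition on $\mu$. Mean Lipschitz space: for $f\in H^p$ with boundary values $f(e^{i\theta})$ and $\delta>0$, let $\omega_p(\delta,f)=\sup_{0<|t|\le\delta}\left(\frac{1}{2\pi}\int_{-\pi}^{\pi}|f(e^{i(\theta+t)})-f(e^{i\theta})|^p\,d\theta\right)^{1/p}$. The space $\Lambda^p_{1/p}$ is the set of $f\in H^p$ with $\omega_p(\delta,f)=O(\delta^{1/p})$ as $\delta\to0$, with norm $\|f\|_{H^p}+\sup_{0<\delta\le\pi}\omega_p(\delta,f)/\delta^{1/p}$. Operator $\mathcal{H}_\mu$: for $n\ge0$ let $\mu_n=\int_{[0,1)}t^n\,d\mu(t)$. For $f(z)=\sum_{k=0}^\infty a_kz^k\in\mathrm{Hol}(\mathbb{D})$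 define $\mathcal{H}_\mu(f)(z)=\sum_{n=0}^\infty\left(\sum_{k=0}^\infty\mu_{n+k}a_k\right)z^n$ whenever the right-hand side makes sense (all inner series converge) and defines an analytic function in $\mathbb{D}$. "Well defined in $\Lambda^p_{1/p}$" means that this holds for every $f\in\Lambda^p_{1/p}$. $1$-logarithmic $1$-Carleson measure: for an interval (arc) $I\subset\partial\mathbb{D}$ of length $|I|$, let $S(I)=\{re^{it}:e^{it}\in I,\ 1-\frac{|I|}{2\pi}\le r<1\}$. A positive Borel measure $\mu$ on $\mathbb{D}$ is a $1$-logarithmic $1$-Carleson measure if there is $C>0$ with $\mu(S(I))\log\frac{2\pi}{|I|}\le C|I|$ for every interval $I\subset\partial\mathbb{D}$. A measure $\mu$ on $[0,1)$ is identified with the measure $A\mapsto\mu(A\cap[0,1))$ on $\mathbb{D}$; for such $\mu$ the condition is equivalent to the existence of $C>0$ with $\mu([t,1))\log\frac{1}{1-t}\le C(1-t)$ for $0\le t<1$. *)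

theory Defs
  imports "HOL-Complex_Analysis.Complex_Analysis" "HOL-Library.Landau_Symbols"
begin

text \<open>
  Functions on the unit disc are total functions on the complex numbers; everything below depends
  only on their values on \<open>ball 0 1\<close>.
\<close>

definition circle_norm :: "real \<Rightarrow> (real \<Rightarrow> complex) \<Rightarrow> real" where
  "circle_norm p g = (1 / (2 * pi) * (LBINT \<theta>:{-pi..pi}. norm (g \<theta>) powr p)) powr (1 / p)"

definition integral_mean :: "real \<Rightarrow> real \<Rightarrow> (complex \<Rightarrow> complex) \<Rightarrow> real" where
  "integral_mean p r f = circle_norm p (\<lambda>\<theta>. f (of_real r * cis \<theta>))"

definition hardy_space :: "real \<Rightarrow> (complex \<Rightarrow> complex) set" where
  "hardy_space p =
     {f. f holomorphic_on ball 0 1 \<and> bdd_above ((\<lambda>r. integral_mean p r f) ` {0<..<1})}"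

definition hardy_norm :: "real \<Rightarrow> (complex \<Rightarrow> complex) \<Rightarrow> real" where
  "hardy_norm p f = (SUP r\<in>{0<..<1}. integral_mean p r f)"

text \<open>
  Radial limits. For \<open>f\<close> in a Hardy space they exist for almost every \<open>\<theta>\<close> and form
  a \<open>p\<close>-integrable function, so the arbitrary value that \<^const>\<open>Lim\<close> has at the
  remaining points does not matter, and the supremum in \<open>Lp_modulus\<close> below is over a bounded set.
\<close>
definition boundary_value :: "(complex \<Rightarrow> complex) \<Rightarrow> real \<Rightarrow> complex" where
  "boundary_value f \<theta> = Lim (at_left 1) (\<lambda>r. f (of_real r * cis \<theta>))"

definition Lp_modulus :: "real \<Rightarrow> real \<Rightarrow> (complex \<Rightarrow> complex) \<Rightarrow> real" where
  "Lp_modulus p \<delta> f =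
     (SUP t\<in>{t. 0 < \<bar>t\<bar> \<and> \<bar>t\<bar> \<le> \<delta>}.
        circle_norm p (\<lambda>\<theta>. boundary_value f (\<theta> + t) - boundary_value f \<theta>))"

definition mean_lipschitz :: "real \<Rightarrow> (complex \<Rightarrow> complex) set" where
  "mean_lipschitz p =
     {f \<in> hardy_space p. (\<lambda>\<delta>. Lp_modulus p \<delta> f) \<in> O[at_right 0](\<lambda>\<delta>. \<delta> powr (1 / p))}"

definition mean_lipschitz_norm :: "real \<Rightarrow> (complex \<Rightarrow> complex) \<Rightarrow> real" where
  "mean_lipschitz_norm p f =
     hardy_norm p f + (SUP \<delta>\<in>{0<..pi}. Lp_modulus p \<delta> f / \<delta> powr (1 / p))"

definition moment :: "real measure \<Rightarrow> nat \<Rightarrow> real" where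
  "moment M n = (LINT t|M. t ^ n)"

definition taylor_coeff :: "(complex \<Rightarrow> complex) \<Rightarrow> nat \<Rightarrow> complex" where
  "taylor_coeff f k = (deriv ^^ k) f 0 / fact k"

definition hankel_coeff :: "real measure \<Rightarrow> (complex \<Rightarrow> complex) \<Rightarrow> nat \<Rightarrow> complex" where
  "hankel_coeff M f n = (\<Sum>k. of_real (moment M (n + k)) * taylor_coeff f k)"

definition hankel_op :: "real measure \<Rightarrow> (complex \<Rightarrow> complex) \<Rightarrow> complex \<Rightarrow> complex" where
  "hankel_op M f z = (\<Sum>n. hankel_coeff M f n * z ^ n)"

definition hankel_defined :: "real measure \<Rightarrow> (complex \<Rightarrow> complex) \<Rightarrow> bool" where
  "hankel_defined M f \<longleftrightarrow>
     (\<forall>n. summable (\<lambda>k. of_real (moment M (n + k)) * taylor_coeff f k)) \<and>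
     (\<forall>z\<in>ball 0 1. summable (\<lambda>n. hankel_coeff M f n * z ^ n)) \<and>
     hankel_op M f holomorphic_on ball 0 1"

definition hankel_well_defined_in :: "real measure \<Rightarrow> (complex \<Rightarrow> complex) set \<Rightarrow> bool" where
  "hankel_well_defined_in M X \<longleftrightarrow> (\<forall>f\<in>X. hankel_defined M f)"

definition hankel_bounded_on_mean_lipschitz :: "real measure \<Rightarrow> real \<Rightarrow> bool" where
  "hankel_bounded_on_mean_lipschitz M p \<longleftrightarrow>
     (\<forall>f\<in>mean_lipschitz p. hankel_op M f \<in> mean_lipschitz p) \<and>
     (\<exists>C. \<forall>f\<in>mean_lipschitz p.
        mean_lipschitz_norm p (hankel_op M f) \<le> C * mean_lipschitz_norm p f)"

text \<open>Arcs of the unit circle, with or without their endpoints.\<close>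
definition arc_of_length :: "complex set \<Rightarrow> real \<Rightarrow> bool" where
  "arc_of_length I l \<longleftrightarrow> 0 < l \<and> l \<le> 2 * pi \<and>
     (\<exists>a. cis ` {a<..<a + l} \<subseteq> I \<and> I \<subseteq> cis ` {a..a + l})"

definition carleson_box :: "complex set \<Rightarrow> real \<Rightarrow> complex set" where
  "carleson_box I l =
     {of_real r * cis t | r t. cis t \<in> I \<and> 1 - l / (2 * pi) \<le> r \<and> r < 1}"

text \<open>
  The 1-logarithmic 1-Carleson condition, for a Borel measure on the disc. It is stated in
  \<^typ>\<open>ennreal\<close>, since \<open>N\<close> need not be finite; the logarithm is nonnegative because
  \<open>l \<le> 2 * pi\<close>.
\<close>
definition log_carleson :: "complex measure \<Rightarrow> bool" where
  "log_carleson N \<longleftrightarrow>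
     (\<exists>C>0. \<forall>I l. arc_of_length I l \<longrightarrow>
        emeasure N (carleson_box I l) * ennreal (ln (2 * pi / l)) \<le> ennreal (C * l))"

definition disc_measure :: "real measure \<Rightarrow> complex measure" where
  "disc_measure M = distr M (restrict_space borel (ball 0 1)) complex_of_real"

lemma emeasure_disc_measure:
  assumes M: "sets M = sets (restrict_space borel {0..<1})"
    and A: "A \<in> sets borel" "A \<subseteq> ball 0 1"
  shows "emeasure (disc_measure M) A = emeasure M {t \<in> {0..<1}. complex_of_real t \<in> A}"
proof -
  have space: "space M = {0..<1}"
    using sets_eq_imp_space_eq[OF M] by (simp add: space_restrict_space)
  have meas: "complex_of_real \<in> measurable M (restrict_space borel (ball 0 1))"
  proof (rule measurable_restrict_space2)
    show "complex_of_real \<in> space M \<rightarrow> ball 0 1"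
      by (simp add: space Pi_iff)
    show "complex_of_real \<in> borel_measurable M"
      unfolding measurable_cong_sets[OF M refl]
      by (rule measurable_restrict_space1[OF borel_measurable_of_real])
  qed
  have "A \<in> sets (restrict_space borel (ball 0 1))"
    using A by (simp add: sets_restrict_space_iff)
  then have "emeasure (disc_measure M) A = emeasure M (complex_of_real -` A \<inter> space M)"
    unfolding disc_measure_def by (rule emeasure_distr[OF meas])
  also have "complex_of_real -` A \<inter> space M = {t \<in> {0..<1}. complex_of_real t \<in> A}"
    unfolding space by blast
  finally show ?thesis .
qed

end

theory Submission
  imports Defs "HOL-Real_Asymp.Real_Asymp"
begin

text \<open>
  Two estimates of opposite direction carry the proof. A holomorphic function \<open>F\<close> with
  \<open>|F'(z)| \<le> C / |1 - z|\<close> has at worst a logarithmic singularity at \<open>1\<close>; every such function lies in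
  the mean Lipschitz space, with norm at most a constant times \<open>|F(0)| + C\<close>
  (\<open>log_singular.mean_lipschitz\<close>). Conversely, a function \<open>f\<close> in the mean Lipschitz space with norm
  \<open>N\<close> satisfies \<open>|f'(z)| \<le> K N / (1 - |z|)\<close>, hence grows at most logarithmically along the radius
  \<open>[0,1)\<close>, and its Taylor coefficients are of order \<open>k\<^sup>-\<^sup>1\<^sup>/\<^sup>p\<close> (\<open>mean_lipschitz_deriv_bound\<close>,
  \<open>mean_lipschitz_log_growth\<close>, \<open>mean_lipschitz_coeff_bound\<close>).

  Sufficiency. The condition on \<open>\<mu>\<close> says that \<open>(1 + log (1/(1-t))) d\<mu>(t)\<close> gives mass \<open>O(x)\<close> to
  \<open>[1-x,1)\<close> (\<open>log_weight_tail\<close>). So the moments are \<open>O(1/n)\<close>, the series for the coefficients of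
  \<open>H f\<close> converge absolutely, and \<open>H f(z)\<close> is the integral of \<open>f(t)/(1-tz)\<close>. Its derivative is
  bounded by the integral of \<open>|f(t)| / |1-tz|\<^sup>2\<close>, which is \<open>O(N / |1-z|)\<close> because \<open>|1-tz|\<close> is
  at least a constant times \<open>(1-t) + |1-z|\<close>. The first estimate then applies to \<open>H f\<close>.

  Necessity. The function \<open>-log (1-z)\<close> is in the space by the first estimate. Its image has the
  coefficients \<open>\<beta>\<^sub>n = \<Sum>\<^sub>k \<mu>\<^sub>n\<^sub>+\<^sub>k / k\<close>, which are nonnegative and decreasing, so the derivative bound for
  the image forces \<open>\<beta>\<^sub>n = O(1/n)\<close>. On the other hand \<open>\<beta>\<^sub>n \<ge> \<mu>\<^sub>2\<^sub>n log (n+1)\<close>, and \<open>\<mu>\<^sub>2\<^sub>n\<close> dominates the mass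
  of \<open>[1 - 1/(4n), 1)\<close>. This is the logarithmic Carleson condition.

  The second estimate needs to recover \<open>f\<close> inside the disc from its radial limits, because the
  modulus of continuity only sees these. For \<open>p > 1\<close> the dilates \<open>f(r\<cdot>)\<close> of a function in the Hardy
  space converge in \<open>L\<^sup>1\<close> of the circle: the means of the strictly convex function
  \<open>\<surd>(1 + |f(r\<cdot>)|\<^sup>2)\<close> increase to a limit, so the convexity defect of two late dilates is small
  (\<open>hardy_L1_Cauchy\<close>). A weak-type maximal inequality for Poisson integrals turns this into radial
  convergence almost everywhere (\<open>radial_limit_AE\<close>).
\<close>

section \<open>Kernel integrals and normalised arc length\<close>

text \<open>
  On the shell where \<open>u\<close> is of size \<open>2\<^sup>j d\<close> the kernel is of size \<open>4\<^sup>-\<^sup>j d\<^sup>-\<^sup>2\<close> and the mass at most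
  \<open>2\<^sup>j K d\<close>, so the shells contribute a geometric series. The lemma serves twice: with the angle
  \<open>u = |s|\<close> for Poisson kernels, and with \<open>u = 1 - t\<close> for Carleson measures on the radius.
\<close>
lemma dyadic_kernel_bound:
  fixes u :: "'a \<Rightarrow> real"
  assumes [measurable]: "u \<in> borel_measurable M"
    and u0: "\<And>w. w \<in> space M \<Longrightarrow> 0 \<le> u w" and K: "0 \<le> K" and d: "0 < d"
    and dist: "\<And>x. 0 < x \<Longrightarrow> emeasure M {w \<in> space M. u w \<le> x} \<le> ennreal (K * x)"
  shows "(\<integral>\<^sup>+w. ennreal (1 / (d + u w)\<^sup>2) \<partial>M) \<le> ennreal (8 * K / d)"
proof -
  define A where "A j = {w \<in> space M. u w \<le> 2 ^ j * d}" for j :: nat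
  define c where "c j = 4 / (4 ^ j * d\<^sup>2)" for j :: nat
  have A[measurable]: "A j \<in> sets M" for j
    unfolding A_def by measurable
  have c0: "c j \<ge> 0" for j unfolding c_def by simp
  have pt: "ennreal (1 / (d + u w)\<^sup>2) \<le> (\<Sum>j. ennreal (c j) * indicator (A j) w)" if w: "w \<in> space M" for w
  proof -
    have "\<exists>j. u w \<le> 2 ^ j * d"
      using real_arch_pow[of 2 "u w / d"] d by (auto simp: field_simps intro: less_imp_le)
    then obtain j where j: "u w \<le> 2 ^ j * d" and jmin: "\<And>i. i < j \<Longrightarrow> \<not> u w \<le> 2 ^ i * d"
      using exists_least_iff[of "\<lambda>j. u w \<le> 2 ^ j * d"] by auto
    have "1 / (d + u w)\<^sup>2 \<le> c j"
    proof (cases j)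
      case 0
      have "d\<^sup>2 \<le> (d + u w)\<^sup>2" using u0[OF w] d by (intro power_mono) auto
      then have "1 / (d + u w)\<^sup>2 \<le> 1 / d\<^sup>2" using d by (intro divide_left_mono) (auto intro!: mult_pos_pos)
      also have "\<dots> \<le> c j" unfolding c_def 0 using d by (auto simp: divide_simps)
      finally show ?thesis .
    next
      case (Suc i)
      have "2 ^ i * d \<le> d + u w" using jmin[of i] Suc d by auto
      then have "(2 ^ i * d)\<^sup>2 \<le> (d + u w)\<^sup>2" using d by (intro power_mono) auto
      then have "1 / (d + u w)\<^sup>2 \<le> 1 / (2 ^ i * d)\<^sup>2" using d u0[OF w]
        by (intro divide_left_mono) (auto intro!: mult_pos_pos)
      also have "(2 ^ i * d)\<^sup>2 = 4 ^ i * d\<^sup>2"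
        using power_mult_distrib[of "2::real" 2 i] by (simp add: power2_eq_square)
      also have "1 / (4 ^ i * d\<^sup>2) = c j" unfolding c_def Suc by simp
      finally show ?thesis .
    qed
    then have "ennreal (1 / (d + u w)\<^sup>2) \<le> ennreal (c j) * indicator (A j) w"
      using j w by (simp add: A_def ennreal_leI)
    also have "\<dots> \<le> (\<Sum>j. ennreal (c j) * indicator (A j) w)"
    proof -
      define F where "F i = ennreal (c i) * indicator (A i) w" for i
      show ?thesis using sum_le_suminf[of F "{j}"] unfolding F_def[symmetric] by simp
    qed
    finally show ?thesis .
  qed
  have "(\<integral>\<^sup>+w. ennreal (1 / (d + u w)\<^sup>2) \<partial>M) \<le> (\<integral>\<^sup>+w. (\<Sum>j. ennreal (c j) * indicator (A j) w) \<partial>M)"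
    by (intro nn_integral_mono pt)
  also have "\<dots> = (\<Sum>j. ennreal (c j) * emeasure M (A j))"
    by (simp add: nn_integral_suminf nn_integral_cmult_indicator)
  also have "\<dots> \<le> (\<Sum>j. ennreal (4 * K / d * (1 / 2) ^ j))"
  proof (rule suminf_le)
    fix j
    have "ennreal (c j) * emeasure M (A j) \<le> ennreal (c j) * ennreal (K * (2 ^ j * d))"
      unfolding A_def using d by (intro mult_left_mono dist) auto
    also have "\<dots> = ennreal (c j * (K * (2 ^ j * d)))"
      using c0 K d by (simp add: ennreal_mult)
    also have "(4::real) ^ j = 2 ^ j * 2 ^ j" using power_mult_distrib[of "2::real" 2 j] by simp
    then have "c j * (K * (2 ^ j * d)) = 4 * K / d * (1 / 2) ^ j"
      unfolding c_def using d by (simp add: power2_eq_square field_simps power_divide)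
    finally show "ennreal (c j) * emeasure M (A j) \<le> ennreal (4 * K / d * (1 / 2) ^ j)" .
  qed auto
  also have "\<dots> = ennreal (4 * K / d * 2)"
    using K d by (intro suminf_ennreal_eq sums_mult) (auto intro!: geometric_sums[of "1/2::real", simplified])
  finally show ?thesis by (simp add: mult.assoc)
qed

text \<open>
  A density with respect to \<^const>\<open>lborel\<close>, so that the measurable sets are the Borel sets of the
  whole line and translates of functions on the circle stay measurable.
\<close>
definition circ :: "real measure" where
  "circ = density lborel (\<lambda>x. ennreal (indicator {-pi..pi} x / (2 * pi)))"

lemma sets_circ [simp, measurable_cong]: "sets circ = sets borel"
  by (simp add: circ_def)

lemma space_circ [simp]: "space circ = UNIV"
  by (simp add: circ_def)

lemma nn_integral_circ:
  assumes [measurable]: "h \<in> borel_measurable borel"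
  shows "(\<integral>\<^sup>+x. h x \<partial>circ) = ennreal (1 / (2 * pi)) * (\<integral>\<^sup>+x. h x * indicator {-pi..pi} x \<partial>lborel)"
proof -
  have "(\<integral>\<^sup>+x. h x \<partial>circ) = (\<integral>\<^sup>+x. ennreal (1 / (2 * pi)) * (h x * indicator {-pi..pi} x) \<partial>lborel)"
    unfolding circ_def
    by (subst nn_integral_density) (auto intro!: nn_integral_cong split: split_indicator simp: mult.commute)
  then show ?thesis by (simp add: nn_integral_cmult)
qed

lemma integral_circ:
  fixes h :: "real \<Rightarrow> 'a::{banach, second_countable_topology}"
  assumes [measurable]: "h \<in> borel_measurable borel"
  shows "integral\<^sup>L circ h = (1 / (2 * pi)) *\<^sub>R (LBINT x:{-pi..pi}. h x)"
proof -
  have "integral\<^sup>L circ h = (LBINT x. (1 / (2 * pi)) *\<^sub>R (indicator {-pi..pi} x *\<^sub>R h x))"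
    unfolding circ_def by (subst integral_density) (auto intro!: Bochner_Integration.integral_cong)
  then show ?thesis unfolding set_lebesgue_integral_def by (simp only: integral_scaleR_right)
qed

lemma emeasure_circ_UNIV [simp]: "emeasure circ UNIV = 1"
  using nn_integral_circ[of "\<lambda>_. 1"] by (simp flip: ennreal_mult)

lemma finite_measure_circ [simp, intro]: "finite_measure circ"
  by (rule finite_measureI) simp

lemma AE_circ: "(AE x in circ. P x) \<longleftrightarrow> (AE x in lborel. x \<in> {-pi..pi} \<longrightarrow> P x)"
  unfolding circ_def by (subst AE_density) (auto intro!: AE_cong split: split_indicator)

lemma AE_circ_bounds: "AE x in circ. x \<in> {-pi..pi}"
  unfolding AE_circ by simp

lemma nn_integral_lborel_translate:
  fixes h :: "real \<Rightarrow> ennreal"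
  assumes [measurable]: "h \<in> borel_measurable borel"
  shows "(\<integral>\<^sup>+x. h (x + t) \<partial>lborel) = (\<integral>\<^sup>+x. h x \<partial>lborel)"
  using nn_integral_real_affine[OF assms, of 1 t] by (simp add: add.commute)

lemma nn_integral_even_le:
  fixes \<phi> :: "real \<Rightarrow> ennreal"
  assumes [measurable]: "\<phi> \<in> borel_measurable borel" "A \<in> sets borel"
    and even: "\<And>x. \<phi> (- x) = \<phi> x"
  shows "(\<integral>\<^sup>+x. \<phi> x * indicator A \<bar>x\<bar> \<partial>lborel) \<le> 2 * (\<integral>\<^sup>+x. \<phi> x * indicator A x \<partial>lborel)"
proof -
  have [measurable]: "(\<lambda>x. indicator A (- x) :: ennreal) \<in> borel_measurable borel"
    by (rule measurable_compose[where f = uminus and N = borel]) measurable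
  have "(\<integral>\<^sup>+x. \<phi> x * indicator A \<bar>x\<bar> \<partial>lborel)
      \<le> (\<integral>\<^sup>+x. \<phi> x * indicator A x + \<phi> x * indicator A (- x) \<partial>lborel)"
    by (intro nn_integral_mono) (auto simp: abs_if split: split_indicator)
  also have "\<dots> = (\<integral>\<^sup>+x. \<phi> x * indicator A x \<partial>lborel) + (\<integral>\<^sup>+x. \<phi> x * indicator A (- x) \<partial>lborel)"
    by (intro nn_integral_add) auto
  also have "(\<integral>\<^sup>+x. \<phi> x * indicator A (- x) \<partial>lborel) = (\<integral>\<^sup>+x. \<phi> x * indicator A x \<partial>lborel)"
    by (subst nn_integral_real_affine[where c = "-1" and t = 0]) (simp_all add: even)
  finally show ?thesis unfolding mult_2 .
qed

lemma periodic_2pi_int: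
  fixes h :: "real \<Rightarrow> 'a"
  assumes per: "\<And>x. h (x + 2 * pi) = h x"
  shows "h (x + 2 * pi * of_int k) = h x"
proof (induction k rule: int_induct[where k = 0])
  case (step1 i)
  then show ?case using per[of "x + 2 * pi * of_int i"] by (simp add: algebra_simps)
next
  case (step2 i)
  then show ?case using per[of "x + 2 * pi * of_int (i - 1)"] by (simp add: algebra_simps)
qed simp

text \<open>
  The part of the window beyond \<open>pi\<close> is moved back by one period.
\<close>
lemma nn_integral_period_window:
  fixes h :: "real \<Rightarrow> ennreal"
  assumes [measurable]: "h \<in> borel_measurable borel"
    and per: "\<And>x. h (x + 2 * pi) = h x" and t: "0 \<le> t" "t \<le> 2 * pi"
  shows "(\<integral>\<^sup>+x. h x * indicator {t - pi..t + pi} x \<partial>lborel) = (\<integral>\<^sup>+x. h x * indicator {-pi..pi} x \<partial>lborel)"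
proof -
  have ae: "AE x in lborel. x \<noteq> c" for c :: real by (rule AE_lborel_singleton)
  have "(\<integral>\<^sup>+x. h x * indicator {t - pi..t + pi} x \<partial>lborel)
      = (\<integral>\<^sup>+x. (h x * indicator {t - pi..pi} x + h x * indicator {pi..t + pi} x) \<partial>lborel)"
    using ae[of pi] t by (intro nn_integral_cong_AE) (auto split: split_indicator)
  also have "\<dots> = (\<integral>\<^sup>+x. h x * indicator {t - pi..pi} x \<partial>lborel) + (\<integral>\<^sup>+x. h x * indicator {pi..t + pi} x \<partial>lborel)"
    by (intro nn_integral_add) auto
  also have "(\<integral>\<^sup>+x. h x * indicator {pi..t + pi} x \<partial>lborel)
      = (\<integral>\<^sup>+x. h (x + 2 * pi) * indicator {pi..t + pi} (x + 2 * pi) \<partial>lborel)"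
    by (subst nn_integral_lborel_translate[of "\<lambda>x. h x * indicator {pi..t + pi} x" "2 * pi"]) auto
  also have "\<dots> = (\<integral>\<^sup>+x. h x * indicator {-pi..t - pi} x \<partial>lborel)"
    by (intro nn_integral_cong) (auto simp: per split: split_indicator)
  also have "(\<integral>\<^sup>+x. h x * indicator {t - pi..pi} x \<partial>lborel) + (\<integral>\<^sup>+x. h x * indicator {-pi..t - pi} x \<partial>lborel)
      = (\<integral>\<^sup>+x. (h x * indicator {t - pi..pi} x + h x * indicator {-pi..t - pi} x) \<partial>lborel)"
    by (intro nn_integral_add[symmetric]) auto
  also have "\<dots> = (\<integral>\<^sup>+x. h x * indicator {-pi..pi} x \<partial>lborel)"
  proof (rule nn_integral_cong_AE)
    show "AE x in lborel. h x * indicator {t - pi..pi} x + h x * indicator {-pi..t - pi} x = h x * indicator {-pi..pi} x"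
      using ae[of "t - pi"]
    proof eventually_elim
      case (elim x)
      have "indicator {t - pi..pi} x + indicator {-pi..t - pi} x = (indicator {-pi..pi} x :: ennreal)"
      proof (cases "x < t - pi")
        case True
        then have "x \<le> pi" using t by linarith
        with True show ?thesis by (simp add: indicator_def)
      next
        case False
        with elim have "t - pi < x" "- pi \<le> x" using t by linarith+
        then show ?thesis by (simp add: indicator_def)
      qed
      then show ?case by (simp flip: distrib_left)
    qed
  qed
  finally show ?thesis .
qed

lemma nn_integral_circ_shift:
  fixes h :: "real \<Rightarrow> ennreal"
  assumes [measurable]: "h \<in> borel_measurable borel" and per: "\<And>x. h (x + 2 * pi) = h x"
  shows "(\<integral>\<^sup>+x. h (x + t) \<partial>circ) = (\<integral>\<^sup>+x. h x \<partial>circ)"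
proof -
  define k where "k = \<lfloor>t / (2 * pi)\<rfloor>"
  define s where "s = t - 2 * pi * of_int k"
  have "of_int k \<le> t / (2 * pi)" "t / (2 * pi) < of_int k + 1" unfolding k_def by linarith+
  then have s: "0 \<le> s" "s \<le> 2 * pi" unfolding s_def by (auto simp: field_simps)
  have hs: "h (x + t) = h (x + s)" for x
    using periodic_2pi_int[of h "x + s" k, OF per] by (simp add: s_def algebra_simps)
  have "(\<integral>\<^sup>+x. h (x + t) * indicator {-pi..pi} x \<partial>lborel)
      = (\<integral>\<^sup>+x. h (x + s) * indicator {s - pi..s + pi} (x + s) \<partial>lborel)"
    unfolding hs by (intro nn_integral_cong) (auto split: split_indicator)
  also have "\<dots> = (\<integral>\<^sup>+x. h x * indicator {-pi..pi} x \<partial>lborel)"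
    using nn_integral_period_window[of h s] s per
    by (subst nn_integral_lborel_translate[of "\<lambda>x. h x * indicator {s - pi..s + pi} x" s]) auto
  finally show ?thesis by (simp add: nn_integral_circ)
qed

lemma nn_integral_two_periods:
  fixes h :: "real \<Rightarrow> ennreal"
  assumes [measurable]: "h \<in> borel_measurable borel" and per: "\<And>x. h (x + 2 * pi) = h x"
  shows "(\<integral>\<^sup>+x. h x * indicator {-2 * pi..2 * pi} x \<partial>lborel) \<le> 2 * (\<integral>\<^sup>+x. h x * indicator {-pi..pi} x \<partial>lborel)"
proof -
  have "(\<integral>\<^sup>+x. h x * indicator {-2 * pi..2 * pi} x \<partial>lborel)
     \<le> (\<integral>\<^sup>+x. (h x * indicator {0..2 * pi} x + h x * indicator {-2 * pi..0} x) \<partial>lborel)"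
    by (intro nn_integral_mono) (auto split: split_indicator)
  also have "\<dots> = (\<integral>\<^sup>+x. h x * indicator {0..2 * pi} x \<partial>lborel) + (\<integral>\<^sup>+x. h x * indicator {-2 * pi..0} x \<partial>lborel)"
    by (intro nn_integral_add) auto
  also have "(\<integral>\<^sup>+x. h x * indicator {-2 * pi..0} x \<partial>lborel)
      = (\<integral>\<^sup>+x. h (x + 2 * pi) * indicator {0..2 * pi} (x + 2 * pi) \<partial>lborel)"
    unfolding per by (intro nn_integral_cong) (auto split: split_indicator)
  also have "\<dots> = (\<integral>\<^sup>+x. h x * indicator {0..2 * pi} x \<partial>lborel)"
    by (subst nn_integral_lborel_translate[of "\<lambda>x. h x * indicator {0..2 * pi} x" "2 * pi"]) auto
  also have "(\<integral>\<^sup>+x. h x * indicator {0..2 * pi} x \<partial>lborel) = (\<integral>\<^sup>+x. h x * indicator {-pi..pi} x \<partial>lborel)"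
    using nn_integral_period_window[of h pi] per by simp
  finally show ?thesis unfolding mult_2 .
qed

section \<open>The Poisson kernel and its maximal function\<close>

text \<open>
  The range extends beyond \<open>pi / 2\<close> so that the estimates below also cover angles \<open>\<theta> + t\<close> that
  leave \<open>[-pi, pi]\<close>.
\<close>
lemma sin_ge_sixth:
  assumes "0 \<le> y" "y \<le> 5 * pi / 6"
  shows "y / 6 \<le> sin y"
proof (cases "y \<le> pi / 3")
  case True
  have "sin 0 - 0 / 2 \<le> sin y - y / 2"
  proof (rule DERIV_nonneg_imp_nondecreasing[OF assms(1)], intro exI conjI)
    fix x assume x: "0 \<le> x" "x \<le> y"
    show "((\<lambda>x. sin x - x / 2) has_real_derivative cos x - 1 / 2) (at x)"
      by (auto intro!: derivative_eq_intros)
    have "cos (pi / 3) \<le> cos x" using x True by (intro cos_monotone_0_pi_le) auto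
    then show "0 \<le> cos x - 1 / 2" by (simp add: cos_60)
  qed
  with assms show ?thesis by simp
next
  case False
  have 6: "y / 6 \<le> 1 / 2" using assms pi_less_4 pi_approx by simp
  have "1 / 2 \<le> sin y"
  proof (cases "y \<le> pi / 2")
    case True
    have "sin (pi / 6) \<le> sin y" using True False by (intro sin_monotone_2pi_le) auto
    then show ?thesis by (simp add: sin_30)
  next
    case F: False
    have "sin (pi / 6) \<le> sin (pi - y)" using F assms by (intro sin_monotone_2pi_le) auto
    then show ?thesis by (simp add: sin_30)
  qed
  with 6 show ?thesis by simp
qed

lemma norm_one_minus_cis: "cmod (1 - cis s) = 2 * \<bar>sin (s / 2)\<bar>"
  using dist_exp_i_1[of s] by (simp add: cis_conv_exp norm_minus_commute)

lemma norm_one_minus_cis_ge: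
  assumes "\<bar>s\<bar> \<le> 5 * pi / 3"
  shows "\<bar>s\<bar> / 6 \<le> cmod (1 - cis s)"
proof -
  have "\<bar>s\<bar> / 2 / 6 \<le> sin (\<bar>s\<bar> / 2)" using assms by (intro sin_ge_sixth) auto
  also have "\<dots> \<le> \<bar>sin (s / 2)\<bar>" by (cases "s \<ge> 0") auto
  finally show ?thesis by (simp add: norm_one_minus_cis)
qed

lemma norm_one_minus_scaled:
  fixes z :: complex
  assumes t: "0 \<le> t" "t \<le> 1" and z: "cmod z \<le> 1"
  shows "1 - t \<le> cmod (1 - of_real t * z)" "cmod (1 - z) \<le> 2 * cmod (1 - of_real t * z)"
proof -
  have "cmod (of_real t * z) \<le> t" using t z by (simp add: norm_mult mult_left_le)
  then show 1: "1 - t \<le> cmod (1 - of_real t * z)"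
    using norm_triangle_ineq2[of 1 "of_real t * z"] by simp
  have "1 - z = (1 - of_real t * z) - of_real (1 - t) * z" by (simp add: algebra_simps)
  then have "cmod (1 - z) \<le> cmod (1 - of_real t * z) + cmod (of_real (1 - t) * z)"
    by (metis norm_triangle_ineq4)
  also have "cmod (of_real (1 - t) * z) \<le> 1 - t"
    using t z by (simp only: norm_mult norm_of_real) (simp add: mult_left_le)
  finally show "cmod (1 - z) \<le> 2 * cmod (1 - of_real t * z)" using 1 by simp
qed

lemma norm_one_minus_polar_ge:
  assumes "0 \<le> r" "r \<le> 1" "\<bar>s\<bar> \<le> 5 * pi / 3"
  shows "(1 - r + \<bar>s\<bar>) / 24 \<le> cmod (1 - of_real r * cis s)"
  using norm_one_minus_scaled[of r "cis s"] norm_one_minus_cis_ge[of s] assms by simp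

definition poisson_kernel :: "real \<Rightarrow> real \<Rightarrow> real" where
  "poisson_kernel r s = (1 - r\<^sup>2) / (cmod (1 - of_real r * cis s))\<^sup>2"

lemma one_minus_polar_nonzero: "0 \<le> r \<Longrightarrow> r < 1 \<Longrightarrow> 1 - complex_of_real r * cis s \<noteq> 0"
  using norm_one_minus_scaled(1)[of r "cis s"] by auto

lemma poisson_kernel_nonneg: "0 \<le> r \<Longrightarrow> r < 1 \<Longrightarrow> 0 \<le> poisson_kernel r s"
  unfolding poisson_kernel_def by (intro divide_nonneg_nonneg) (auto simp: power_le_one)

lemma continuous_on_poisson_kernel:
  assumes "0 \<le> r" "r < 1"
  shows "continuous_on A (poisson_kernel r)"
  unfolding poisson_kernel_def using one_minus_polar_nonzero[OF assms]
  by (auto intro!: continuous_intros)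

lemma poisson_kernel_measurable [measurable]: "poisson_kernel r \<in> borel_measurable borel"
  unfolding poisson_kernel_def by (intro borel_measurable_divide borel_measurable_power
    borel_measurable_norm borel_measurable_continuous_onI continuous_intros borel_measurable_const)

lemma poisson_kernel_le:
  assumes r: "0 \<le> r" "r < 1"
  shows "poisson_kernel r s \<le> 2 / (1 - r)"
proof -
  have "(1 - r)\<^sup>2 \<le> (cmod (1 - of_real r * cis s))\<^sup>2"
    using norm_one_minus_scaled(1)[of r "cis s"] r by (intro power_mono) auto
  then have "poisson_kernel r s \<le> (1 - r\<^sup>2) / (1 - r)\<^sup>2"
    unfolding poisson_kernel_def using r one_minus_polar_nonzero[OF r]
    by (intro divide_left_mono) (auto intro!: mult_pos_pos simp: power_le_one)
  also have "\<dots> = (1 + r) / (1 - r)"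
    using r by (simp add: power2_eq_square divide_simps) (simp add: algebra_simps)
  also have "\<dots> \<le> 2 / (1 - r)" using r by (intro divide_right_mono) auto
  finally show ?thesis .
qed

lemma poisson_kernel_decay:
  assumes r: "0 \<le> r" "r < 1" and s: "\<bar>s\<bar> \<le> pi"
  shows "poisson_kernel r s \<le> 1152 * (1 - r) * (1 / (1 - r + \<bar>s\<bar>)\<^sup>2)"
proof -
  have pos: "0 < 1 - r + \<bar>s\<bar>" using r by simp
  have "((1 - r + \<bar>s\<bar>) / 24)\<^sup>2 \<le> (cmod (1 - of_real r * cis s))\<^sup>2"
    using norm_one_minus_polar_ge[of r s] r s by (intro power_mono) auto
  then have "poisson_kernel r s \<le> (1 - r\<^sup>2) / ((1 - r + \<bar>s\<bar>) / 24)\<^sup>2"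
    unfolding poisson_kernel_def using r one_minus_polar_nonzero[OF r] pos
    by (intro divide_left_mono) (auto intro!: mult_pos_pos simp: power_le_one)
  also have "\<dots> = 576 * (1 - r\<^sup>2) * (1 / (1 - r + \<bar>s\<bar>)\<^sup>2)"
    by (simp add: power_divide)
  also have "\<dots> \<le> 1152 * (1 - r) * (1 / (1 - r + \<bar>s\<bar>)\<^sup>2)"
  proof (rule mult_right_mono)
    have "1 - r\<^sup>2 = (1 - r) * (1 + r)" by (simp add: power2_eq_square algebra_simps)
    also have "\<dots> \<le> (1 - r) * 2" using r by (intro mult_left_mono) auto
    finally show "576 * (1 - r\<^sup>2) \<le> 1152 * (1 - r)" by simp
  qed simp
  finally show ?thesis .
qed

lemma integrable_circ_continuous:
  fixes h :: "real \<Rightarrow> 'a::{banach, second_countable_topology}"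
  assumes "continuous_on UNIV h"
  shows "integrable circ h"
proof -
  have [measurable]: "h \<in> borel_measurable borel"
    using assms by (rule borel_measurable_continuous_onI)
  have "bounded (h ` {-pi..pi})"
    by (intro compact_imp_bounded compact_continuous_image) (use assms continuous_on_subset in auto)
  then obtain B where B: "\<And>x. x \<in> {-pi..pi} \<Longrightarrow> norm (h x) \<le> B"
    unfolding bounded_iff by blast
  show ?thesis
  proof (rule finite_measure.integrable_const_bound[OF finite_measure_circ])
    show "AE x in circ. norm (h x) \<le> B"
      using AE_circ_bounds by (rule eventually_mono) (rule B)
  qed simp
qed

text \<open>
  This is Cauchy's formula at the point \<open>r\<close> for the function \<open>h(e\<^sup>i\<^sup>\<alpha> w) (1 - r\<^sup>2) / (1 - r w)\<close>: the
  additional factor equals \<open>1\<close> at \<open>w = r\<close> and turns the Cauchy kernel into the Poisson kernel.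
\<close>
lemma poisson_formula:
  assumes hol: "h holomorphic_on ball 0 R" and R: "1 < R" and r: "0 \<le> r" "r < 1"
  shows "h (of_real r * cis \<alpha>) = (LINT s|circ. poisson_kernel r s *\<^sub>R h (cis (\<alpha> + s)))"
proof -
  define F where "F w = h (cis \<alpha> * w) * (1 - of_real r ^ 2) / (1 - of_real r * w)" for w
  have nz: "1 - of_real r * w \<noteq> 0" if "cmod w \<le> 1" for w
    using norm_one_minus_scaled(1)[of r w] r that by auto
  have holF: "F holomorphic_on cball 0 1" unfolding F_def
  proof (intro holomorphic_intros)
    show "(\<lambda>w. h (cis \<alpha> * w)) holomorphic_on cball 0 1"
      by (rule holomorphic_on_compose_gen[OF _ hol, unfolded o_def])
        (use R in \<open>auto intro!: holomorphic_intros simp: norm_mult\<close>)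
  qed (use nz in auto)
  have holF': "(\<lambda>w. F (- w)) holomorphic_on cball 0 1"
    by (rule holomorphic_on_compose_gen[OF _ holF, unfolded o_def]) (auto intro!: holomorphic_intros)
  define g where "g s = F (cis s) / (cis s - of_real r) * (\<i> * cis s)" for s
  \<comment> \<open>Reflecting \<open>w\<close> to \<open>-w\<close> moves the parameter interval of the circle from \<open>[0, 2 pi]\<close> to \<open>[-pi, pi]\<close>.\<close>
  have "((\<lambda>u. F (- u) / (u - (- of_real r))) has_contour_integral (2 * of_real pi * \<i> * F (- (- of_real r)))) (circlepath 0 1)"
    by (rule Cauchy_integral_circlepath_simple[OF holF']) (use r in auto)
  then have "((\<lambda>t. F (- cis t) / (cis t + of_real r) * (\<i> * cis t)) has_integral (2 * of_real pi * \<i> * F (of_real r))) {0..2 * pi}"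
    unfolding circlepath_def by (subst (asm) has_contour_integral_part_circlepath_iff) (auto simp: mult.assoc)
  moreover have "F (- cis t) / (cis t + of_real r) * (\<i> * cis t) = g (t - pi)" for t
  proof -
    have "cis (t - pi) = - cis t" by (simp add: complex_eq_iff sin_diff cos_diff)
    moreover have "x / (a + b) * (\<i> * a) = x / (- a - b) * (\<i> * (- a))" for x a b :: complex
      by (simp add: divide_simps) (auto simp: add_eq_0_iff algebra_simps)
    ultimately show ?thesis unfolding g_def by simp
  qed
  ultimately have "((\<lambda>t. g (t - pi)) has_integral (2 * of_real pi * \<i> * F (of_real r))) {0..2 * pi}"
    by simp
  then have int: "integral {0..2 * pi} (\<lambda>t. g (t - pi)) = 2 * of_real pi * \<i> * F (of_real r)"
    by blast
  have rF: "F (of_real r) = h (of_real r * cis \<alpha>)"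
    unfolding F_def using nz[of "of_real r"] r by (simp add: power2_eq_square mult.commute)
  have nzc: "cis s - of_real r \<noteq> 0" for s
  proof -
    have "cmod (cis s) \<noteq> cmod (of_real r)" using r by simp
    then show ?thesis by (metis eq_iff_diff_eq_0)
  qed
  have gc: "continuous_on UNIV g"
    unfolding g_def
    by (intro continuous_intros continuous_on_compose2[OF holomorphic_on_imp_continuous_on[OF holF]])
      (use nzc in auto)
  have [measurable]: "g \<in> borel_measurable borel"
    using gc by (rule borel_measurable_continuous_onI)
  have "set_integrable lborel {0..2 * pi} (\<lambda>t. g (t - pi))"
    by (rule borel_integrable_atLeastAtMost')
      (auto intro!: continuous_on_compose2[OF gc] continuous_intros)
  then have "(LBINT t:{0..2 * pi}. g (t - pi)) = 2 * of_real pi * \<i> * F (of_real r)"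
    using set_borel_integral_eq_integral(2) int by metis
  moreover have "(LBINT t:{0..2 * pi}. g (t - pi)) = (LBINT t:{-pi..pi}. g t)"
    unfolding set_lebesgue_integral_def
    by (subst lborel_integral_real_affine[where c = 1 and t = pi])
      (auto intro!: Bochner_Integration.integral_cong split: split_indicator)
  ultimately have "(LINT s|circ. g s) = \<i> * h (of_real r * cis \<alpha>)"
    by (simp add: integral_circ rF scaleR_conv_of_real)
  moreover have "g s = \<i> * (poisson_kernel r s *\<^sub>R h (cis (\<alpha> + s)))" for s
  proof -
    have "(cmod (1 - of_real r * cis s))\<^sup>2 = (1 - of_real r * cis s) * cnj (1 - of_real r * cis s)"
      by (rule complex_norm_square)
    also have "cnj (1 - of_real r * cis s) = (cis s - of_real r) / cis s"
      using cis_mult[of s "- s"] by (simp add: cis_cnj divide_simps algebra_simps)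
    finally show ?thesis
      unfolding g_def F_def poisson_kernel_def scaleR_conv_of_real of_real_divide
      by (simp add: cis_mult)
  qed
  ultimately have "(LINT s|circ. \<i> * (poisson_kernel r s *\<^sub>R h (cis (\<alpha> + s)))) = \<i> * h (of_real r * cis \<alpha>)"
    by simp
  then show ?thesis by (subst (asm) integral_mult_right_zero) simp
qed

lemma integral_poisson_kernel:
  assumes "0 \<le> r" "r < 1"
  shows "(LINT s|circ. poisson_kernel r s) = 1"
proof -
  have "(LINT s|circ. poisson_kernel r s *\<^sub>R (1::complex)) = 1"
    using poisson_formula[of "\<lambda>_. 1" 2 r 0] assms by auto
  then have "complex_of_real (LINT s|circ. poisson_kernel r s) = 1"
    by (simp add: scaleR_conv_of_real)
  then show ?thesis by simp
qed

lemma nn_integral_poisson_kernel: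
  assumes "0 \<le> r" "r < 1"
  shows "(\<integral>\<^sup>+s. ennreal (poisson_kernel r s) \<partial>circ) = 1"
  by (subst nn_integral_eq_integral)
    (use assms in \<open>auto intro!: integrable_circ_continuous continuous_on_poisson_kernel AE_I2 poisson_kernel_nonneg
      simp: integral_poisson_kernel\<close>)

lemma poisson_bound:
  assumes hol: "h holomorphic_on ball 0 R" and R: "1 < R" and r: "0 \<le> r" "r < 1"
  shows "ennreal (cmod (h (of_real r * cis \<alpha>))) \<le> (\<integral>\<^sup>+s. ennreal (poisson_kernel r s) * ennreal (cmod (h (cis (\<alpha> + s)))) \<partial>circ)"
proof -
  have hc: "continuous_on UNIV (\<lambda>s. h (cis (\<alpha> + s)))"
    by (intro continuous_on_compose2[OF holomorphic_on_imp_continuous_on[OF hol]] continuous_intros)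
      (use R in auto)
  have c: "continuous_on UNIV (\<lambda>s. poisson_kernel r s *\<^sub>R h (cis (\<alpha> + s)))"
    using hc continuous_on_poisson_kernel[OF r] by (auto intro!: continuous_intros)
  have "cmod (h (of_real r * cis \<alpha>)) \<le> (LINT s|circ. cmod (poisson_kernel r s *\<^sub>R h (cis (\<alpha> + s))))"
    unfolding poisson_formula[OF assms] by (rule integral_norm_bound)
  then have "ennreal (cmod (h (of_real r * cis \<alpha>))) \<le> ennreal (LINT s|circ. cmod (poisson_kernel r s *\<^sub>R h (cis (\<alpha> + s))))"
    by (rule ennreal_leI)
  also have "\<dots> = (\<integral>\<^sup>+s. ennreal (cmod (poisson_kernel r s *\<^sub>R h (cis (\<alpha> + s)))) \<partial>circ)"
    by (intro nn_integral_eq_integral[symmetric] integrable_circ_continuous continuous_on_norm[OF c]) auto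
  also have "\<dots> = (\<integral>\<^sup>+s. ennreal (poisson_kernel r s) * ennreal (cmod (h (cis (\<alpha> + s)))) \<partial>circ)"
    using poisson_kernel_nonneg[OF r] by (simp add: ennreal_mult)
  finally show ?thesis .
qed


text \<open>
  The Hardy-Littlewood inequality: select by Vitali's covering lemma disjoint intervals on which the
  average exceeds \<open>\<kappa>\<close> and whose fivefold enlargements cover the exceptional set. A Borel superset
  \<open>B\<close> of that set is all that is needed.
\<close>
lemma weak_type_maximal:
  fixes h :: "real \<Rightarrow> ennreal"
  assumes h[measurable]: "h \<in> borel_measurable borel" and per: "\<And>x. h (x + 2 * pi) = h x"
    and l: "0 < \<kappa>"
  obtains B where "B \<in> sets borel" "emeasure circ B \<le> ennreal (10 / \<kappa>) * (\<integral>\<^sup>+x. h x \<partial>circ)"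
    "\<And>\<alpha> s. \<alpha> \<in> {-pi..pi} - B \<Longrightarrow> 0 < s \<Longrightarrow> s \<le> pi \<Longrightarrow>
       (\<integral>\<^sup>+x. h x * indicator (cball \<alpha> s) x \<partial>lborel) \<le> ennreal (2 * s * \<kappa>)"
proof -
  define \<nu> where "\<nu> = density lborel h"
  have \<nu>: "emeasure \<nu> A = (\<integral>\<^sup>+x. h x * indicator A x \<partial>lborel)" if "A \<in> sets borel" for A
    unfolding \<nu>_def using that by (simp add: emeasure_density)
  define K where "K = {(\<alpha>, s). \<alpha> \<in> {-pi..pi} \<and> 0 < s \<and> s \<le> pi \<and> ennreal (2 * s * \<kappa>) < emeasure \<nu> (cball \<alpha> s)}"
  have K: "0 < snd i \<and> snd i \<le> pi" if "i \<in> K" for i using that by (auto simp: K_def)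
  obtain C where C: "countable C" "C \<subseteq> K"
     "pairwise (\<lambda>i j. disjnt (cball (fst i) (snd i)) (cball (fst j) (snd j))) C"
     "fst ` K \<subseteq> (\<Union>i\<in>C. cball (fst i) (5 * snd i))"
    by (rule Vitali_covering_lemma_cballs[where S = "fst ` K" and K = K and a = fst and r = snd and B = pi]) (use K in force)+
  define f where "f = to_nat_on C"
  have f: "inj_on f C" unfolding f_def using C(1) by (rule inj_on_to_nat_on)
  define g where "g = inv_into C f"
  define D where "D n = (if n \<in> f ` C then cball (fst (g n)) (snd (g n)) else {})" for n
  define E where "E n = (if n \<in> f ` C then cball (fst (g n)) (5 * snd (g n)) else {})" for n
  have gf: "g (f i) = i" if "i \<in> C" for i unfolding g_def using f that by simp
  have gC: "g n \<in> C" if "n \<in> f ` C" for n using that gf by auto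
  have disj: "disjoint_family D"
    unfolding disjoint_family_on_def
  proof (intro ballI impI)
    fix m n :: nat assume mn: "m \<noteq> n"
    show "D m \<inter> D n = {}"
    proof (cases "m \<in> f ` C \<and> n \<in> f ` C")
      case True
      then have "g m \<noteq> g n" using mn gf by auto
      then show ?thesis using True C(3) gC unfolding D_def pairwise_def disjnt_def by auto
    qed (auto simp: D_def)
  qed
  have EB: "fst ` K \<subseteq> (\<Union>n. E n)"
  proof
    fix x assume "x \<in> fst ` K"
    then obtain i where "i \<in> C" "x \<in> cball (fst i) (5 * snd i)" using C(4) by blast
    then have "x \<in> E (f i)" by (simp add: E_def gf)
    then show "x \<in> (\<Union>n. E n)" by blast
  qed
  have ED: "emeasure lborel (E n) \<le> ennreal (5 / \<kappa>) * emeasure \<nu> (D n)" for n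
  proof (cases "n \<in> f ` C")
    case True
    define a s where "a = fst (g n)" "s = snd (g n)"
    have gn: "g n \<in> K" using True gC C(2) by blast
    have s: "0 < s" and lt: "ennreal (2 * s * \<kappa>) < emeasure \<nu> (cball a s)"
      using gn unfolding K_def a_s_def by auto
    have "emeasure lborel (E n) = ennreal (10 * s)"
      unfolding E_def using True s by (simp add: a_s_def[symmetric] cball_eq_atLeastAtMost)
    also have "\<dots> = ennreal (5 / \<kappa>) * ennreal (2 * s * \<kappa>)"
      using l s by (simp flip: ennreal_mult)
    also have "\<dots> \<le> ennreal (5 / \<kappa>) * emeasure \<nu> (D n)"
      using lt True unfolding D_def by (intro mult_left_mono) (auto simp: a_s_def)
    finally show ?thesis .
  qed (simp add: E_def)
  have Esets: "range E \<subseteq> sets lborel" by (auto simp: E_def)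
  have Dsets: "range D \<subseteq> sets \<nu>" by (auto simp: D_def \<nu>_def)
  have Dsub: "(\<Union>n. D n) \<subseteq> {-2 * pi..2 * pi}"
  proof
    fix x assume "x \<in> (\<Union>n. D n)"
    then obtain n where "x \<in> D n" by blast
    then have n: "n \<in> f ` C" "x \<in> cball (fst (g n)) (snd (g n))" by (auto simp: D_def split: if_splits)
    then have "g n \<in> K" using gC C(2) by blast
    then show "x \<in> {-2 * pi..2 * pi}" using n(2) by (auto simp: K_def dist_real_def)
  qed
  have "emeasure lborel (\<Union>n. E n) \<le> (\<Sum>n. emeasure lborel (E n))"
    by (rule emeasure_subadditive_countably[OF Esets])
  also have "\<dots> \<le> (\<Sum>n. ennreal (5 / \<kappa>) * emeasure \<nu> (D n))"
    by (intro suminf_le ED) auto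
  also have "\<dots> = ennreal (5 / \<kappa>) * emeasure \<nu> (\<Union>n. D n)"
    by (simp add: suminf_emeasure[OF Dsets disj])
  also have "\<dots> \<le> ennreal (5 / \<kappa>) * emeasure \<nu> {-2 * pi..2 * pi}"
    using Dsub by (intro mult_left_mono emeasure_mono) (auto simp: \<nu>_def)
  also have "\<dots> \<le> ennreal (5 / \<kappa>) * (2 * (\<integral>\<^sup>+x. h x * indicator {-pi..pi} x \<partial>lborel))"
    using nn_integral_two_periods[OF h per] by (intro mult_left_mono) (simp_all add: \<nu>)
  finally have 1: "emeasure lborel (\<Union>n. E n) \<le> ennreal (5 / \<kappa>) * (2 * (\<integral>\<^sup>+x. h x * indicator {-pi..pi} x \<partial>lborel))" .
  have Em: "(\<Union>n. E n) \<in> sets borel" using Esets by auto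
  have "emeasure circ (\<Union>n. E n) = (\<integral>\<^sup>+x. indicator (\<Union>n. E n) x \<partial>circ)"
    using Em by simp
  also have "\<dots> = ennreal (1 / (2 * pi)) * (\<integral>\<^sup>+x. indicator (\<Union>n. E n) x * indicator {-pi..pi} x \<partial>lborel)"
    using Em by (intro nn_integral_circ) auto
  also have "\<dots> \<le> ennreal (1 / (2 * pi)) * (\<integral>\<^sup>+x. indicator (\<Union>n. E n) x \<partial>lborel)"
    by (intro mult_left_mono nn_integral_mono) (auto split: split_indicator)
  also have "\<dots> = ennreal (1 / (2 * pi)) * emeasure lborel (\<Union>n. E n)"
    using Em by simp
  also have "\<dots> \<le> ennreal (1 / (2 * pi)) * (ennreal (5 / \<kappa>) * (2 * (\<integral>\<^sup>+x. h x * indicator {-pi..pi} x \<partial>lborel)))"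
    by (intro mult_left_mono 1) auto
  also have "\<dots> = ennreal (5 / \<kappa>) * 2 * (\<integral>\<^sup>+x. h x \<partial>circ)"
    by (simp add: nn_integral_circ mult_ac)
  also have "ennreal (5 / \<kappa>) * 2 = ennreal (10 / \<kappa>)"
    using l ennreal_mult[of "5 / \<kappa>" 2] by simp
  finally have 2: "emeasure circ (\<Union>n. E n) \<le> ennreal (10 / \<kappa>) * (\<integral>\<^sup>+x. h x \<partial>circ)" .
  show ?thesis
  proof (rule that[OF Em 2])
    fix \<alpha> s assume a: "\<alpha> \<in> {-pi..pi} - (\<Union>n. E n)" and s: "0 < s" "s \<le> pi"
    have "(\<alpha>, s) \<notin> K" using a EB by (metis Diff_iff fst_conv imageI subsetD)
    then show "(\<integral>\<^sup>+x. h x * indicator (cball \<alpha> s) x \<partial>lborel) \<le> ennreal (2 * s * \<kappa>)"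
      using a s by (auto simp: K_def \<nu> not_less)
  qed
qed

text \<open>
  Where all averages of \<open>h\<close> around \<open>\<alpha>\<close> are at most \<open>\<kappa>\<close>, the measure \<open>h(\<alpha> + s) ds\<close> gives mass
  \<open>O(\<kappa> x)\<close> to \<open>|s| \<le> x\<close>, and \<open>dyadic_kernel_bound\<close> applies to the decay of the Poisson kernel, uniformly in \<open>r\<close>.
\<close>
lemma weak_type_poisson:
  fixes h :: "real \<Rightarrow> ennreal"
  assumes h[measurable]: "h \<in> borel_measurable borel" and per: "\<And>x. h (x + 2 * pi) = h x"
    and l: "0 < \<kappa>"
  obtains B where "B \<in> sets borel" "emeasure circ B \<le> ennreal (10 / \<kappa>) * (\<integral>\<^sup>+x. h x \<partial>circ)"
    "\<And>\<alpha> r. \<alpha> \<in> {-pi..pi} - B \<Longrightarrow> 0 \<le> r \<Longrightarrow> r < 1 \<Longrightarrow>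
       (\<integral>\<^sup>+s. ennreal (poisson_kernel r s) * h (\<alpha> + s) \<partial>circ) \<le> ennreal (9216 * \<kappa>)"
proof -
  obtain B where B: "B \<in> sets borel" "emeasure circ B \<le> ennreal (10 / \<kappa>) * (\<integral>\<^sup>+x. h x \<partial>circ)"
    and avg: "\<And>\<alpha> s. \<alpha> \<in> {-pi..pi} - B \<Longrightarrow> 0 < s \<Longrightarrow> s \<le> pi \<Longrightarrow>
       (\<integral>\<^sup>+x. h x * indicator (cball \<alpha> s) x \<partial>lborel) \<le> ennreal (2 * s * \<kappa>)"
    using weak_type_maximal[OF assms] by metis
  show ?thesis
  proof (rule that[OF B])
    fix \<alpha> r :: real assume a: "\<alpha> \<in> {-pi..pi} - B" and r: "0 \<le> r" "r < 1"
    define \<nu> where "\<nu> = density circ (\<lambda>s. h (\<alpha> + s))"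
    have dist: "emeasure \<nu> {s \<in> space \<nu>. \<bar>s\<bar> \<le> x} \<le> ennreal (\<kappa> * x)" if x: "0 < x" for x
    proof -
      define y where "y = min x pi"
      have y: "0 < y" "y \<le> pi" "y \<le> x" using x by (auto simp: y_def)
      have "emeasure \<nu> {s \<in> space \<nu>. \<bar>s\<bar> \<le> x} = (\<integral>\<^sup>+s. h (\<alpha> + s) * indicator {s. \<bar>s\<bar> \<le> x} s \<partial>circ)"
        unfolding \<nu>_def by (subst emeasure_density) auto
      also have "\<dots> = ennreal (1 / (2 * pi)) * (\<integral>\<^sup>+s. h (\<alpha> + s) * indicator {s. \<bar>s\<bar> \<le> x} s * indicator {-pi..pi} s \<partial>lborel)"
        by (subst nn_integral_circ) auto
      also have "(\<integral>\<^sup>+s. h (\<alpha> + s) * indicator {s. \<bar>s\<bar> \<le> x} s * indicator {-pi..pi} s \<partial>lborel)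
         = (\<integral>\<^sup>+s. h (s + \<alpha>) * indicator (cball \<alpha> y) (s + \<alpha>) \<partial>lborel)"
        by (intro nn_integral_cong) (auto simp: y_def dist_real_def add.commute split: split_indicator)
      also have "\<dots> = (\<integral>\<^sup>+s. h s * indicator (cball \<alpha> y) s \<partial>lborel)"
        by (rule nn_integral_lborel_translate[of "\<lambda>s. h s * indicator (cball \<alpha> y) s" \<alpha>])
            (intro borel_measurable_times_ennreal h borel_measurable_indicator; simp)
      also have "\<dots> \<le> ennreal (2 * y * \<kappa>)" using avg[OF a] y by simp
      also have "ennreal (1 / (2 * pi)) * ennreal (2 * y * \<kappa>) = ennreal (y * \<kappa> / pi)"
        using y l by (simp flip: ennreal_mult)
      also have "\<dots> \<le> ennreal (\<kappa> * x)"
      proof (rule ennreal_leI)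
        have "y * \<kappa> / pi \<le> y * \<kappa> / 1" using y l pi_gt3 by (intro divide_left_mono) auto
        also have "\<dots> \<le> \<kappa> * x" using y l by (simp add: mult.commute)
        finally show "y * \<kappa> / pi \<le> \<kappa> * x" .
      qed
      finally show ?thesis by (simp add: mult_left_mono)
    qed
    have d: "(\<integral>\<^sup>+s. ennreal (1 / (1 - r + \<bar>s\<bar>)\<^sup>2) \<partial>\<nu>) \<le> ennreal (8 * \<kappa> / (1 - r))"
      using dist r l by (intro dyadic_kernel_bound) (auto simp: \<nu>_def)
    have "(\<integral>\<^sup>+s. ennreal (poisson_kernel r s) * h (\<alpha> + s) \<partial>circ)
        \<le> (\<integral>\<^sup>+s. ennreal (1152 * (1 - r)) * (h (\<alpha> + s) * ennreal (1 / (1 - r + \<bar>s\<bar>)\<^sup>2)) \<partial>circ)"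
    proof (rule nn_integral_mono_AE)
      show "AE s in circ. ennreal (poisson_kernel r s) * h (\<alpha> + s) \<le> ennreal (1152 * (1 - r)) * (h (\<alpha> + s) * ennreal (1 / (1 - r + \<bar>s\<bar>)\<^sup>2))"
        using AE_circ_bounds
      proof eventually_elim
        case (elim s)
        have "ennreal (poisson_kernel r s) \<le> ennreal (1152 * (1 - r) * (1 / (1 - r + \<bar>s\<bar>)\<^sup>2))"
          using poisson_kernel_decay[OF r, of s] elim by (intro ennreal_leI) auto
        also have "\<dots> = ennreal (1152 * (1 - r)) * ennreal (1 / (1 - r + \<bar>s\<bar>)\<^sup>2)"
          using r by (intro ennreal_mult) auto
        finally have "ennreal (poisson_kernel r s) * h (\<alpha> + s)
            \<le> ennreal (1152 * (1 - r)) * ennreal (1 / (1 - r + \<bar>s\<bar>)\<^sup>2) * h (\<alpha> + s)"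
          by (rule mult_right_mono) simp
        then show ?case by (simp only: mult_ac)
      qed
    qed
    also have "\<dots> = ennreal (1152 * (1 - r)) * (\<integral>\<^sup>+s. ennreal (1 / (1 - r + \<bar>s\<bar>)\<^sup>2) \<partial>\<nu>)"
      unfolding \<nu>_def by (subst nn_integral_density) (auto simp: nn_integral_cmult)
    also have "\<dots> \<le> ennreal (1152 * (1 - r)) * ennreal (8 * \<kappa> / (1 - r))"
      by (intro mult_left_mono d) auto
    also have "\<dots> = ennreal (9216 * \<kappa>)"
    proof -
      have "1152 * (1 - r) * (8 * \<kappa> / (1 - r)) = 9216 * \<kappa>" using r by (simp add: field_simps)
      then show ?thesis using r l by (subst ennreal_mult[symmetric]) auto
    qed
    finally show "(\<integral>\<^sup>+s. ennreal (poisson_kernel r s) * h (\<alpha> + s) \<partial>circ) \<le> ennreal (9216 * \<kappa>)" .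
  qed
qed

section \<open>Convergence of the dilates of a Hardy function in mean\<close>

lemma integrable_circ_const [simp]: "integrable circ (\<lambda>_. c :: 'a::{banach, second_countable_topology})"
  by (rule finite_measure.integrable_const[OF finite_measure_circ])

lemma measure_circ_UNIV [simp]: "measure circ UNIV = 1"
  by (simp add: measure_def)

text \<open>
  Integrated with \<open>l\<close> free, this plays the role of Hoelder's inequality: minimising over \<open>l\<close>
  (\<open>le_of_young_split\<close> below) bounds a first moment by twice the root of a \<open>p\<close>-th moment.
\<close>
lemma young_split:
  fixes x :: real
  assumes "0 < l" "1 \<le> p" "0 \<le> x"
  shows "x \<le> l + l powr (1 - p) * x powr p"
proof (cases "x \<le> l")
  case False
  then have "l powr (1 - p) * x powr p \<ge> x powr (1 - p) * x powr p"
    using assms by (intro mult_right_mono powr_mono2') auto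
  moreover have "x powr (1 - p) * x powr p = x" using False assms by (simp flip: powr_add)
  ultimately show ?thesis using assms by simp
qed (simp add: add_increasing2)

lemma norm_sqrt_pair: "norm (1::real, a::complex) = sqrt (1 + (cmod a)\<^sup>2)"
  by (simp add: norm_Pair)

lemma norm_pair_power2: "(norm (1::real, a::complex))\<^sup>2 = 1 + (cmod a)\<^sup>2"
  unfolding norm_sqrt_pair by (rule real_sqrt_pow2) (simp add: add_nonneg_nonneg)

text \<open>
  Uniform convexity of \<open>x \<mapsto> \<surd>(1 + |x|\<^sup>2)\<close> on bounded sets. Realising this function as the norm of
  \<open>(1, x)\<close> in \<open>\<real> \<times> \<complex>\<close>, the parallelogram law expresses the defect at the midpoint through
  \<open>|X| |Y| - \<langle>X, Y\<rangle>\<close>, and Lagrange's identity bounds the latter below by \<open>|a - b|\<^sup>2 / (2 |X| |Y|)\<close>.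
\<close>
lemma convexity_defect:
  fixes a b :: complex
  defines "X \<equiv> norm (1::real, a)" and "Y \<equiv> norm (1::real, b)"
  assumes K: "X \<le> K" "Y \<le> K"
  shows "(cmod (a - b))\<^sup>2 \<le> 8 * K ^ 3 * ((X + Y) / 2 - norm (1::real, (a + b) / 2))"
proof -
  define Z where "Z = norm (1::real, (a + b) / 2)"
  define q where "q = 1 + a \<bullet> b"
  have X2: "X\<^sup>2 = 1 + (cmod a)\<^sup>2" and Y2: "Y\<^sup>2 = 1 + (cmod b)\<^sup>2"
    unfolding X_def Y_def norm_pair_power2 by simp_all
  have X1: "1 \<le> X" and Y1: "1 \<le> Y" unfolding X_def Y_def norm_sqrt_pair by simp_all
  have Z0: "0 \<le> Z" unfolding Z_def by simp
  have "(cmod (a + b))\<^sup>2 = (cmod a)\<^sup>2 + 2 * (a \<bullet> b) + (cmod b)\<^sup>2"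
    by (simp add: power2_norm_eq_inner inner_add inner_commute)
  then have "Z\<^sup>2 = (X\<^sup>2 + Y\<^sup>2 + 2 * q) / 4"
    unfolding Z_def norm_pair_power2 X2 Y2 q_def
    by (simp add: norm_divide power_divide field_simps)
  moreover have "((X + Y) / 2 - Z) * ((X + Y) / 2 + Z) = (X\<^sup>2 + 2 * X * Y + Y\<^sup>2) / 4 - Z\<^sup>2"
    by (simp add: power2_eq_square field_simps)
  ultimately have e1: "((X + Y) / 2 - Z) * ((X + Y) / 2 + Z) = (X * Y - q) / 2"
    by (simp add: field_simps)
  have ab: "(cmod (a - b))\<^sup>2 = (cmod a)\<^sup>2 - 2 * (a \<bullet> b) + (cmod b)\<^sup>2"
    by (simp add: power2_norm_eq_inner inner_diff inner_commute)
  have cs: "(a \<bullet> b)\<^sup>2 \<le> (cmod a)\<^sup>2 * (cmod b)\<^sup>2"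
    using Cauchy_Schwarz_ineq[of a b] by (simp add: power2_norm_eq_inner)
  have "(X * Y - q) * (X * Y + q) = X\<^sup>2 * Y\<^sup>2 - q\<^sup>2"
    by (simp add: power2_eq_square algebra_simps)
  also have "\<dots> = (cmod (a - b))\<^sup>2 + ((cmod a)\<^sup>2 * (cmod b)\<^sup>2 - (a \<bullet> b)\<^sup>2)"
    unfolding X2 Y2 ab q_def by (simp add: power2_eq_square algebra_simps)
  finally have e2: "(cmod (a - b))\<^sup>2 \<le> (X * Y - q) * (X * Y + q)" using cs by simp
  have "q\<^sup>2 \<le> (X * Y)\<^sup>2"
  proof -
    have "0 \<le> (X * Y - q) * (X * Y + q)" using e2 zero_le_power2[of "cmod (a - b)"] by linarith
    also have "\<dots> = (X * Y)\<^sup>2 - q\<^sup>2" by (simp add: power2_eq_square algebra_simps)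
    finally show ?thesis by simp
  qed
  then have qle: "q \<le> X * Y" "- q \<le> X * Y"
    using X1 Y1 abs_le_square_iff[of q "X * Y"] by auto
  have Zle: "Z \<le> (X + Y) / 2"
  proof (rule ccontr)
    assume "\<not> Z \<le> (X + Y) / 2"
    then have "(X + Y) / 2 - Z < 0" by simp
    moreover have "0 < (X + Y) / 2 + Z"
      using X1 Y1 Z0 by (simp add: field_simps)
    ultimately have "((X + Y) / 2 - Z) * ((X + Y) / 2 + Z) < 0" by (rule mult_neg_pos)
    then show False using e1 qle by simp
  qed
  have "X * Y \<le> K * K" using X1 Y1 K by (intro mult_mono) auto
  then have q2: "X * Y + q \<le> 2 * (K * K)" using qle by simp
  have c1: "(cmod (a - b))\<^sup>2 \<le> (X * Y - q) * (2 * (K * K))"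
    using e2 q2 qle by (smt (verit) mult_left_mono)
  have "X * Y - q \<le> 2 * (((X + Y) / 2 - Z) * (2 * K))"
  proof -
    have "X * Y - q = 2 * (((X + Y) / 2 - Z) * ((X + Y) / 2 + Z))" using e1 by simp
    also have "\<dots> \<le> 2 * (((X + Y) / 2 - Z) * (2 * K))"
      using Zle K by (intro mult_left_mono) (auto simp: field_simps)
    finally show ?thesis .
  qed
  then have "(X * Y - q) * (2 * (K * K)) \<le> 2 * (((X + Y) / 2 - Z) * (2 * K)) * (2 * (K * K))"
    using X1 K by (intro mult_right_mono) auto
  with c1 have "(cmod (a - b))\<^sup>2 \<le> 2 * (((X + Y) / 2 - Z) * (2 * K)) * (2 * (K * K))"
    by (rule order_trans)
  also have "\<dots> = 8 * K ^ 3 * ((X + Y) / 2 - Z)"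
    by (simp add: power3_eq_cube)
  finally show ?thesis unfolding Z_def .
qed

text \<open>
  Where both values are at most \<open>K\<close> the defect controls the difference, up to the free error \<open>\<eta>\<close>;
  elsewhere the \<open>p\<close>-th powers do, with the factor \<open>K\<^sup>1\<^sup>-\<^sup>p\<close>, which is small for large \<open>K\<close>.
\<close>
lemma norm_diff_le_defect:
  fixes a b :: complex
  defines "X \<equiv> norm (1::real, a)" and "Y \<equiv> norm (1::real, b)"
  assumes K: "1 \<le> K" and e: "0 < \<eta>" and p: "1 \<le> p"
  shows "cmod (a - b) \<le> \<eta> + 8 * K ^ 3 / \<eta> * ((X + Y) / 2 - norm (1::real, (a + b) / 2))
     + 2 * K powr (1 - p) * (X powr p + Y powr p)"
proof -
  define D where "D = (X + Y) / 2 - norm (1::real, (a + b) / 2)"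
  have D0: "0 \<le> D"
  proof -
    have "(1::real, (a + b) / 2) = (1/2) *\<^sub>R ((1, a) + (1, b))" by (simp add: scaleR_conv_of_real)
    then have "norm (1::real, (a + b) / 2) \<le> 1 / 2 * (X + Y)"
      using norm_triangle_ineq[of "(1::real, a)" "(1, b)"]
      unfolding X_def Y_def by (simp only: norm_scaleR) simp
    then show ?thesis by (simp add: D_def)
  qed
  have X1: "1 \<le> X" and Y1: "1 \<le> Y" unfolding X_def Y_def norm_sqrt_pair by simp_all
  have aX: "cmod a \<le> X" "cmod b \<le> Y" unfolding X_def Y_def norm_sqrt_pair
    by (rule real_le_rsqrt, simp)+
  have tail: "0 \<le> 2 * K powr (1 - p) * (X powr p + Y powr p)" by simp
  have mid: "0 \<le> 8 * K ^ 3 / \<eta> * D" using D0 K e by simp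
  have big: "z \<le> K powr (1 - p) * z powr p" if "K < z" for z
  proof -
    have "z powr (1 - p) * z powr p \<le> K powr (1 - p) * z powr p"
      using that K p by (intro mult_right_mono powr_mono2') auto
    moreover have "z powr (1 - p) * z powr p = z" using that K by (simp flip: powr_add)
    ultimately show ?thesis by simp
  qed
  show ?thesis unfolding D_def[symmetric]
  proof (cases "X \<le> K \<and> Y \<le> K")
    case True
    have "(cmod (a - b))\<^sup>2 \<le> 8 * K ^ 3 * D"
      using convexity_defect[of a K b] True unfolding D_def X_def Y_def by blast
    then have "\<eta> * cmod (a - b) \<le> \<eta> * \<eta> + 8 * K ^ 3 * D" if "\<eta> < cmod (a - b)"
      using that e by (smt (verit) mult_right_mono norm_ge_zero power2_eq_square mult_nonneg_nonneg)
    then have "\<eta> < cmod (a - b) \<Longrightarrow> cmod (a - b) \<le> \<eta> + 8 * K ^ 3 / \<eta> * D"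
      using e by (simp add: field_simps)
    then show "cmod (a - b) \<le> \<eta> + 8 * K ^ 3 / \<eta> * D + 2 * K powr (1 - p) * (X powr p + Y powr p)"
      using tail mid by (cases "\<eta> < cmod (a - b)") linarith+
  next
    case False
    have "cmod (a - b) \<le> X + Y" using norm_triangle_ineq4[of a b] aX by simp
    also have "\<dots> \<le> 2 * max X Y" by simp
    also have "max X Y \<le> K powr (1 - p) * max X Y powr p" using False by (intro big) auto
    also have "max X Y powr p \<le> X powr p + Y powr p" by (simp add: max_def)
    finally have "cmod (a - b) \<le> 2 * K powr (1 - p) * (X powr p + Y powr p)"
      by (simp add: mult_left_mono)
    then show "cmod (a - b) \<le> \<eta> + 8 * K ^ 3 / \<eta> * D + 2 * K powr (1 - p) * (X powr p + Y powr p)"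
      using e mid by simp
  qed
qed

lemma nn_integral_circ_circ_swap:
  assumes [measurable]: "k \<in> borel_measurable borel" "h \<in> borel_measurable borel"
    and per: "\<And>x. h (x + 2 * pi) = h x"
  shows "(\<integral>\<^sup>+\<alpha>. (\<integral>\<^sup>+s. k s * h (\<alpha> + s) \<partial>circ) \<partial>circ) = (\<integral>\<^sup>+s. k s \<partial>circ) * (\<integral>\<^sup>+\<alpha>. (h \<alpha> :: ennreal) \<partial>circ)"
proof -
  interpret c: finite_measure circ by (rule finite_measure_circ)
  interpret pair_sigma_finite circ circ ..
  have "(\<integral>\<^sup>+\<alpha>. (\<integral>\<^sup>+s. k s * h (\<alpha> + s) \<partial>circ) \<partial>circ) = (\<integral>\<^sup>+s. (\<integral>\<^sup>+\<alpha>. k s * h (\<alpha> + s) \<partial>circ) \<partial>circ)"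
    by (rule Fubini') measurable
  also have "\<dots> = (\<integral>\<^sup>+s. k s * (\<integral>\<^sup>+\<alpha>. h (\<alpha> + s) \<partial>circ) \<partial>circ)"
    by (simp add: nn_integral_cmult)
  also have "\<dots> = (\<integral>\<^sup>+s. k s * (\<integral>\<^sup>+\<alpha>. h \<alpha> \<partial>circ) \<partial>circ)"
    by (simp add: nn_integral_circ_shift[OF assms(2) per])
  finally show ?thesis by (simp add: nn_integral_multc)
qed

lemma continuous_on_circle_function:
  assumes "h holomorphic_on ball 0 R" "\<bar>r\<bar> < R"
  shows "continuous_on A (\<lambda>s. h (of_real r * cis s))"
  by (rule continuous_on_compose2[OF holomorphic_on_imp_continuous_on[OF assms(1)]])
    (use assms in \<open>auto intro!: continuous_intros simp: norm_mult\<close>)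

lemma holomorphic_on_dilation:
  assumes hol: "f holomorphic_on ball 0 1" and u: "cmod u * R \<le> 1"
  shows "(\<lambda>w. f (u * w)) holomorphic_on ball 0 R"
proof (rule holomorphic_on_compose_gen[OF _ hol, unfolded o_def])
  show "(*) u ` ball 0 R \<subseteq> ball 0 1"
  proof (rule image_subsetI)
    fix w :: complex assume "w \<in> ball 0 R"
    then have "cmod u * cmod w < 1"
    proof (cases "u = 0")
      case False
      with \<open>w \<in> ball 0 R\<close> have "cmod u * cmod w < cmod u * R"
        by (intro mult_strict_left_mono) auto
      with u show ?thesis by simp
    qed simp
    then show "u * w \<in> ball 0 1" by (simp add: norm_mult)
  qed
qed (intro holomorphic_intros)

lemma tendsto_dilation:
  assumes hol: "f holomorphic_on ball 0 1" and z: "cmod z < 1" and \<rho>: "(\<rho> \<longlongrightarrow> (1::real)) F"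
  shows "((\<lambda>n. f (of_real (\<rho> n) * z)) \<longlongrightarrow> f z) F"
proof -
  have "isCont f z"
    using holomorphic_on_imp_continuous_on[OF hol] z by (simp add: continuous_on_eq_continuous_at)
  moreover have "((\<lambda>n. of_real (\<rho> n) * z) \<longlongrightarrow> of_real 1 * z) F"
    by (intro tendsto_intros \<rho>)
  ultimately show ?thesis by (intro isCont_tendsto_compose[of _ f]) auto
qed

text \<open>
  Subharmonicity: \<open>(1, h(r e\<^sup>i\<^sup>\<alpha>))\<close> is the Poisson average of the vectors \<open>(1, h(e\<^sup>i\<^sup>\<theta>))\<close>, so its norm is
  at most the average of their norms; averaging over \<open>\<alpha>\<close> removes the kernel.
\<close>
lemma dilation_decreases_mean:
  assumes hol: "h holomorphic_on ball 0 R" and R: "1 < R" and r: "0 \<le> r" "r < 1"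
  shows "(LINT \<theta>|circ. norm (1::real, h (of_real r * cis \<theta>))) \<le> (LINT \<theta>|circ. norm (1::real, h (cis \<theta>)))"
proof -
  have hc: "continuous_on UNIV (\<lambda>s. h (cis s))"
    using continuous_on_circle_function[OF hol, of 1] R by simp
  have hc': "continuous_on UNIV (\<lambda>s. h (cis (\<alpha> + s)))" for \<alpha>
    by (rule continuous_on_compose2[OF hc]) (auto intro!: continuous_intros)
  have hcr: "continuous_on UNIV (\<lambda>s. h (of_real r * cis s))"
    using continuous_on_circle_function[OF hol, of r] R r by simp
  define v where "v \<alpha> s = poisson_kernel r s *\<^sub>R (1::real, h (cis (\<alpha> + s)))" for \<alpha> s
  have vc: "continuous_on UNIV (v \<alpha>)" for \<alpha>
    unfolding v_def using continuous_on_poisson_kernel[OF r, of UNIV] hc'[of \<alpha>]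
    by (auto intro!: continuous_intros)
  have pt: "ennreal (norm (1::real, h (of_real r * cis \<alpha>)))
     \<le> (\<integral>\<^sup>+s. ennreal (poisson_kernel r s) * ennreal (norm (1::real, h (cis (\<alpha> + s)))) \<partial>circ)" for \<alpha>
  proof -
    have iv: "integrable circ (v \<alpha>)" by (rule integrable_circ_continuous[OF vc])
    have "fst (integral\<^sup>L circ (v \<alpha>)) = (LINT s|circ. fst (v \<alpha> s))"
      using integral_bounded_linear[OF bounded_linear_fst iv] by simp
    moreover have "snd (integral\<^sup>L circ (v \<alpha>)) = (LINT s|circ. snd (v \<alpha> s))"
      using integral_bounded_linear[OF bounded_linear_snd iv] by simp
    ultimately have "(1, h (of_real r * cis \<alpha>)) = integral\<^sup>L circ (v \<alpha>)"
      unfolding v_def using poisson_formula[OF assms, of \<alpha>] integral_poisson_kernel[OF r]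
      by (intro prod_eqI) auto
    then have "norm (1::real, h (of_real r * cis \<alpha>)) \<le> (LINT s|circ. norm (v \<alpha> s))"
      using integral_norm_bound by metis
    then have "ennreal (norm (1::real, h (of_real r * cis \<alpha>))) \<le> ennreal (LINT s|circ. norm (v \<alpha> s))"
      by (rule ennreal_leI)
    also have "\<dots> = (\<integral>\<^sup>+s. ennreal (norm (v \<alpha> s)) \<partial>circ)"
      using iv by (intro nn_integral_eq_integral[symmetric]) auto
    finally show ?thesis
      using poisson_kernel_nonneg[OF r] unfolding v_def norm_scaleR by (simp add: ennreal_mult)
  qed
  have [measurable]: "(\<lambda>s. h (cis s)) \<in> borel_measurable borel"
    by (rule borel_measurable_continuous_onI[OF hc])
  have i1: "integrable circ (\<lambda>\<theta>. norm (1::real, h (of_real r * cis \<theta>)))"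
    by (intro integrable_circ_continuous continuous_intros hcr)
  have i2: "integrable circ (\<lambda>\<theta>. norm (1::real, h (cis \<theta>)))"
    by (intro integrable_circ_continuous continuous_intros hc)
  have "ennreal (LINT \<theta>|circ. norm (1::real, h (of_real r * cis \<theta>))) = (\<integral>\<^sup>+\<theta>. ennreal (norm (1::real, h (of_real r * cis \<theta>))) \<partial>circ)"
    using i1 by (intro nn_integral_eq_integral[symmetric]) auto
  also have "\<dots> \<le> (\<integral>\<^sup>+\<alpha>. (\<integral>\<^sup>+s. ennreal (poisson_kernel r s) * ennreal (norm (1::real, h (cis (\<alpha> + s)))) \<partial>circ) \<partial>circ)"
    by (intro nn_integral_mono pt)
  also have "\<dots> = (\<integral>\<^sup>+\<theta>. ennreal (norm (1::real, h (cis \<theta>))) \<partial>circ)"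
    by (subst nn_integral_circ_circ_swap[of _ "\<lambda>\<theta>. ennreal (norm (1::real, h (cis \<theta>)))"])
      (simp_all add: nn_integral_poisson_kernel[OF r] cis.simps complex_eq_iff flip: cis_mult)
  also have "\<dots> = ennreal (LINT \<theta>|circ. norm (1::real, h (cis \<theta>)))"
    using i2 by (intro nn_integral_eq_integral) auto
  finally show ?thesis by (subst (asm) ennreal_le_iff) auto
qed


lemma hardy_space_imp_holomorphic: "f \<in> hardy_space p \<Longrightarrow> f holomorphic_on ball 0 1"
  by (simp add: hardy_space_def)

lemma circle_function_measurable:
  assumes "f holomorphic_on ball 0 1" "\<bar>r\<bar> < 1"
  shows "(\<lambda>\<theta>. f (of_real r * cis \<theta>)) \<in> borel_measurable borel"
  by (rule borel_measurable_continuous_onI[OF continuous_on_circle_function[OF assms]])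

lemma continuous_on_norm_powr:
  fixes g :: "'a::topological_space \<Rightarrow> 'b::real_normed_vector"
  assumes "continuous_on A g" "0 < p"
  shows "continuous_on A (\<lambda>x. norm (g x) powr p)"
  by (rule continuous_on_powr') (use assms in \<open>auto intro!: continuous_intros\<close>)

lemma circle_norm_circ:
  assumes "g \<in> borel_measurable borel"
  shows "circle_norm p g = (LINT \<theta>|circ. norm (g \<theta>) powr p) powr (1 / p)"
  using assms by (subst integral_circ) (auto simp: circle_norm_def)

lemma hardy_norm_nonneg: "f \<in> hardy_space p \<Longrightarrow> 0 \<le> hardy_norm p f"
  unfolding hardy_norm_def hardy_space_def
  by (rule cSUP_upper2[where x = "1 / 2"]) (auto simp: integral_mean_def circle_norm_def)

lemma hardy_integral_le:
  assumes f: "f \<in> hardy_space p" and p: "0 < p" and r: "0 < r" "r < 1"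
  shows "(LINT \<theta>|circ. norm (f (of_real r * cis \<theta>)) powr p) \<le> hardy_norm p f powr p"
proof -
  let ?I = "LINT \<theta>|circ. norm (f (of_real r * cis \<theta>)) powr p"
  have "integral_mean p r f \<le> hardy_norm p f"
    unfolding hardy_norm_def using f r by (intro cSUP_upper) (auto simp: hardy_space_def)
  then have "?I powr (1 / p) \<le> hardy_norm p f"
    unfolding integral_mean_def
    by (subst (asm) circle_norm_circ) (use circle_function_measurable hardy_space_imp_holomorphic f r in auto)
  then have "(?I powr (1 / p)) powr p \<le> hardy_norm p f powr p"
    using p by (intro powr_mono2) auto
  moreover have "0 \<le> ?I" by (rule integral_nonneg_AE) auto
  ultimately show ?thesis using p by (simp add: powr_powr)
qed

lemma hardy_nn_integral_le:
  assumes f: "f \<in> hardy_space p" and p: "0 < p" and r: "0 < r" "r < 1"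
  shows "(\<integral>\<^sup>+\<theta>. ennreal (norm (f (of_real r * cis \<theta>)) powr p) \<partial>circ) \<le> ennreal (hardy_norm p f powr p)"
proof -
  have "integrable circ (\<lambda>\<theta>. norm (f (of_real r * cis \<theta>)) powr p)"
    using r p by (intro integrable_circ_continuous continuous_on_norm_powr
        continuous_on_circle_function[OF hardy_space_imp_holomorphic[OF f]]) auto
  then show ?thesis
    using hardy_integral_le[OF assms] by (subst nn_integral_eq_integral) (auto intro: ennreal_leI)
qed

text \<open>
  Let \<open>A\<close> be the supremum of the means \<open>I(r)\<close> of \<open>\<surd>(1 + |f(r\<cdot>)|\<^sup>2)\<close>, and choose \<open>\<rho>\<close> with \<open>I(\<rho>)\<close> close
  to \<open>A\<close>. For \<open>r, s\<close> near \<open>1\<close> the midpoint \<open>h\<close> of the dilates \<open>f(r\<cdot>)\<close> and \<open>f(s\<cdot>)\<close> satisfies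
  \<open>h(\<rho>\<cdot>) \<approx> f(\<rho>\<cdot>)\<close>, so by subharmonicity the mean of \<open>h\<close> on the unit circle is nearly \<open>A\<close>, whereas the
  means of the two dilates are at most \<open>A\<close>. Hence the integrated convexity defect is small, and with
  it the distance of the dilates. The exponent \<open>p > 1\<close> enters through uniform integrability.
\<close>
lemma hardy_L1_Cauchy:
  assumes f: "f \<in> hardy_space p" and p: "1 < p" and e: "0 < e"
  obtains r0 where "0 < r0" "r0 < 1"
    "\<And>r s. r0 < r \<Longrightarrow> r < 1 \<Longrightarrow> r0 < s \<Longrightarrow> s < 1 \<Longrightarrow>
       (LINT \<theta>|circ. cmod (f (of_real r * cis \<theta>) - f (of_real s * cis \<theta>))) < e"
proof -
  have hol: "f holomorphic_on ball 0 1" using f by (rule hardy_space_imp_holomorphic)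
  define X where "X r \<theta> = norm (1::real, f (of_real r * cis \<theta>))" for r \<theta>
  define H where "H = hardy_norm p f powr p"
  have H0: "0 \<le> H" unfolding H_def by simp
  have fc: "continuous_on UNIV (\<lambda>\<theta>. f (of_real r * cis \<theta>))" if "0 < r" "r < 1" for r
    using continuous_on_circle_function[OF hol, of r] that by simp
  have Xc: "continuous_on UNIV (X r)" if "0 < r" "r < 1" for r
    unfolding X_def using fc[OF that] by (auto intro!: continuous_intros)
  have Xi: "integrable circ (X r)" if "0 < r" "r < 1" for r
    by (rule integrable_circ_continuous[OF Xc[OF that]])
  have X1: "1 \<le> X r \<theta>" for r \<theta> unfolding X_def norm_sqrt_pair by simp
  have Xpi: "integrable circ (\<lambda>\<theta>. X r \<theta> powr p)" if "0 < r" "r < 1" for r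
    using Xc[OF that] X1 p by (intro integrable_circ_continuous continuous_on_powr' continuous_intros)
      (auto intro: order_trans[OF zero_le_one])
  have fpi: "integrable circ (\<lambda>\<theta>. cmod (f (of_real r * cis \<theta>)) powr p)" if "0 < r" "r < 1" for r
    using p by (intro integrable_circ_continuous continuous_on_norm_powr fc[OF that]) auto
  have Xp_le: "X r \<theta> powr p \<le> 2 powr p * (1 + cmod (f (of_real r * cis \<theta>)) powr p)" for r \<theta>
  proof -
    let ?a = "cmod (f (of_real r * cis \<theta>))"
    have "X r \<theta> \<le> 1 + ?a" unfolding X_def using norm_Pair_le[of "1::real"] by simp
    also have "\<dots> \<le> 2 * max 1 ?a" by simp
    finally have "X r \<theta> powr p \<le> (2 * max 1 ?a) powr p"
      using p X1[of r \<theta>] by (intro powr_mono2) auto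
    also have "\<dots> = 2 powr p * max 1 ?a powr p" by (simp add: powr_mult)
    also have "max 1 ?a powr p \<le> 1 + ?a powr p" by (simp add: max_def)
    finally show ?thesis by (simp add: mult_left_mono)
  qed
  define Bp where "Bp = 2 powr p * (1 + H)"
  have Bp: "(LINT \<theta>|circ. X r \<theta> powr p) \<le> Bp" if r: "0 < r" "r < 1" for r
  proof -
    have "(LINT \<theta>|circ. X r \<theta> powr p) \<le> (LINT \<theta>|circ. 2 powr p * (1 + cmod (f (of_real r * cis \<theta>)) powr p))"
      by (intro integral_mono Xpi[OF r] integrable_mult_right Bochner_Integration.integrable_add
          fpi[OF r] integrable_circ_const Xp_le)
    also have "\<dots> = 2 powr p * (1 + (LINT \<theta>|circ. cmod (f (of_real r * cis \<theta>)) powr p))"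
      using fpi[OF r] integrable_circ_const
      by (simp add: measure_def)
    also have "\<dots> \<le> Bp" unfolding Bp_def H_def
      using hardy_integral_le[OF f _ r] p by (intro mult_left_mono) auto
    finally show ?thesis .
  qed
  have Bp0: "0 < Bp" unfolding Bp_def using H0 by (simp add: add_pos_nonneg)
  define \<eta> where "\<eta> = e / 4"
  have \<eta>: "0 < \<eta>" using e by (simp add: \<eta>_def)
  have lim0: "((\<lambda>x::real. x powr (1 - p)) \<longlongrightarrow> 0) at_top"
    using p by (intro tendsto_neg_powr filterlim_ident) auto
  have "0 < e / (16 * Bp)" using e Bp0 by simp
  with lim0 have "\<forall>\<^sub>F x in at_top. (x::real) powr (1 - p) < e / (16 * Bp)"
    by (rule order_tendstoD(2))
  then have "\<forall>\<^sub>F x in at_top. (x::real) powr (1 - p) < e / (16 * Bp) \<and> 1 \<le> x"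
    by (intro eventually_conj eventually_ge_at_top)
  from eventually_happens[OF this] obtain K where K: "K powr (1 - p) < e / (16 * Bp)" "1 \<le> (K::real)"
    by auto
  have tail: "2 * K powr (1 - p) * (2 * Bp) < e / 4"
    using K(1) Bp0 by (simp add: field_simps)
  \<comment> \<open>Chosen so that a defect of total size \<open>\<kappa>\<close> contributes \<open>e / 4\<close> in \<open>norm_diff_le_defect\<close>.\<close>
  define \<kappa> where "\<kappa> = e * \<eta> / (32 * K ^ 3)"
  have \<kappa>: "0 < \<kappa>" "8 * K ^ 3 / \<eta> * \<kappa> = e / 4"
    unfolding \<kappa>_def using e \<eta> K(2) by (auto simp: field_simps)
  define I where "I r = (LINT \<theta>|circ. X r \<theta>)" for r
  have Ile: "I r \<le> Bp" if r: "0 < r" "r < 1" for r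
  proof -
    have "I r \<le> (LINT \<theta>|circ. X r \<theta> powr p)" unfolding I_def
    proof (rule integral_mono[OF Xi[OF r] Xpi[OF r]])
      fix \<theta> show "X r \<theta> \<le> X r \<theta> powr p"
        using powr_mono[of 1 p "X r \<theta>"] p X1[of r \<theta>] by simp
    qed
    then show ?thesis using Bp[OF r] by simp
  qed
  define A where "A = (SUP r\<in>{0<..<1}. I r)"
  have bdd: "bdd_above (I ` {0<..<1})" using Ile by (intro bdd_aboveI2[where M = Bp]) auto
  have IA: "I r \<le> A" if "0 < r" "r < 1" for r
    unfolding A_def using that bdd by (intro cSUP_upper) auto
  have "\<exists>r\<in>{0<..<1}. A - \<kappa> / 2 < I r"
    unfolding A_def using \<kappa> bdd less_cSUP_iff[of "{0<..<1::real}" I "A - \<kappa> / 2"]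
    by (auto simp: A_def)
  then obtain \<rho> where \<rho>: "0 < \<rho>" "\<rho> < 1" "A - \<kappa> / 2 < I \<rho>" by auto
  have "continuous_on (cball 0 \<rho>) f"
    using holomorphic_on_imp_continuous_on[OF hol] \<rho> by (rule_tac continuous_on_subset) auto
  then have "uniformly_continuous_on (cball 0 \<rho>) f"
    by (rule compact_uniformly_continuous) simp
  then obtain d where d: "0 < d" "\<And>z w. z \<in> cball 0 \<rho> \<Longrightarrow> w \<in> cball 0 \<rho> \<Longrightarrow> dist w z < d \<Longrightarrow> dist (f w) (f z) < \<kappa> / 2"
    unfolding uniformly_continuous_on_def using \<kappa>(1) by (metis half_gt_zero)
  define r0 where "r0 = max (1 / 2) (1 - d)"
  have close: "cmod (f (of_real r * (of_real \<rho> * cis \<theta>)) - f (of_real \<rho> * cis \<theta>)) \<le> \<kappa> / 2"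
    if r: "r0 < r" "r < 1" for r \<theta>
  proof -
    have r01: "0 < r" "1 - r < d" using r by (auto simp: r0_def)
    have "of_real r * (of_real \<rho> * cis \<theta>) - of_real \<rho> * cis \<theta> = of_real ((r - 1) * \<rho>) * cis \<theta>"
      by (simp add: algebra_simps)
    then have "dist (of_real r * (of_real \<rho> * cis \<theta>)) (of_real \<rho> * cis \<theta>) = (1 - r) * \<rho>"
      using r \<rho> by (simp only: dist_norm norm_mult norm_of_real norm_cis) (simp add: abs_mult)
    also have "\<dots> \<le> (1 - r) * 1" using r \<rho> by (intro mult_left_mono) auto
    also have "\<dots> < d" using r01 by simp
    finally have "dist (f (of_real r * (of_real \<rho> * cis \<theta>))) (f (of_real \<rho> * cis \<theta>)) < \<kappa> / 2"
      using r r01 \<rho> by (intro d(2)) (auto simp: norm_mult mult_left_le_one_le)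
    then show ?thesis by (simp add: dist_norm)
  qed
  show ?thesis
  proof (rule that)
    show "0 < r0" "r0 < 1" using d by (auto simp: r0_def)
    fix r s assume r: "r0 < r" "r < 1" and s: "r0 < s" "s < 1"
    have r1: "0 < r" "r < 1" and s1: "0 < s" "s < 1" using r s by (auto simp: r0_def)
    define h where "h w = (f (of_real r * w) + f (of_real s * w)) / 2" for w
    define R where "R = 1 / max r s"
    have R: "1 < R" unfolding R_def using r1 s1 by (simp add: max_def)
    have holh: "h holomorphic_on ball 0 R"
      unfolding h_def using r1 s1
      by (intro holomorphic_intros holomorphic_on_dilation[OF hol]) (auto simp: R_def max_def field_simps)
    define D where "D \<theta> = (X r \<theta> + X s \<theta>) / 2 - norm (1::real, h (cis \<theta>))" for \<theta>
    have hi: "integrable circ (\<lambda>\<theta>. norm (1::real, h (of_real t * cis \<theta>)))" if "0 \<le> t" "t \<le> 1" for t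
      using R that by (intro integrable_circ_continuous continuous_intros continuous_on_circle_function[OF holh]) auto
    have hi1: "integrable circ (\<lambda>\<theta>. norm (1::real, h (cis \<theta>)))" using hi[of 1] by simp
    have "I \<rho> - \<kappa> / 2 = (LINT \<theta>|circ. X \<rho> \<theta> - \<kappa> / 2)"
      unfolding I_def using Xi[of \<rho>] \<rho> integrable_circ_const
      by (simp add: measure_def)
    also have "\<dots> \<le> (LINT \<theta>|circ. norm (1::real, h (of_real \<rho> * cis \<theta>)))"
    proof (rule integral_mono)
      show "integrable circ (\<lambda>\<theta>. X \<rho> \<theta> - \<kappa> / 2)"
        using Xi[of \<rho>] \<rho> integrable_circ_const by simp
      show "integrable circ (\<lambda>\<theta>. norm (1::real, h (of_real \<rho> * cis \<theta>)))" using hi \<rho> by simp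
      fix \<theta>
      let ?z = "of_real \<rho> * cis \<theta>"
      have "h ?z - f ?z = ((f (of_real r * ?z) - f ?z) + (f (of_real s * ?z) - f ?z)) / 2"
        unfolding h_def by (simp add: field_simps)
      moreover have "cmod ((f (of_real r * ?z) - f ?z) + (f (of_real s * ?z) - f ?z)) \<le> \<kappa> / 2 + \<kappa> / 2"
        by (intro norm_triangle_mono close r s)
      ultimately have "cmod (h ?z - f ?z) \<le> \<kappa> / 2"
        by (simp only: norm_divide) simp
      moreover have "norm (1::real, f ?z) - norm (1::real, h ?z) \<le> norm ((1::real, f ?z) - (1, h ?z))"
        by (rule norm_triangle_ineq2)
      ultimately show "X \<rho> \<theta> - \<kappa> / 2 \<le> norm (1::real, h ?z)"
        unfolding X_def by (simp add: norm_minus_commute)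
    qed
    also have "\<dots> \<le> (LINT \<theta>|circ. norm (1::real, h (cis \<theta>)))"
      using dilation_decreases_mean[OF holh R, of \<rho>] \<rho> by simp
    finally have low: "A - \<kappa> \<le> (LINT \<theta>|circ. norm (1::real, h (cis \<theta>)))" using \<rho>(3) by simp
    have Di: "integrable circ D" unfolding D_def using Xi[OF r1] Xi[OF s1] hi1 by simp
    have "(LINT \<theta>|circ. D \<theta>) = (I r + I s) / 2 - (LINT \<theta>|circ. norm (1::real, h (cis \<theta>)))"
      unfolding D_def I_def using Xi[OF r1] Xi[OF s1] hi1 by simp
    then have Dle: "(LINT \<theta>|circ. D \<theta>) \<le> \<kappa>" using low IA[OF r1] IA[OF s1] by (simp add: field_simps)
    have "(LINT \<theta>|circ. cmod (f (of_real r * cis \<theta>) - f (of_real s * cis \<theta>)))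
      \<le> (LINT \<theta>|circ. \<eta> + 8 * K ^ 3 / \<eta> * D \<theta> + 2 * K powr (1 - p) * (X r \<theta> powr p + X s \<theta> powr p))"
    proof (rule integral_mono)
      show "integrable circ (\<lambda>\<theta>. cmod (f (of_real r * cis \<theta>) - f (of_real s * cis \<theta>)))"
        by (intro integrable_circ_continuous continuous_intros fc r1 s1)
      show "integrable circ (\<lambda>\<theta>. \<eta> + 8 * K ^ 3 / \<eta> * D \<theta> + 2 * K powr (1 - p) * (X r \<theta> powr p + X s \<theta> powr p))"
        using Di Xpi[OF r1] Xpi[OF s1] integrable_circ_const by simp
      fix \<theta>
      show "cmod (f (of_real r * cis \<theta>) - f (of_real s * cis \<theta>))
         \<le> \<eta> + 8 * K ^ 3 / \<eta> * D \<theta> + 2 * K powr (1 - p) * (X r \<theta> powr p + X s \<theta> powr p)"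
        unfolding D_def X_def h_def using p by (intro norm_diff_le_defect[OF K(2) \<eta>]) auto
    qed
    also have "\<dots> = \<eta> + 8 * K ^ 3 / \<eta> * (LINT \<theta>|circ. D \<theta>)
        + 2 * K powr (1 - p) * ((LINT \<theta>|circ. X r \<theta> powr p) + (LINT \<theta>|circ. X s \<theta> powr p))"
      using Di Xpi[OF r1] Xpi[OF s1] integrable_circ_const
      by (simp add: measure_def)
    also have "\<dots> \<le> \<eta> + 8 * K ^ 3 / \<eta> * \<kappa> + 2 * K powr (1 - p) * (2 * Bp)"
      using Dle Bp[OF r1] Bp[OF s1] \<eta> K(2) by (intro add_mono mult_left_mono) auto
    also have "\<dots> < e" unfolding \<kappa>(2) using tail e \<eta>_def by linarith
    finally show "(LINT \<theta>|circ. cmod (f (of_real r * cis \<theta>) - f (of_real s * cis \<theta>))) < e" .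
  qed
qed

section \<open>Radial limits of Hardy functions\<close>

lemma ennreal_tendsto_0I:
  fixes u :: "nat \<Rightarrow> ennreal"
  assumes "\<And>e::real. 0 < e \<Longrightarrow> \<exists>N. \<forall>n\<ge>N. u n \<le> ennreal e"
  shows "u \<longlonglongrightarrow> 0"
proof (rule order_tendstoI)
  fix a :: ennreal assume "0 < a"
  then obtain e where e: "0 < e" "e < a" using dense by blast
  then have "e < top" by (meson less_le_trans top_greatest)
  then obtain e' where e': "e = ennreal e'" "0 < e'"
    using e(1) by (cases e) auto
  then obtain N where "\<forall>n\<ge>N. u n \<le> e" using assms[of e'] by auto
  then show "\<forall>\<^sub>F n in sequentially. u n < a"
    using e(2) by (auto simp: eventually_sequentially intro: le_less_trans)
qed simp

lemma cis_add_2pi: "cis (x + 2 * pi) = cis x"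
  by (simp add: complex_eq_iff)

lemma hardy_L1_limit:
  assumes f: "f \<in> hardy_space p" and p: "1 < p"
  obtains \<rho> g where "\<And>n. 0 < \<rho> n" "\<And>n. \<rho> n < 1" "\<rho> \<longlonglongrightarrow> (1::real)"
    "g \<in> borel_measurable borel" "\<And>x. g (x + 2 * pi) = g x"
    "AE \<theta> in circ. (\<lambda>n. f (of_real (\<rho> n) * cis \<theta>)) \<longlonglongrightarrow> g \<theta>"
    "(\<lambda>n. \<integral>\<^sup>+\<theta>. ennreal (cmod (f (of_real (\<rho> n) * cis \<theta>) - g \<theta>)) \<partial>circ) \<longlonglongrightarrow> 0"
proof -
  have hol: "f holomorphic_on ball 0 1" using f by (rule hardy_space_imp_holomorphic)
  define r where "r n = 1 - 1 / (real n + 2)" for n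
  have r: "0 < r n" "r n < 1" for n by (auto simp: r_def field_simps)
  have rlim: "r \<longlonglongrightarrow> 1" unfolding r_def by real_asymp
  define s where "s n \<theta> = f (of_real (r n) * cis \<theta>)" for n \<theta>
  have sm[measurable]: "s n \<in> borel_measurable borel" for n
    unfolding s_def using r[of n] by (intro circle_function_measurable hol) auto
  have si: "integrable circ (s n)" for n
    unfolding s_def using r[of n] by (intro integrable_circ_continuous continuous_on_circle_function[OF hol]) auto
  have cau: "\<exists>N. \<forall>i\<ge>N. \<forall>j\<ge>N. (LINT x|circ. norm (s i x - s j x)) < e" if e: "0 < e" for e
  proof -
    obtain r0 where r0: "0 < r0" "r0 < 1" "\<And>r s. r0 < r \<Longrightarrow> r < 1 \<Longrightarrow> r0 < s \<Longrightarrow> s < 1 \<Longrightarrow>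
       (LINT \<theta>|circ. cmod (f (of_real r * cis \<theta>) - f (of_real s * cis \<theta>))) < e"
      using hardy_L1_Cauchy[OF f p e] by metis
    have "\<forall>\<^sub>F n in sequentially. r0 < r n" using rlim r0(2) by (rule order_tendstoD(1))
    then obtain N where "\<And>n. N \<le> n \<Longrightarrow> r0 < r n" by (auto simp: eventually_sequentially)
    then show ?thesis using r0(3) r unfolding s_def by blast
  qed
  obtain q where q: "strict_mono q" "AE x in circ. Cauchy (\<lambda>i. s (q i) x)"
    using cauchy_L1_AE_cauchy_subseq[OF si cau] by metis
  define \<rho> where "\<rho> n = r (q n)" for n
  define g where "g \<theta> = lim (\<lambda>n. s (q n) \<theta>)" for \<theta>
  have gm[measurable]: "g \<in> borel_measurable borel" unfolding g_def by measurable
  have gper: "g (x + 2 * pi) = g x" for x unfolding g_def s_def by (simp add: cis_add_2pi)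
  have conv: "AE x in circ. (\<lambda>n. s (q n) x) \<longlonglongrightarrow> g x"
    using q(2) by eventually_elim (simp add: g_def Cauchy_convergent_iff convergent_LIMSEQ_iff)
  have L1: "(\<lambda>n. \<integral>\<^sup>+\<theta>. ennreal (cmod (s (q n) \<theta> - g \<theta>)) \<partial>circ) \<longlonglongrightarrow> 0"
  proof (rule ennreal_tendsto_0I)
    fix e :: real assume e: "0 < e"
    obtain N where N: "\<And>i j. N \<le> i \<Longrightarrow> N \<le> j \<Longrightarrow> (LINT x|circ. norm (s i x - s j x)) < e"
      using cau[OF e] by metis
    show "\<exists>N. \<forall>n\<ge>N. (\<integral>\<^sup>+\<theta>. ennreal (cmod (s (q n) \<theta> - g \<theta>)) \<partial>circ) \<le> ennreal e"
    proof (intro exI allI impI)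
      fix n assume n: "N \<le> n"
      have qn: "N \<le> q i" if "N \<le> i" for i
        using seq_suble[OF q(1), of i] that by simp
      have "(\<integral>\<^sup>+\<theta>. ennreal (cmod (s (q n) \<theta> - g \<theta>)) \<partial>circ)
          = (\<integral>\<^sup>+\<theta>. liminf (\<lambda>m. ennreal (cmod (s (q n) \<theta> - s (q m) \<theta>))) \<partial>circ)"
      proof (rule nn_integral_cong_AE)
        show "AE \<theta> in circ. ennreal (cmod (s (q n) \<theta> - g \<theta>)) = liminf (\<lambda>m. ennreal (cmod (s (q n) \<theta> - s (q m) \<theta>)))"
          using conv
        proof eventually_elim
          case (elim \<theta>)
          then have "(\<lambda>m. ennreal (cmod (s (q n) \<theta> - s (q m) \<theta>))) \<longlonglongrightarrow> ennreal (cmod (s (q n) \<theta> - g \<theta>))"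
            by (intro tendsto_intros) auto
          then show ?case by (intro lim_imp_Liminf[symmetric]) auto
        qed
      qed
      also have "\<dots> \<le> liminf (\<lambda>m. \<integral>\<^sup>+\<theta>. ennreal (cmod (s (q n) \<theta> - s (q m) \<theta>)) \<partial>circ)"
        by (intro nn_integral_liminf) auto
      also have "\<dots> \<le> ennreal e"
      proof (rule Liminf_le)
        show "\<forall>\<^sub>F m in sequentially. (\<integral>\<^sup>+\<theta>. ennreal (cmod (s (q n) \<theta> - s (q m) \<theta>)) \<partial>circ) \<le> ennreal e"
        proof (rule eventually_sequentiallyI)
          fix m assume m: "N \<le> m"
          have "(\<integral>\<^sup>+\<theta>. ennreal (cmod (s (q n) \<theta> - s (q m) \<theta>)) \<partial>circ)
             = ennreal (LINT \<theta>|circ. cmod (s (q n) \<theta> - s (q m) \<theta>))"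
            by (intro nn_integral_eq_integral) (auto intro!: si)
          also have "\<dots> \<le> ennreal e" using N[OF qn[OF n] qn[OF m]] by (intro ennreal_leI) auto
          finally show "(\<integral>\<^sup>+\<theta>. ennreal (cmod (s (q n) \<theta> - s (q m) \<theta>)) \<partial>circ) \<le> ennreal e" .
        qed
      qed simp
      finally show "(\<integral>\<^sup>+\<theta>. ennreal (cmod (s (q n) \<theta> - g \<theta>)) \<partial>circ) \<le> ennreal e" .
    qed
  qed
  show ?thesis
  proof (rule that[OF _ _ _ gm gper])
    show "0 < \<rho> n" "\<rho> n < 1" for n by (auto simp: \<rho>_def r)
    show "\<rho> \<longlonglongrightarrow> 1" unfolding \<rho>_def
      using LIMSEQ_subseq_LIMSEQ[OF rlim q(1)] by (simp add: o_def)
    show "AE \<theta> in circ. (\<lambda>n. f (of_real (\<rho> n) * cis \<theta>)) \<longlonglongrightarrow> g \<theta>"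
      using conv by (simp add: s_def \<rho>_def)
    show "(\<lambda>n. \<integral>\<^sup>+\<theta>. ennreal (cmod (f (of_real (\<rho> n) * cis \<theta>) - g \<theta>)) \<partial>circ) \<longlonglongrightarrow> 0"
      using L1 by (simp add: s_def \<rho>_def)
  qed
qed


text \<open>
  The Poisson bound for the difference of two dilates with \<open>\<rho>\<^sub>m\<close> and \<open>\<rho>\<^sub>n\<close>, in the limit \<open>m \<rightarrow> \<infinity>\<close>. For
  fixed \<open>r\<close> the kernel is bounded, so the error made in replacing the \<open>m\<close>-th dilate by \<open>g\<close> vanishes.
\<close>
lemma radial_oscillation_bound:
  fixes f :: "complex \<Rightarrow> complex" and g :: "real \<Rightarrow> complex" and \<rho> :: "nat \<Rightarrow> real"
  assumes hol: "f holomorphic_on ball 0 1"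
    and \<rho>: "\<And>n. 0 < \<rho> n" "\<And>n. \<rho> n < 1" "\<rho> \<longlonglongrightarrow> 1"
    and g[measurable]: "g \<in> borel_measurable borel" and per: "\<And>x. g (x + 2 * pi) = g x"
  defines "h n \<theta> \<equiv> ennreal (cmod (f (of_real (\<rho> n) * cis \<theta>) - g \<theta>))"
  assumes L1: "(\<lambda>n. \<integral>\<^sup>+\<theta>. h n \<theta> \<partial>circ) \<longlonglongrightarrow> 0" and r: "0 \<le> r" "r < 1"
  shows "ennreal (cmod (f (of_real r * cis \<alpha>) - f (of_real (\<rho> n) * (of_real r * cis \<alpha>))))
     \<le> (\<integral>\<^sup>+s. ennreal (poisson_kernel r s) * h n (\<alpha> + s) \<partial>circ)"
proof -
  have [measurable]: "(\<lambda>\<theta>. f (of_real (\<rho> n) * cis \<theta>)) \<in> borel_measurable borel" for n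
    using \<rho>(1,2)[of n] by (intro circle_function_measurable hol) auto
  have hm[measurable]: "h n \<in> borel_measurable borel" for n unfolding h_def by measurable
  have hper: "h n (x + 2 * pi) = h n x" for n x unfolding h_def by (simp add: per cis_add_2pi)
  let ?z = "of_real r * cis \<alpha>"
  have step: "ennreal (cmod (f (of_real (\<rho> m) * ?z) - f (of_real (\<rho> n) * ?z)))
     \<le> ennreal (2 / (1 - r)) * (\<integral>\<^sup>+s. h m s \<partial>circ) + (\<integral>\<^sup>+s. ennreal (poisson_kernel r s) * h n (\<alpha> + s) \<partial>circ)" for m
  proof -
    define k where "k w = f (of_real (\<rho> m) * w) - f (of_real (\<rho> n) * w)" for w
    define R where "R = 1 / max (\<rho> m) (\<rho> n)"
    have R: "1 < R" unfolding R_def using \<rho>(1,2)[of m] \<rho>(1,2)[of n] by (simp add: max_def)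
    have "k holomorphic_on ball 0 R"
      unfolding k_def using \<rho>(1,2)[of m] \<rho>(1,2)[of n]
      by (intro holomorphic_intros holomorphic_on_dilation[OF hol]) (auto simp: R_def max_def field_simps)
    then have "ennreal (cmod (k ?z)) \<le> (\<integral>\<^sup>+s. ennreal (poisson_kernel r s) * ennreal (cmod (k (cis (\<alpha> + s)))) \<partial>circ)"
      using R r by (rule poisson_bound)
    also have "\<dots> \<le> (\<integral>\<^sup>+s. ennreal (2 / (1 - r)) * h m (\<alpha> + s) + ennreal (poisson_kernel r s) * h n (\<alpha> + s) \<partial>circ)"
    proof (rule nn_integral_mono)
      fix s
      have "cmod (k (cis (\<alpha> + s))) \<le> cmod (f (of_real (\<rho> m) * cis (\<alpha> + s)) - g (\<alpha> + s)) + cmod (f (of_real (\<rho> n) * cis (\<alpha> + s)) - g (\<alpha> + s))"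
        unfolding k_def using norm_triangle_ineq4[of "f (of_real (\<rho> m) * cis (\<alpha> + s)) - g (\<alpha> + s)" "f (of_real (\<rho> n) * cis (\<alpha> + s)) - g (\<alpha> + s)"]
        by simp
      then have "ennreal (cmod (k (cis (\<alpha> + s)))) \<le> h m (\<alpha> + s) + h n (\<alpha> + s)"
        unfolding h_def by (simp flip: ennreal_plus)
      then have "ennreal (poisson_kernel r s) * ennreal (cmod (k (cis (\<alpha> + s)))) \<le> ennreal (poisson_kernel r s) * (h m (\<alpha> + s) + h n (\<alpha> + s))"
        by (rule mult_left_mono) simp
      also have "\<dots> = ennreal (poisson_kernel r s) * h m (\<alpha> + s) + ennreal (poisson_kernel r s) * h n (\<alpha> + s)"
        by (rule distrib_left)
      also have "\<dots> \<le> ennreal (2 / (1 - r)) * h m (\<alpha> + s) + ennreal (poisson_kernel r s) * h n (\<alpha> + s)"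
        using poisson_kernel_le[OF r] by (intro add_right_mono mult_right_mono ennreal_leI) auto
      finally show "ennreal (poisson_kernel r s) * ennreal (cmod (k (cis (\<alpha> + s)))) \<le> ennreal (2 / (1 - r)) * h m (\<alpha> + s) + ennreal (poisson_kernel r s) * h n (\<alpha> + s)" .
    qed
    also have "\<dots> = ennreal (2 / (1 - r)) * (\<integral>\<^sup>+s. h m (\<alpha> + s) \<partial>circ) + (\<integral>\<^sup>+s. ennreal (poisson_kernel r s) * h n (\<alpha> + s) \<partial>circ)"
      by (simp add: nn_integral_add nn_integral_cmult)
    also have "(\<integral>\<^sup>+s. h m (\<alpha> + s) \<partial>circ) = (\<integral>\<^sup>+s. h m s \<partial>circ)"
      using nn_integral_circ_shift[of "h m" \<alpha>, OF hm hper] by (simp add: add.commute)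
    finally show ?thesis by (simp add: k_def)
  qed
  have "(\<lambda>m. f (of_real (\<rho> m) * ?z)) \<longlonglongrightarrow> f ?z"
    using r by (intro tendsto_dilation hol \<rho>(3)) (simp add: norm_mult)
  then have 1: "(\<lambda>m. ennreal (cmod (f (of_real (\<rho> m) * ?z) - f (of_real (\<rho> n) * ?z)))) \<longlonglongrightarrow> ennreal (cmod (f ?z - f (of_real (\<rho> n) * ?z)))"
    by (intro tendsto_intros) auto
  have "(\<lambda>m. ennreal (2 / (1 - r)) * (\<integral>\<^sup>+s. h m s \<partial>circ) + (\<integral>\<^sup>+s. ennreal (poisson_kernel r s) * h n (\<alpha> + s) \<partial>circ))
     \<longlonglongrightarrow> ennreal (2 / (1 - r)) * 0 + (\<integral>\<^sup>+s. ennreal (poisson_kernel r s) * h n (\<alpha> + s) \<partial>circ)"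
    by (intro tendsto_add ennreal_tendsto_cmult L1 tendsto_const) auto
  then show ?thesis using LIMSEQ_le[OF 1] step by auto
qed

text \<open>
  Off the weak-type exceptional set of \<open>|f(\<rho>\<^sub>n\<cdot>) - g|\<close>, the function \<open>f\<close> differs on the whole radius by
  \<open>O(\<kappa>)\<close> from the dilate \<open>f(\<rho>\<^sub>n\<cdot>)\<close>, which is continuous up to the circle, and that dilate is within
  \<open>\<kappa>\<close> of \<open>g\<close> on the circle. The exceptional sets \<open>C n\<close> have measure tending to \<open>0\<close>, so their
  intersection is a null set.
\<close>
lemma radial_limit_AE:
  fixes f :: "complex \<Rightarrow> complex" and g :: "real \<Rightarrow> complex" and \<rho> :: "nat \<Rightarrow> real"
  assumes hol: "f holomorphic_on ball 0 1"
    and \<rho>: "\<And>n. 0 < \<rho> n" "\<And>n. \<rho> n < 1" "\<rho> \<longlonglongrightarrow> 1"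
    and g[measurable]: "g \<in> borel_measurable borel" and per: "\<And>x. g (x + 2 * pi) = g x"
    and L1: "(\<lambda>n. \<integral>\<^sup>+\<theta>. ennreal (cmod (f (of_real (\<rho> n) * cis \<theta>) - g \<theta>)) \<partial>circ) \<longlonglongrightarrow> 0"
  shows "AE \<theta> in circ. ((\<lambda>r. f (of_real r * cis \<theta>)) \<longlongrightarrow> g \<theta>) (at_left 1)"
proof -
  define h where "h n \<theta> = ennreal (cmod (f (of_real (\<rho> n) * cis \<theta>) - g \<theta>))" for n \<theta>
  have [measurable]: "(\<lambda>\<theta>. f (of_real (\<rho> n) * cis \<theta>)) \<in> borel_measurable borel" for n
    using \<rho>(1,2)[of n] by (intro circle_function_measurable hol) auto
  have hm[measurable]: "h n \<in> borel_measurable borel" for n unfolding h_def by measurable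
  have hper: "h n (x + 2 * pi) = h n x" for n x unfolding h_def by (simp add: per cis_add_2pi)
  have L1': "(\<lambda>n. \<integral>\<^sup>+\<theta>. h n \<theta> \<partial>circ) \<longlonglongrightarrow> 0" using L1 by (simp add: h_def)
  have main: "AE \<theta> in circ. \<forall>\<^sub>F r in at_left 1. cmod (f (of_real r * cis \<theta>) - g \<theta>) \<le> 9218 * \<kappa>"
    if \<kappa>: "0 < \<kappa>" for \<kappa>
  proof -
    define good where "good n B \<longleftrightarrow> B \<in> sets borel \<and> emeasure circ B \<le> ennreal (10 / \<kappa>) * (\<integral>\<^sup>+x. h n x \<partial>circ) \<and>
      (\<forall>\<alpha> r. \<alpha> \<in> {-pi..pi} - B \<longrightarrow> 0 \<le> r \<longrightarrow> r < 1 \<longrightarrow>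
       (\<integral>\<^sup>+s. ennreal (poisson_kernel r s) * h n (\<alpha> + s) \<partial>circ) \<le> ennreal (9216 * \<kappa>))" for n B
    have "\<exists>B. good n B" for n
      by (rule weak_type_poisson[OF hm hper \<kappa>, of n]) (auto simp: good_def)
    then obtain B where good: "\<And>n. good n (B n)" by metis
    have B: "B n \<in> sets borel"
       "emeasure circ (B n) \<le> ennreal (10 / \<kappa>) * (\<integral>\<^sup>+x. h n x \<partial>circ)"
       "\<alpha> \<in> {-pi..pi} - B n \<Longrightarrow> 0 \<le> r \<Longrightarrow> r < 1 \<Longrightarrow>
       (\<integral>\<^sup>+s. ennreal (poisson_kernel r s) * h n (\<alpha> + s) \<partial>circ) \<le> ennreal (9216 * \<kappa>)" for n \<alpha> r
      using good[of n] unfolding good_def by blast+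
    define C where "C n = B n \<union> {x \<in> space circ. ennreal \<kappa> \<le> h n x}" for n
    have Bm[measurable]: "B n \<in> sets circ" for n using B(1) by simp
    have hmc[measurable]: "h n \<in> borel_measurable circ" for n
      using hm by (simp add: measurable_cong_sets[OF sets_circ refl])
    have Cm[measurable]: "C n \<in> sets circ" for n unfolding C_def by measurable
    have Cle: "emeasure circ (C n) \<le> ennreal (11 / \<kappa>) * (\<integral>\<^sup>+x. h n x \<partial>circ)" for n
    proof -
      have "emeasure circ (C n) \<le> emeasure circ (B n) + emeasure circ {x \<in> space circ. ennreal \<kappa> \<le> h n x}"
        unfolding C_def by (intro emeasure_subadditive) measurable
      also have "{x \<in> space circ. ennreal \<kappa> \<le> h n x} = {x \<in> space circ. 1 \<le> ennreal (1 / \<kappa>) * h n x}"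
      proof -
        have "ennreal \<kappa> \<le> y \<longleftrightarrow> 1 \<le> ennreal (1 / \<kappa>) * y" for y :: ennreal
        proof
          assume "ennreal \<kappa> \<le> y"
          then have "ennreal (1 / \<kappa>) * ennreal \<kappa> \<le> ennreal (1 / \<kappa>) * y" by (rule mult_left_mono) simp
          then show "1 \<le> ennreal (1 / \<kappa>) * y" using \<kappa> by (simp flip: ennreal_mult)
        next
          assume "1 \<le> ennreal (1 / \<kappa>) * y"
          then have "ennreal \<kappa> * 1 \<le> ennreal \<kappa> * (ennreal (1 / \<kappa>) * y)" by (rule mult_left_mono) simp
          also have "\<dots> = y" using \<kappa> by (simp add: mult.assoc[symmetric] flip: ennreal_mult)
          finally show "ennreal \<kappa> \<le> y" by simp
        qed
        then show ?thesis by simp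
      qed
      also have "emeasure circ {x \<in> space circ. 1 \<le> ennreal (1 / \<kappa>) * h n x} \<le> ennreal (1 / \<kappa>) * (\<integral>\<^sup>+x. h n x * indicator (space circ) x \<partial>circ)"
        using nn_integral_Markov_inequality[of "h n" "space circ" circ "ennreal (1 / \<kappa>)"] by simp
      also have "emeasure circ (B n) + ennreal (1 / \<kappa>) * (\<integral>\<^sup>+x. h n x * indicator (space circ) x \<partial>circ)
         \<le> ennreal (10 / \<kappa>) * (\<integral>\<^sup>+x. h n x \<partial>circ) + ennreal (1 / \<kappa>) * (\<integral>\<^sup>+x. h n x \<partial>circ)"
        using B(2)[of n] by (intro add_mono) auto
      also have "\<dots> = (ennreal (10 / \<kappa>) + ennreal (1 / \<kappa>)) * (\<integral>\<^sup>+x. h n x \<partial>circ)"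
        by (simp add: distrib_right)
      also have "ennreal (10 / \<kappa>) + ennreal (1 / \<kappa>) = ennreal (11 / \<kappa>)"
        using \<kappa> by (simp flip: ennreal_plus add: add_divide_distrib[symmetric])
      finally show ?thesis by (simp add: add_left_mono)
    qed
    have "(\<lambda>n. ennreal (11 / \<kappa>) * (\<integral>\<^sup>+x. h n x \<partial>circ)) \<longlonglongrightarrow> ennreal (11 / \<kappa>) * 0"
      by (intro ennreal_tendsto_cmult L1') auto
    then have C0: "(\<lambda>n. ennreal (11 / \<kappa>) * (\<integral>\<^sup>+x. h n x \<partial>circ)) \<longlonglongrightarrow> 0" by simp
    have "emeasure circ (\<Inter>n. C n) \<le> 0"
    proof (rule LIMSEQ_le_const[OF C0], intro exI allI impI)
      fix n
      have "emeasure circ (\<Inter>n. C n) \<le> emeasure circ (C n)" by (intro emeasure_mono Cm) auto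
      then show "emeasure circ (\<Inter>n. C n) \<le> ennreal (11 / \<kappa>) * (\<integral>\<^sup>+x. h n x \<partial>circ)"
        using Cle order_trans by blast
    qed
    moreover have "(\<Inter>n. C n) \<in> sets circ" by measurable
    ultimately have null: "(\<Inter>n. C n) \<in> null_sets circ"
      by (intro null_setsI) auto
    have "AE \<theta> in circ. \<theta> \<notin> (\<Inter>n. C n)" using null by (rule AE_not_in)
    then show ?thesis using AE_circ_bounds
    proof eventually_elim
      case (elim \<theta>)
      then obtain n where n: "\<theta> \<notin> C n" by auto
      let ?w = "of_real (\<rho> n) * cis \<theta>"
      have gl: "cmod (f ?w - g \<theta>) \<le> \<kappa>"
        using n \<kappa> unfolding C_def h_def by (auto simp: not_le ennreal_less_iff)
      have "((\<lambda>r. f (of_real r * ?w)) \<longlongrightarrow> f ?w) (at_left 1)"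
        using \<rho>(1,2)[of n] by (intro tendsto_dilation hol tendsto_ident_at) (simp add: norm_mult)
      then have "((\<lambda>r. f (of_real (\<rho> n) * (of_real r * cis \<theta>))) \<longlongrightarrow> f ?w) (at_left 1)"
        by (simp only: mult.left_commute)
      then have "\<forall>\<^sub>F r in at_left 1. dist (f (of_real (\<rho> n) * (of_real r * cis \<theta>))) (f ?w) < \<kappa>"
        using \<kappa> by (rule tendstoD)
      moreover have "\<forall>\<^sub>F r in at_left (1::real). r \<in> {0<..<1}"
        by (rule eventually_at_left_real) simp
      ultimately show ?case
      proof eventually_elim
        case (elim r)
        let ?z = "of_real r * cis \<theta>"
        have "ennreal (cmod (f ?z - f (of_real (\<rho> n) * ?z))) \<le> (\<integral>\<^sup>+s. ennreal (poisson_kernel r s) * h n (\<theta> + s) \<partial>circ)"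
          unfolding h_def using elim by (intro radial_oscillation_bound[OF hol \<rho> g per L1]) auto
        also have "\<dots> \<le> ennreal (9216 * \<kappa>)"
          using elim n \<open>\<theta> \<in> {-pi..pi}\<close> by (intro B(3)) (auto simp: C_def)
        finally have "cmod (f ?z - f (of_real (\<rho> n) * ?z)) \<le> 9216 * \<kappa>"
          using \<kappa> by (simp add: ennreal_le_iff)
        moreover have "cmod (f (of_real (\<rho> n) * ?z) - f ?w) < \<kappa>"
          using elim by (simp add: dist_norm)
        ultimately show ?case using gl
          norm_triangle_ineq[of "f ?z - f (of_real (\<rho> n) * ?z)" "f (of_real (\<rho> n) * ?z) - f ?w"]
          norm_triangle_ineq[of "f ?z - f ?w" "f ?w - g \<theta>"] by simp
      qed
    qed
  qed
  have "AE \<theta> in circ. \<forall>k::nat. \<forall>\<^sub>F r in at_left 1. cmod (f (of_real r * cis \<theta>) - g \<theta>) \<le> 9218 * (1 / real (Suc k))"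
    unfolding AE_all_countable by (intro allI main) simp
  then show ?thesis
  proof eventually_elim
    case (elim \<theta>)
    show ?case
    proof (rule tendstoI)
      fix e :: real assume "0 < e"
      then obtain k where k: "1 / real (Suc k) < e / 9218"
        using nat_approx_posE[of "e / 9218"] by (auto simp: inverse_eq_divide)
      show "\<forall>\<^sub>F r in at_left 1. dist (f (of_real r * cis \<theta>)) (g \<theta>) < e"
        using elim[rule_format, of k]
        by (rule eventually_mono) (use k in \<open>unfold dist_norm, linarith\<close>)
    qed
  qed
qed


text \<open>
  By Cauchy's criterion the radial limit exists at \<open>\<theta>\<close> iff the oscillation over \<open>(1 - \<epsilon>, 1)\<close> tends to
  \<open>0\<close>. The conditions that bound an oscillation are closed in \<open>\<theta>\<close>, being intersections of closed ones
  over all pairs of radii, so the set \<open>E\<close> of convergence is Borel. Off \<open>E\<close> the boundary value is a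
  constant default.
\<close>
lemma boundary_value_measurable:
  assumes hol: "f holomorphic_on ball 0 1"
  shows "boundary_value f \<in> borel_measurable borel"
proof -
  define F where "F r \<theta> = f (of_real r * cis \<theta>)" for r \<theta>
  define I where "I m = {1 - 1 / (real m + 2)<..<1}" for m
  define \<sigma> where "\<sigma> n = 1 - 1 / (real n + 2)" for n
  define S where "S m k = {\<theta>. \<forall>r\<in>I m. \<forall>s\<in>I m. cmod (F r \<theta> - F s \<theta>) \<le> 1 / real (Suc k)}" for m k
  define E where "E = (\<Inter>k. \<Union>m. S m k)"
  have I01: "0 < r \<and> r < 1" if "r \<in> I m" for r m
  proof -
    have "0 < 1 - 1 / (real m + 2)" by simp
    moreover have "1 - 1 / (real m + 2) < r" "r < 1" using that unfolding I_def by simp_all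
    ultimately show ?thesis by linarith
  qed
  have Fc: "continuous_on UNIV (F r)" if "r \<in> I m" for r m
    unfolding F_def using I01[OF that] by (intro continuous_on_circle_function[OF hol]) auto
  have "closed (S m k)" for m k
  proof -
    have "S m k = (\<Inter>r\<in>I m. \<Inter>s\<in>I m. {\<theta>. cmod (F r \<theta> - F s \<theta>) \<le> 1 / real (Suc k)})"
      unfolding S_def by auto
    moreover have "closed {\<theta>. cmod (F r \<theta> - F s \<theta>) \<le> 1 / real (Suc k)}" if "r \<in> I m" "s \<in> I m" for r s
      by (intro closed_Collect_le continuous_intros Fc[OF that(1)] Fc[OF that(2)])
    ultimately show ?thesis by (simp only:) (intro closed_INT ballI)
  qed
  then have [measurable]: "E \<in> sets borel" unfolding E_def by measurable
  have \<sigma>: "\<sigma> \<longlonglongrightarrow> 1" unfolding \<sigma>_def by real_asymp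
  have \<sigma>I: "\<forall>\<^sub>F n in sequentially. \<sigma> n \<in> I m" for m
  proof -
    have "1 - 1 / (real m + 2) < 1" by simp
    from order_tendstoD(1)[OF \<sigma> this] have "\<forall>\<^sub>F n in sequentially. 1 - 1 / (real m + 2) < \<sigma> n" .
    then show ?thesis by eventually_elim (auto simp: I_def \<sigma>_def)
  qed
  have \<sigma>left: "filterlim \<sigma> (at_left 1) sequentially"
    unfolding filterlim_at using \<sigma> by (auto simp: \<sigma>_def eventually_sequentially)
  have EI: "((\<lambda>r. F r \<theta>) \<longlongrightarrow> lim (\<lambda>n. F (\<sigma> n) \<theta>)) (at_left 1)" if E: "\<theta> \<in> E" for \<theta>
  proof -
    have osc: "\<exists>m. \<forall>r\<in>I m. \<forall>s\<in>I m. cmod (F r \<theta> - F s \<theta>) < e" if e0: "0 < e" for e :: real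
    proof -
      obtain k where k: "1 / real (Suc k) < e" using nat_approx_posE[OF e0] by (auto simp: inverse_eq_divide)
      obtain m where "\<theta> \<in> S m k" using E unfolding E_def by auto
      then show ?thesis using k unfolding S_def by (auto intro!: exI[of _ m] intro: le_less_trans)
    qed
    have "Cauchy (\<lambda>n. F (\<sigma> n) \<theta>)"
    proof (rule CauchyI)
      fix e :: real assume "0 < e"
      then obtain m where m: "\<forall>r\<in>I m. \<forall>s\<in>I m. cmod (F r \<theta> - F s \<theta>) < e" using osc by blast
      obtain N where "\<And>n. N \<le> n \<Longrightarrow> \<sigma> n \<in> I m" using \<sigma>I[of m] by (auto simp: eventually_sequentially)
      then show "\<exists>M. \<forall>i\<ge>M. \<forall>j\<ge>M. cmod (F (\<sigma> i) \<theta> - F (\<sigma> j) \<theta>) < e" using m by blast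
    qed
    then have l: "(\<lambda>n. F (\<sigma> n) \<theta>) \<longlonglongrightarrow> lim (\<lambda>n. F (\<sigma> n) \<theta>)"
      by (simp add: Cauchy_convergent_iff convergent_LIMSEQ_iff)
    show ?thesis
    proof (rule tendstoI)
      fix e :: real assume e: "0 < e"
      then obtain m where m: "\<forall>r\<in>I m. \<forall>s\<in>I m. cmod (F r \<theta> - F s \<theta>) < e / 2" using osc[of "e / 2"] by auto
      have "\<forall>\<^sub>F r in at_left 1. r \<in> I m" unfolding I_def by (rule eventually_at_left_real) simp
      then show "\<forall>\<^sub>F r in at_left 1. dist (F r \<theta>) (lim (\<lambda>n. F (\<sigma> n) \<theta>)) < e"
      proof eventually_elim
        case (elim r)
        have "(\<lambda>n. cmod (F r \<theta> - F (\<sigma> n) \<theta>)) \<longlonglongrightarrow> cmod (F r \<theta> - lim (\<lambda>n. F (\<sigma> n) \<theta>))"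
          by (intro tendsto_intros l)
        moreover have "\<forall>\<^sub>F n in sequentially. cmod (F r \<theta> - F (\<sigma> n) \<theta>) \<le> e / 2"
          using \<sigma>I[of m] by eventually_elim (use m elim in \<open>auto intro: less_imp_le\<close>)
        ultimately have "cmod (F r \<theta> - lim (\<lambda>n. F (\<sigma> n) \<theta>)) \<le> e / 2"
          by (rule tendsto_upperbound) simp
        then show ?case using e by (simp add: dist_norm)
      qed
    qed
  qed
  have EE: "\<theta> \<in> E" if l: "((\<lambda>r. F r \<theta>) \<longlongrightarrow> l) (at_left 1)" for \<theta> l
    unfolding E_def
  proof
    fix k :: nat
    define e where "e = 1 / real (Suc k)"
    have "\<forall>\<^sub>F r in at_left 1. dist (F r \<theta>) l < e / 2" using l by (rule tendstoD) (simp add: e_def)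
    then obtain b where b: "b < 1" "\<And>r. b < r \<Longrightarrow> r < 1 \<Longrightarrow> dist (F r \<theta>) l < e / 2"
      unfolding eventually_at_left_field by auto
    obtain m where m: "1 / real (Suc m) < 1 - b" using nat_approx_posE[of "1 - b"] b(1) by (auto simp: inverse_eq_divide)
    have "1 / (real m + 2) \<le> 1 / real (Suc m)" by (simp add: field_simps)
    then have Ib: "b < r" if "r \<in> I m" for r using that m by (auto simp: I_def)
    have "\<theta> \<in> S m k"
      unfolding S_def e_def[symmetric]
    proof (intro CollectI ballI)
      fix r s assume "r \<in> I m" "s \<in> I m"
      then have "dist (F r \<theta>) l < e / 2" "dist (F s \<theta>) l < e / 2" using b(2) Ib I01 by blast+
      then have "dist (F r \<theta>) (F s \<theta>) < e" by (rule dist_triangle_half_l)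
      then show "cmod (F r \<theta> - F s \<theta>) \<le> e" by (simp add: dist_norm)
    qed
    then show "\<theta> \<in> (\<Union>m. S m k)" by blast
  qed
  have bv: "boundary_value f \<theta> = (if \<theta> \<in> E then lim (\<lambda>n. F (\<sigma> n) \<theta>) else (THE l. False))" for \<theta>
  proof (cases "\<theta> \<in> E")
    case True
    then show ?thesis using tendsto_Lim[OF _ EI[OF True]] unfolding boundary_value_def F_def by simp
  next
    case False
    then have "\<not> ((\<lambda>r. F r \<theta>) \<longlongrightarrow> l) (at_left 1)" for l using EE by blast
    then show ?thesis using False unfolding boundary_value_def t2_space_class.Lim_def F_def by simp
  qed
  have [measurable]: "F (\<sigma> n) \<in> borel_measurable borel" for n
    unfolding F_def by (intro circle_function_measurable hol) (auto simp: \<sigma>_def)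
  have "boundary_value f = (\<lambda>\<theta>. if \<theta> \<in> E then lim (\<lambda>n. F (\<sigma> n) \<theta>) else (THE l. False))"
    using bv by auto
  also have "\<dots> \<in> borel_measurable borel" by measurable
  finally show ?thesis .
qed

lemma boundary_value_periodic: "boundary_value f (x + 2 * pi) = boundary_value f x"
  unfolding boundary_value_def by (simp only: cis_add_2pi)

lemma boundary_value_eq: "((\<lambda>r. f (of_real r * cis \<theta>)) \<longlongrightarrow> l) (at_left 1) \<Longrightarrow> boundary_value f \<theta> = l"
  unfolding boundary_value_def by (rule tendsto_Lim) simp_all

text \<open>
  The form in which boundary values enter the later estimates: identities and bounds for the
  continuous functions \<open>f(\<rho>\<^sub>n\<cdot>)\<close> on the circle pass to the boundary values in mean.
\<close>
lemma hardy_boundary_value_L1: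
  assumes f: "f \<in> hardy_space p" and p: "1 < p"
  obtains \<rho> where "\<And>n. 0 < \<rho> n" "\<And>n. \<rho> n < 1" "\<rho> \<longlonglongrightarrow> (1::real)"
    "(\<lambda>n. \<integral>\<^sup>+\<theta>. ennreal (cmod (f (of_real (\<rho> n) * cis \<theta>) - boundary_value f \<theta>)) \<partial>circ) \<longlonglongrightarrow> 0"
    "(\<integral>\<^sup>+\<theta>. ennreal (cmod (boundary_value f \<theta>) powr p) \<partial>circ) \<le> ennreal (hardy_norm p f powr p)"
proof -
  have hol: "f holomorphic_on ball 0 1" using f by (rule hardy_space_imp_holomorphic)
  show ?thesis
  proof (rule hardy_L1_limit[OF f p])
    fix \<rho> g
    assume \<rho>: "\<And>n. 0 < \<rho> n" "\<And>n. \<rho> n < 1" "\<rho> \<longlonglongrightarrow> (1::real)"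
      and g: "g \<in> borel_measurable borel" "\<And>x. g (x + 2 * pi) = g x"
      "AE \<theta> in circ. (\<lambda>n. f (of_real (\<rho> n) * cis \<theta>)) \<longlonglongrightarrow> g \<theta>"
      "(\<lambda>n. \<integral>\<^sup>+\<theta>. ennreal (cmod (f (of_real (\<rho> n) * cis \<theta>) - g \<theta>)) \<partial>circ) \<longlonglongrightarrow> 0"
    have "AE \<theta> in circ. ((\<lambda>r. f (of_real r * cis \<theta>)) \<longlongrightarrow> g \<theta>) (at_left 1)"
      by (rule radial_limit_AE[OF hol \<rho> g(1,2,4)])
    then have eq: "AE \<theta> in circ. boundary_value f \<theta> = g \<theta>"
      by eventually_elim (rule boundary_value_eq)
    have fm: "(\<lambda>\<theta>. f (of_real (\<rho> n) * cis \<theta>)) \<in> borel_measurable borel" for n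
      using \<rho>(1,2)[of n] by (intro circle_function_measurable hol) auto
    have fmc[measurable]: "(\<lambda>\<theta>. f (of_real (\<rho> n) * cis \<theta>)) \<in> borel_measurable circ" for n
      using fm by (simp add: measurable_cong_sets[OF sets_circ refl])
    show ?thesis
    proof (rule that[OF \<rho>])
      have "(\<integral>\<^sup>+\<theta>. ennreal (cmod (f (of_real (\<rho> n) * cis \<theta>) - boundary_value f \<theta>)) \<partial>circ)
         = (\<integral>\<^sup>+\<theta>. ennreal (cmod (f (of_real (\<rho> n) * cis \<theta>) - g \<theta>)) \<partial>circ)" for n
        using eq by (intro nn_integral_cong_AE) (auto elim!: eventually_mono)
      then show "(\<lambda>n. \<integral>\<^sup>+\<theta>. ennreal (cmod (f (of_real (\<rho> n) * cis \<theta>) - boundary_value f \<theta>)) \<partial>circ) \<longlonglongrightarrow> 0"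
        using g(4) by simp
      have "(\<integral>\<^sup>+\<theta>. ennreal (cmod (boundary_value f \<theta>) powr p) \<partial>circ)
         = (\<integral>\<^sup>+\<theta>. liminf (\<lambda>n. ennreal (cmod (f (of_real (\<rho> n) * cis \<theta>)) powr p)) \<partial>circ)"
      proof (rule nn_integral_cong_AE)
        show "AE \<theta> in circ. ennreal (cmod (boundary_value f \<theta>) powr p) = liminf (\<lambda>n. ennreal (cmod (f (of_real (\<rho> n) * cis \<theta>)) powr p))"
          using eq g(3)
        proof eventually_elim
          case (elim \<theta>)
          have "(\<lambda>n. cmod (f (of_real (\<rho> n) * cis \<theta>)) powr p) \<longlonglongrightarrow> cmod (g \<theta>) powr p"
            by (rule tendsto_powr'[OF tendsto_norm[OF elim(2)] tendsto_const]) (use p in auto)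
          then have "(\<lambda>n. ennreal (cmod (f (of_real (\<rho> n) * cis \<theta>)) powr p)) \<longlonglongrightarrow> ennreal (cmod (boundary_value f \<theta>) powr p)"
            unfolding elim(1) by (rule tendsto_ennrealI)
          then show ?case by (intro lim_imp_Liminf[symmetric]) auto
        qed
      qed
      also have "\<dots> \<le> liminf (\<lambda>n. \<integral>\<^sup>+\<theta>. ennreal (cmod (f (of_real (\<rho> n) * cis \<theta>)) powr p) \<partial>circ)"
        by (intro nn_integral_liminf) measurable
      also have "\<dots> \<le> ennreal (hardy_norm p f powr p)"
        using hardy_nn_integral_le[OF f _ \<rho>(1,2)] p by (intro Liminf_le) auto
      finally show "(\<integral>\<^sup>+\<theta>. ennreal (cmod (boundary_value f \<theta>) powr p) \<partial>circ) \<le> ennreal (hardy_norm p f powr p)" .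
    qed
  qed
qed

section \<open>Increments of the boundary values\<close>

lemma contour_circlepath_bound:
  assumes I: "(g has_contour_integral I) (circlepath 0 \<rho>)" and \<rho>: "0 \<le> \<rho>"
    and c: "continuous_on UNIV (\<lambda>\<theta>. g (of_real \<rho> * cis \<theta>))"
  shows "ennreal (cmod I) \<le> ennreal (2 * pi * \<rho>) * (\<integral>\<^sup>+\<theta>. ennreal (cmod (g (of_real \<rho> * cis \<theta>))) \<partial>circ)"
proof -
  define G where "G \<theta> = g (of_real \<rho> * cis \<theta>) * of_real \<rho> * \<i> * cis \<theta>" for \<theta>
  have Gc: "continuous_on UNIV G" unfolding G_def by (intro continuous_intros c)
  have [measurable]: "G \<in> borel_measurable borel" by (rule borel_measurable_continuous_onI[OF Gc])
  have gm[measurable]: "(\<lambda>\<theta>. g (of_real \<rho> * cis \<theta>)) \<in> borel_measurable borel"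
    by (rule borel_measurable_continuous_onI[OF c])
  have "(G has_integral I) {0..2 * pi}"
    using I unfolding circlepath_def G_def by (subst (asm) has_contour_integral_part_circlepath_iff) auto
  then have "I = integral {0..2 * pi} G" by (simp add: integral_unique)
  also have "\<dots> = (LBINT \<theta>:{0..2 * pi}. G \<theta>)"
    by (intro set_borel_integral_eq_integral(2)[symmetric] borel_integrable_atLeastAtMost')
      (use Gc continuous_on_subset in auto)
  finally have I_eq: "I = (LINT \<theta>|lborel. indicator {0..2 * pi} \<theta> *\<^sub>R G \<theta>)"
    by (simp add: set_lebesgue_integral_def)
  have "set_integrable lborel {0..2 * pi} G"
    by (rule borel_integrable_atLeastAtMost') (use Gc continuous_on_subset in auto)
  then have int: "integrable lborel (\<lambda>\<theta>. norm (indicator {0..2 * pi} \<theta> *\<^sub>R G \<theta>))"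
    unfolding set_integrable_def by (rule integrable_norm)
  have "cmod I \<le> (LINT \<theta>|lborel. norm (indicator {0..2 * pi} \<theta> *\<^sub>R G \<theta>))"
    unfolding I_eq by (rule integral_norm_bound)
  then have "ennreal (cmod I) \<le> ennreal (LINT \<theta>|lborel. norm (indicator {0..2 * pi} \<theta> *\<^sub>R G \<theta>))"
    by (rule ennreal_leI)
  also have "\<dots> = (\<integral>\<^sup>+\<theta>. ennreal (norm (indicator {0..2 * pi} \<theta> *\<^sub>R G \<theta>)) \<partial>lborel)"
    using int by (intro nn_integral_eq_integral[symmetric]) auto
  also have "\<dots> = (\<integral>\<^sup>+\<theta>. ennreal \<rho> * (ennreal (cmod (g (of_real \<rho> * cis \<theta>))) * indicator {0..2 * pi} \<theta>) \<partial>lborel)"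
    using \<rho> by (intro nn_integral_cong) (auto simp: G_def norm_mult ennreal_mult mult.commute split: split_indicator)
  also have "\<dots> = ennreal \<rho> * (\<integral>\<^sup>+\<theta>. ennreal (cmod (g (of_real \<rho> * cis \<theta>))) * indicator {0..2 * pi} \<theta> \<partial>lborel)"
    by (rule nn_integral_cmult) measurable
  also have "(\<integral>\<^sup>+\<theta>. ennreal (cmod (g (of_real \<rho> * cis \<theta>))) * indicator {0..2 * pi} \<theta> \<partial>lborel)
     = (\<integral>\<^sup>+\<theta>. ennreal (cmod (g (of_real \<rho> * cis \<theta>))) * indicator {-pi..pi} \<theta> \<partial>lborel)"
    using nn_integral_period_window[of "\<lambda>\<theta>. ennreal (cmod (g (of_real \<rho> * cis \<theta>)))" pi]
    by (simp add: cis_add_2pi)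
  also have "ennreal \<rho> * \<dots> = ennreal (2 * pi * \<rho>) * (\<integral>\<^sup>+\<theta>. ennreal (cmod (g (of_real \<rho> * cis \<theta>))) \<partial>circ)"
    using \<rho> by (subst nn_integral_circ) (simp_all add: mult.assoc[symmetric] flip: ennreal_mult)
  finally show ?thesis .
qed

lemma le_of_young_split:
  fixes x Q p :: real
  assumes p: "1 < p" and Q: "0 \<le> Q" and le: "\<And>l. 0 < l \<Longrightarrow> x \<le> l + l powr (1 - p) * Q"
  shows "x \<le> 2 * Q powr (1 / p)"
proof (cases "Q = 0")
  case True
  then have "x \<le> 0" using le field_le_epsilon[of x 0] by simp
  then show ?thesis using True by simp
next
  case False
  then have Q0: "0 < Q" using Q by simp
  define l where "l = Q powr (1 / p)"
  have l: "0 < l" using Q0 by (simp add: l_def)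
  have "l powr (1 - p) * Q = l powr (1 - p) * l powr p"
    unfolding l_def using Q0 p by (simp add: powr_powr)
  also have "\<dots> = l" using l by (simp flip: powr_add)
  finally show ?thesis using le[OF l] by (simp add: l_def)
qed

lemma powr_add_le:
  fixes a b :: real
  assumes "0 \<le> a" "0 \<le> b" "0 < p"
  shows "(a + b) powr p \<le> 2 powr p * (a powr p + b powr p)"
proof -
  have "(a + b) powr p \<le> (2 * max a b) powr p" using assms by (intro powr_mono2) auto
  also have "\<dots> = 2 powr p * max a b powr p" using assms by (simp add: powr_mult)
  also have "max a b powr p \<le> a powr p + b powr p" by (simp add: max_def)
  finally show ?thesis by (simp add: mult_left_mono)
qed

definition bv_diff :: "(complex \<Rightarrow> complex) \<Rightarrow> real \<Rightarrow> real \<Rightarrow> complex" where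
  "bv_diff f t \<theta> = boundary_value f (\<theta> + t) - boundary_value f \<theta>"

lemma bv_diff_measurable:
  assumes "f holomorphic_on ball 0 1"
  shows "bv_diff f t \<in> borel_measurable borel"
proof -
  note [measurable] = boundary_value_measurable[OF assms]
  show ?thesis unfolding bv_diff_def by measurable
qed

lemma bv_diff_nn_integral_le:
  assumes f: "f \<in> hardy_space p" and p: "1 < p"
  shows "(\<integral>\<^sup>+\<theta>. ennreal (cmod (bv_diff f t \<theta>) powr p) \<partial>circ) \<le> ennreal (2 powr p * (2 * hardy_norm p f powr p))"
proof -
  note [measurable] = boundary_value_measurable[OF hardy_space_imp_holomorphic[OF f]]
  define b where "b \<theta> = ennreal (cmod (boundary_value f \<theta>) powr p)" for \<theta>
  have [measurable]: "b \<in> borel_measurable borel" unfolding b_def by measurable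
  have bH: "(\<integral>\<^sup>+\<theta>. b \<theta> \<partial>circ) \<le> ennreal (hardy_norm p f powr p)"
    unfolding b_def by (rule hardy_boundary_value_L1[OF f p])
  have "(\<integral>\<^sup>+\<theta>. ennreal (cmod (bv_diff f t \<theta>) powr p) \<partial>circ) \<le> (\<integral>\<^sup>+\<theta>. ennreal (2 powr p) * (b (\<theta> + t) + b \<theta>) \<partial>circ)"
  proof (rule nn_integral_mono)
    fix \<theta>
    have "cmod (bv_diff f t \<theta>) powr p \<le> (cmod (boundary_value f (\<theta> + t)) + cmod (boundary_value f \<theta>)) powr p"
      unfolding bv_diff_def using p by (intro powr_mono2 norm_triangle_ineq4) auto
    also have "\<dots> \<le> 2 powr p * (cmod (boundary_value f (\<theta> + t)) powr p + cmod (boundary_value f \<theta>) powr p)"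
      using p by (intro powr_add_le) auto
    finally show "ennreal (cmod (bv_diff f t \<theta>) powr p) \<le> ennreal (2 powr p) * (b (\<theta> + t) + b \<theta>)"
      unfolding b_def by (simp add: ennreal_leI flip: ennreal_plus ennreal_mult)
  qed
  also have "\<dots> = ennreal (2 powr p) * ((\<integral>\<^sup>+\<theta>. b (\<theta> + t) \<partial>circ) + (\<integral>\<^sup>+\<theta>. b \<theta> \<partial>circ))"
    by (simp add: nn_integral_cmult nn_integral_add)
  also have "(\<integral>\<^sup>+\<theta>. b (\<theta> + t) \<partial>circ) = (\<integral>\<^sup>+\<theta>. b \<theta> \<partial>circ)"
    by (rule nn_integral_circ_shift) (auto simp: b_def boundary_value_periodic)
  also have "ennreal (2 powr p) * ((\<integral>\<^sup>+\<theta>. b \<theta> \<partial>circ) + (\<integral>\<^sup>+\<theta>. b \<theta> \<partial>circ))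
     \<le> ennreal (2 powr p) * (ennreal (hardy_norm p f powr p) + ennreal (hardy_norm p f powr p))"
    by (intro mult_left_mono add_mono bH) auto
  also have "\<dots> = ennreal (2 powr p * (2 * hardy_norm p f powr p))"
    by (simp flip: ennreal_plus ennreal_mult)
  finally show ?thesis .
qed

lemma circle_norm_le_of_nn_integral:
  assumes le: "(\<integral>\<^sup>+\<theta>. ennreal (norm (g \<theta>) powr p) * indicator {-pi..pi} \<theta> \<partial>lborel) \<le> ennreal (2 * pi * Q)"
    and Q: "0 \<le> Q" and p: "0 < p"
  shows "circle_norm p g \<le> Q powr (1 / p)"
proof -
  have "(LBINT \<theta>:{-pi..pi}. norm (g \<theta>) powr p) \<le> 2 * pi * Q"
    unfolding set_lebesgue_integral_def
  proof (rule integral_real_bounded)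
    show "(\<integral>\<^sup>+\<theta>. ennreal (indicator {-pi..pi} \<theta> *\<^sub>R norm (g \<theta>) powr p) \<partial>lborel) \<le> ennreal (2 * pi * Q)"
      using le by (rule order_trans[rotated]) (auto intro!: nn_integral_mono split: split_indicator)
  qed (use Q in auto)
  then have "1 / (2 * pi) * (LBINT \<theta>:{-pi..pi}. norm (g \<theta>) powr p) \<le> Q"
    by (simp add: field_simps)
  moreover have "0 \<le> (LBINT \<theta>:{-pi..pi}. norm (g \<theta>) powr p)"
    unfolding set_lebesgue_integral_def by (rule integral_nonneg_AE) auto
  ultimately show ?thesis unfolding circle_norm_def using p by (intro powr_mono2) auto
qed

lemma circle_norm_nonneg: "0 \<le> circle_norm p g"
  by (simp add: circle_norm_def)

lemma Lp_modulus_alt: "Lp_modulus p \<delta> f = (SUP t\<in>{t. 0 < \<bar>t\<bar> \<and> \<bar>t\<bar> \<le> \<delta>}. circle_norm p (bv_diff f t))"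
  unfolding Lp_modulus_def bv_diff_def[abs_def] ..

lemma bv_diff_circle_norm_le:
  assumes f: "f \<in> hardy_space p" and p: "1 < p"
  shows "circle_norm p (bv_diff f t) \<le> (2 powr p * (2 * hardy_norm p f powr p)) powr (1 / p)"
proof -
  note [measurable] = bv_diff_measurable[OF hardy_space_imp_holomorphic[OF f]]
  have "(\<integral>\<^sup>+\<theta>. ennreal (norm (bv_diff f t \<theta>) powr p) * indicator {-pi..pi} \<theta> \<partial>lborel)
     = ennreal (2 * pi) * (\<integral>\<^sup>+\<theta>. ennreal (cmod (bv_diff f t \<theta>) powr p) \<partial>circ)"
    by (subst nn_integral_circ) (auto simp: mult.assoc[symmetric] simp flip: ennreal_mult)
  also have "\<dots> \<le> ennreal (2 * pi) * ennreal (2 powr p * (2 * hardy_norm p f powr p))"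
    by (intro mult_left_mono bv_diff_nn_integral_le f p) auto
  also have "\<dots> = ennreal (2 * pi * (2 powr p * (2 * hardy_norm p f powr p)))"
    by (rule ennreal_mult[symmetric]) auto
  finally show ?thesis using p by (intro circle_norm_le_of_nn_integral) auto
qed

lemma Lp_modulus_upper:
  assumes f: "f \<in> hardy_space p" and p: "1 < p" and t: "0 < \<bar>t\<bar>" "\<bar>t\<bar> \<le> \<delta>"
  shows "circle_norm p (bv_diff f t) \<le> Lp_modulus p \<delta> f"
  unfolding Lp_modulus_alt
  by (rule cSUP_upper) (use t bv_diff_circle_norm_le[OF f p] in \<open>auto intro!: bdd_aboveI2\<close>)

lemma Lp_modulus_le:
  assumes "0 < \<delta>" "\<And>t. 0 < \<bar>t\<bar> \<Longrightarrow> \<bar>t\<bar> \<le> \<delta> \<Longrightarrow> circle_norm p (bv_diff f t) \<le> B"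
  shows "Lp_modulus p \<delta> f \<le> B"
  unfolding Lp_modulus_alt
proof (rule cSUP_least)
  show "{t. 0 < \<bar>t\<bar> \<and> \<bar>t\<bar> \<le> \<delta>} \<noteq> {}" using assms(1) by (auto intro!: exI[of _ \<delta>])
qed (use assms in auto)

lemma Lp_modulus_nonneg:
  assumes f: "f \<in> hardy_space p" and p: "1 < p" and d: "0 < \<delta>"
  shows "0 \<le> Lp_modulus p \<delta> f"
  using Lp_modulus_upper[OF f p, of \<delta> \<delta>] d circle_norm_nonneg[of p "bv_diff f \<delta>"] by simp

text \<open>
  The growth condition at \<open>0\<close> controls small \<open>\<delta>\<close> only; for the others the modulus is bounded by the
  \<open>L\<^sup>p\<close> norm of the boundary values. Hence the supremum in the norm is over a bounded set.
\<close>
lemma mean_lipschitz_quotient_bdd: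
  assumes f: "f \<in> mean_lipschitz p" and p: "1 < p"
  shows "bdd_above ((\<lambda>\<delta>. Lp_modulus p \<delta> f / \<delta> powr (1 / p)) ` {0<..pi})"
proof -
  have fh: "f \<in> hardy_space p" and O: "(\<lambda>\<delta>. Lp_modulus p \<delta> f) \<in> O[at_right 0](\<lambda>\<delta>. \<delta> powr (1 / p))"
    using f by (auto simp: mean_lipschitz_def)
  obtain c where c: "0 < c" "\<forall>\<^sub>F \<delta> in at_right 0. norm (Lp_modulus p \<delta> f) \<le> c * norm (\<delta> powr (1 / p))"
    using O by (rule landau_o.bigE)
  obtain b where b: "0 < b" "\<And>\<delta>. 0 < \<delta> \<Longrightarrow> \<delta> < b \<Longrightarrow> norm (Lp_modulus p \<delta> f) \<le> c * norm (\<delta> powr (1 / p))"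
    using c(2) unfolding eventually_at_right_field by auto
  define M where "M = (2 powr p * (2 * hardy_norm p f powr p)) powr (1 / p)"
  have M: "0 \<le> M" by (simp add: M_def)
  show ?thesis
  proof (rule bdd_aboveI2)
    fix \<delta> assume d: "\<delta> \<in> {0<..pi}"
    show "Lp_modulus p \<delta> f / \<delta> powr (1 / p) \<le> max c (M / b powr (1 / p))"
    proof (cases "\<delta> < b")
      case True
      then have "Lp_modulus p \<delta> f \<le> c * \<delta> powr (1 / p)" using b(2)[of \<delta>] d by simp
      then have "Lp_modulus p \<delta> f / \<delta> powr (1 / p) \<le> c" using d by (simp add: field_simps)
      then show ?thesis by simp
    next
      case False
      have "Lp_modulus p \<delta> f \<le> M"
        using d bv_diff_circle_norm_le[OF fh p] unfolding M_def by (intro Lp_modulus_le) auto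
      then have "Lp_modulus p \<delta> f / \<delta> powr (1 / p) \<le> M / b powr (1 / p)"
        using False d b p M by (intro frac_le powr_mono2) auto
      then show ?thesis by simp
    qed
  qed
qed

lemma mean_lipschitz_norm_parts:
  assumes f: "f \<in> mean_lipschitz p" and p: "1 < p"
  shows "0 \<le> mean_lipschitz_norm p f" "hardy_norm p f \<le> mean_lipschitz_norm p f"
    "\<And>t. 0 < \<bar>t\<bar> \<Longrightarrow> \<bar>t\<bar> \<le> pi \<Longrightarrow> circle_norm p (bv_diff f t) \<le> mean_lipschitz_norm p f * \<bar>t\<bar> powr (1 / p)"
proof -
  have fh: "f \<in> hardy_space p" using f by (simp add: mean_lipschitz_def)
  define L where "L = (SUP \<delta>\<in>{0<..pi}. Lp_modulus p \<delta> f / \<delta> powr (1 / p))"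
  have up: "Lp_modulus p \<delta> f / \<delta> powr (1 / p) \<le> L" if "0 < \<delta>" "\<delta> \<le> pi" for \<delta>
    unfolding L_def using that mean_lipschitz_quotient_bdd[OF f p] by (intro cSUP_upper) auto
  have "0 \<le> Lp_modulus p pi f / pi powr (1 / p)"
    using Lp_modulus_nonneg[OF fh p, of pi] by simp
  then have L0: "0 \<le> L" using up[of pi] by simp
  have N: "mean_lipschitz_norm p f = hardy_norm p f + L"
    unfolding mean_lipschitz_norm_def L_def ..
  have H0: "0 \<le> hardy_norm p f" using hardy_norm_nonneg[OF fh] .
  show "0 \<le> mean_lipschitz_norm p f" "hardy_norm p f \<le> mean_lipschitz_norm p f"
    using N L0 H0 by auto
  fix t :: real assume t: "0 < \<bar>t\<bar>" "\<bar>t\<bar> \<le> pi"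
  have "circle_norm p (bv_diff f t) \<le> Lp_modulus p \<bar>t\<bar> f" using t by (intro Lp_modulus_upper fh p) auto
  also have "\<dots> \<le> L * \<bar>t\<bar> powr (1 / p)" using up[of "\<bar>t\<bar>"] t by (simp add: field_simps)
  also have "\<dots> \<le> mean_lipschitz_norm p f * \<bar>t\<bar> powr (1 / p)" using N H0 by (intro mult_right_mono) auto
  finally show "circle_norm p (bv_diff f t) \<le> mean_lipschitz_norm p f * \<bar>t\<bar> powr (1 / p)" .
qed

lemma mean_lipschitz_nn_integral:
  assumes f: "f \<in> mean_lipschitz p" and p: "1 < p" and t: "0 < \<bar>t\<bar>" "\<bar>t\<bar> \<le> pi"
  shows "(\<integral>\<^sup>+\<theta>. ennreal (cmod (bv_diff f t \<theta>) powr p) \<partial>circ) \<le> ennreal (mean_lipschitz_norm p f powr p * \<bar>t\<bar>)"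
proof -
  have fh: "f \<in> hardy_space p" using f by (simp add: mean_lipschitz_def)
  note bm[measurable] = bv_diff_measurable[OF hardy_space_imp_holomorphic[OF fh]]
  define N where "N = mean_lipschitz_norm p f"
  have N0: "0 \<le> N" unfolding N_def by (rule mean_lipschitz_norm_parts[OF f p])
  have "(\<integral>\<^sup>+\<theta>. ennreal (norm (cmod (bv_diff f t \<theta>) powr p)) \<partial>circ) < \<infinity>"
    using le_less_trans[OF bv_diff_nn_integral_le[OF fh p, of t] ennreal_less_top] by simp
  then have int: "integrable circ (\<lambda>\<theta>. cmod (bv_diff f t \<theta>) powr p)"
    by (intro integrableI_bounded) (auto simp: measurable_cong_sets[OF sets_circ refl])
  define J where "J = (LINT \<theta>|circ. cmod (bv_diff f t \<theta>) powr p)"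
  have J0: "0 \<le> J" unfolding J_def by (rule integral_nonneg_AE) auto
  have "J powr (1 / p) \<le> N * \<bar>t\<bar> powr (1 / p)"
    using mean_lipschitz_norm_parts(3)[OF f p t] unfolding J_def N_def by (subst (asm) circle_norm_circ[OF bm])
  then have "(J powr (1 / p)) powr p \<le> (N * \<bar>t\<bar> powr (1 / p)) powr p"
    using p by (intro powr_mono2) auto
  then have "J \<le> N powr p * \<bar>t\<bar>" using J0 N0 p by (simp add: powr_powr powr_mult)
  moreover have "(\<integral>\<^sup>+\<theta>. ennreal (cmod (bv_diff f t \<theta>) powr p) \<partial>circ) = ennreal J"
    unfolding J_def using int by (intro nn_integral_eq_integral) auto
  ultimately show ?thesis by (simp add: N_def ennreal_leI)
qed

section \<open>Functions in the mean Lipschitz space have a Bloch type derivative\<close>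

lemma powr_root_mult:
  fixes N x p :: real
  assumes "0 \<le> N" "0 \<le> x" "1 < p"
  shows "(N powr p * x) powr (1 / p) = N * x powr (1 / p)"
  using assms by (subst powr_mult) (auto simp: powr_powr)

text \<open>
  An average of rotation increments of a dilate is split into twice the error of replacing the dilate
  by the boundary values and an average of increments of the latter, to which the splitting in
  \<open>l\<close> is applied. The weight \<open>w\<close> is the Poisson kernel for values in the disc, and \<open>1\<close> for Taylor
  coefficients.
\<close>
lemma mean_increment_bound:
  fixes f :: "complex \<Rightarrow> complex" and \<rho> :: "nat \<Rightarrow> real" and w :: "real \<Rightarrow> ennreal"
  assumes f: "f \<in> mean_lipschitz p" and p: "1 < p" and t: "0 < \<bar>t\<bar>" "\<bar>t\<bar> \<le> pi"
    and \<rho>: "0 < \<rho> n" "\<rho> n < 1"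
    and w[measurable]: "w \<in> borel_measurable borel" and w1: "(\<integral>\<^sup>+s. w s \<partial>circ) \<le> 1"
    and wB: "\<And>s. w s \<le> ennreal B" and B: "0 \<le> B" and l: "0 < l"
  shows "(\<integral>\<^sup>+s. w s * ennreal (cmod (f (of_real (\<rho> n) * cis (\<alpha> + s + t)) - f (of_real (\<rho> n) * cis (\<alpha> + s)))) \<partial>circ)
     \<le> ennreal (2 * B) * (\<integral>\<^sup>+\<theta>. ennreal (cmod (f (of_real (\<rho> n) * cis \<theta>) - boundary_value f \<theta>)) \<partial>circ)
       + ennreal (l + l powr (1 - p) * (B * (mean_lipschitz_norm p f powr p * \<bar>t\<bar>)))"
proof -
  have fh: "f \<in> hardy_space p" using f by (simp add: mean_lipschitz_def)
  have hol: "f holomorphic_on ball 0 1" by (rule hardy_space_imp_holomorphic[OF fh])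
  define h where "h \<theta> = ennreal (cmod (f (of_real (\<rho> n) * cis \<theta>) - boundary_value f \<theta>))" for \<theta>
  note [measurable] = boundary_value_measurable[OF hol]
  have [measurable]: "(\<lambda>\<theta>. f (of_real (\<rho> n) * cis \<theta>)) \<in> borel_measurable borel"
    using \<rho> by (intro circle_function_measurable hol) auto
  have hm[measurable]: "h \<in> borel_measurable borel" unfolding h_def by measurable
  have hper: "h (x + 2 * pi) = h x" for x unfolding h_def by (simp add: boundary_value_periodic cis_add_2pi)
  define v where "v \<theta> = ennreal (cmod (bv_diff f t \<theta>) powr p)" for \<theta>
  have vm[measurable]: "v \<in> borel_measurable borel"
    using bv_diff_measurable[OF hol, of t] unfolding v_def by measurable
  have vper: "v (x + 2 * pi) = v x" for x unfolding v_def bv_diff_def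
    using boundary_value_periodic[of f x] boundary_value_periodic[of f "x + t"] by (simp add: algebra_simps)
  define N where "N = mean_lipschitz_norm p f powr p * \<bar>t\<bar>"
  have N0: "0 \<le> N" by (simp add: N_def)
  have vN: "(\<integral>\<^sup>+s. v s \<partial>circ) \<le> ennreal N"
    unfolding v_def N_def by (rule mean_lipschitz_nn_integral[OF f p t])
  have shift: "(\<integral>\<^sup>+s. k (a + s) \<partial>circ) = (\<integral>\<^sup>+s. k s \<partial>circ)"
    if "k \<in> borel_measurable borel" "\<And>x. k (x + 2 * pi) = k x" for k :: "real \<Rightarrow> ennreal" and a
    using nn_integral_circ_shift[of k a, OF that] by (simp add: add.commute)
  have "(\<integral>\<^sup>+s. w s * ennreal (cmod (f (of_real (\<rho> n) * cis (\<alpha> + s + t)) - f (of_real (\<rho> n) * cis (\<alpha> + s)))) \<partial>circ)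
    \<le> (\<integral>\<^sup>+s. (ennreal B * h ((\<alpha> + t) + s) + ennreal B * h (\<alpha> + s)) + (ennreal l * w s + ennreal (l powr (1 - p) * B) * v (\<alpha> + s)) \<partial>circ)"
  proof (rule nn_integral_mono)
    fix s
    let ?x = "\<alpha> + s"
    have "f (of_real (\<rho> n) * cis (?x + t)) - f (of_real (\<rho> n) * cis ?x)
       = ((f (of_real (\<rho> n) * cis (?x + t)) - boundary_value f (?x + t)) - (f (of_real (\<rho> n) * cis ?x) - boundary_value f ?x)) + bv_diff f t ?x"
      by (simp add: bv_diff_def)
    then have "cmod (f (of_real (\<rho> n) * cis (?x + t)) - f (of_real (\<rho> n) * cis ?x))
       \<le> (cmod (f (of_real (\<rho> n) * cis (?x + t)) - boundary_value f (?x + t)) + cmod (f (of_real (\<rho> n) * cis ?x) - boundary_value f ?x)) + cmod (bv_diff f t ?x)"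
      using norm_triangle_mono[OF norm_triangle_ineq4 order_refl] by metis
    also have "cmod (bv_diff f t ?x) \<le> l + l powr (1 - p) * cmod (bv_diff f t ?x) powr p"
      using l p by (intro young_split) auto
    finally have "ennreal (cmod (f (of_real (\<rho> n) * cis (?x + t)) - f (of_real (\<rho> n) * cis ?x)))
      \<le> ennreal ((cmod (f (of_real (\<rho> n) * cis (?x + t)) - boundary_value f (?x + t)) + cmod (f (of_real (\<rho> n) * cis ?x) - boundary_value f ?x)) + (l + l powr (1 - p) * cmod (bv_diff f t ?x) powr p))"
      by (simp add: ennreal_leI)
    also have "\<dots> = (h (?x + t) + h ?x) + (ennreal l + ennreal (l powr (1 - p)) * v ?x)"
      unfolding h_def v_def using l by (simp flip: ennreal_mult ennreal_plus)
    finally have "w s * ennreal (cmod (f (of_real (\<rho> n) * cis (?x + t)) - f (of_real (\<rho> n) * cis ?x)))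
      \<le> w s * ((h (?x + t) + h ?x) + (ennreal l + ennreal (l powr (1 - p)) * v ?x))"
      by (rule mult_left_mono) simp
    also have "\<dots> = (w s * h (?x + t) + w s * h ?x) + (ennreal l * w s + ennreal (l powr (1 - p)) * (w s * v ?x))"
      by (simp add: distrib_left mult_ac)
    also have "\<dots> \<le> (ennreal B * h (?x + t) + ennreal B * h ?x) + (ennreal l * w s + ennreal (l powr (1 - p)) * (ennreal B * v ?x))"
      by (intro add_mono mult_mono wB order_refl) auto
    also have "ennreal (l powr (1 - p)) * (ennreal B * v ?x) = ennreal (l powr (1 - p) * B) * v ?x"
      using B by (simp add: ennreal_mult mult.assoc)
    finally show "w s * ennreal (cmod (f (of_real (\<rho> n) * cis (?x + t)) - f (of_real (\<rho> n) * cis ?x)))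
      \<le> (ennreal B * h ((\<alpha> + t) + s) + ennreal B * h ?x) + (ennreal l * w s + ennreal (l powr (1 - p) * B) * v ?x)"
      by (simp add: add_ac)
  qed
  also have "\<dots> = (ennreal B * (\<integral>\<^sup>+s. h s \<partial>circ) + ennreal B * (\<integral>\<^sup>+s. h s \<partial>circ))
      + (ennreal l * (\<integral>\<^sup>+s. w s \<partial>circ) + ennreal (l powr (1 - p) * B) * (\<integral>\<^sup>+s. v s \<partial>circ))"
    by (simp add: nn_integral_add nn_integral_cmult shift[OF hm hper] shift[OF vm vper])
  also have "\<dots> \<le> ennreal (2 * B) * (\<integral>\<^sup>+s. h s \<partial>circ) + (ennreal l * 1 + ennreal (l powr (1 - p) * B) * ennreal N)"
  proof (intro add_mono mult_left_mono w1 vN)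
    have "ennreal B * (\<integral>\<^sup>+s. h s \<partial>circ) + ennreal B * (\<integral>\<^sup>+s. h s \<partial>circ) = (ennreal B + ennreal B) * (\<integral>\<^sup>+s. h s \<partial>circ)"
      by (rule distrib_right[symmetric])
    also have "ennreal B + ennreal B = ennreal (2 * B)" using B by (simp flip: ennreal_plus)
    finally show "ennreal B * (\<integral>\<^sup>+s. h s \<partial>circ) + ennreal B * (\<integral>\<^sup>+s. h s \<partial>circ) \<le> ennreal (2 * B) * (\<integral>\<^sup>+s. h s \<partial>circ)"
      by simp
  qed auto
  also have "ennreal l * 1 + ennreal (l powr (1 - p) * B) * ennreal N = ennreal (l + l powr (1 - p) * (B * N))"
    using l B N0 by (simp add: mult.assoc flip: ennreal_mult ennreal_plus)
  finally show ?thesis unfolding h_def N_def .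
qed

text \<open>
  The Poisson kernel is at most \<open>2 / (1 - r)\<close>, so values at radius \<open>r\<close> exceed an \<open>L\<^sup>p\<close> mean over the
  circle by at most a constant times \<open>(1 - r)\<^sup>-\<^sup>1\<^sup>/\<^sup>p\<close>; this is applied to the increment of \<open>f\<close> under rotation by \<open>t\<close>.
\<close>
lemma rotation_increment:
  assumes f: "f \<in> mean_lipschitz p" and p: "1 < p" and t: "\<bar>t\<bar> \<le> pi" and r: "0 \<le> r" "r < 1"
  shows "cmod (f (of_real r * cis (\<alpha> + t)) - f (of_real r * cis \<alpha>))
     \<le> 4 * mean_lipschitz_norm p f * (\<bar>t\<bar> / (1 - r)) powr (1 / p)"
proof (cases "t = 0")
  case False
  have fh: "f \<in> hardy_space p" using f by (simp add: mean_lipschitz_def)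
  have hol: "f holomorphic_on ball 0 1" by (rule hardy_space_imp_holomorphic[OF fh])
  define N where "N = mean_lipschitz_norm p f"
  have N0: "0 \<le> N" unfolding N_def by (rule mean_lipschitz_norm_parts[OF f p])
  define B where "B = 2 / (1 - r)"
  have B0: "0 < B" using r by (simp add: B_def)
  show ?thesis
  proof (rule hardy_boundary_value_L1[OF fh p])
    fix \<rho> :: "nat \<Rightarrow> real"
    assume \<rho>: "\<And>n. 0 < \<rho> n" "\<And>n. \<rho> n < 1" "\<rho> \<longlonglongrightarrow> 1"
      and L1: "(\<lambda>n. \<integral>\<^sup>+\<theta>. ennreal (cmod (f (of_real (\<rho> n) * cis \<theta>) - boundary_value f \<theta>)) \<partial>circ) \<longlonglongrightarrow> 0"
    define h where "h n = (\<integral>\<^sup>+\<theta>. ennreal (cmod (f (of_real (\<rho> n) * cis \<theta>) - boundary_value f \<theta>)) \<partial>circ)" for n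
    let ?X = "cmod (f (of_real r * cis (\<alpha> + t)) - f (of_real r * cis \<alpha>))"
    have main: "?X \<le> l + l powr (1 - p) * (B * (N powr p * \<bar>t\<bar>))" if l: "0 < l" for l
    proof -
      define Q where "Q = l + l powr (1 - p) * (B * (N powr p * \<bar>t\<bar>))"
      have Q0: "0 \<le> Q" unfolding Q_def using l B0 by simp
      have step: "ennreal (cmod (f (of_real (\<rho> n) * (of_real r * cis (\<alpha> + t))) - f (of_real (\<rho> n) * (of_real r * cis \<alpha>))))
          \<le> ennreal (2 * B) * h n + ennreal Q" for n
      proof -
        define k where "k w = f (of_real (\<rho> n) * cis t * w) - f (of_real (\<rho> n) * w)" for w
        define R where "R = 1 / \<rho> n"
        have R: "1 < R" unfolding R_def using \<rho>(1,2)[of n] by simp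
        have holk: "k holomorphic_on ball 0 R"
          unfolding k_def using \<rho>(1)[of n]
          by (intro holomorphic_intros holomorphic_on_dilation[OF hol]) (auto simp: R_def norm_mult)
        have kc: "k (of_real a * cis x) = f (of_real (\<rho> n) * (of_real a * cis (x + t))) - f (of_real (\<rho> n) * (of_real a * cis x))" for a x
          unfolding k_def by (simp add: cis_mult[symmetric] mult_ac)
        have kc1: "k (cis x) = f (of_real (\<rho> n) * cis (x + t)) - f (of_real (\<rho> n) * cis x)" for x
          using kc[of 1 x] by simp
        have "ennreal (cmod (k (of_real r * cis \<alpha>))) \<le> (\<integral>\<^sup>+s. ennreal (poisson_kernel r s) * ennreal (cmod (k (cis (\<alpha> + s)))) \<partial>circ)"
          by (rule poisson_bound[OF holk R r])
        also have "\<dots> \<le> ennreal (2 * B) * h n + ennreal Q"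
          unfolding kc1 h_def Q_def N_def
          by (rule mean_increment_bound[OF f p _ t \<rho>(1,2)])
            (use False B0 l poisson_kernel_le[OF r] nn_integral_poisson_kernel[OF r] in \<open>auto simp: B_def intro!: ennreal_leI\<close>)
        finally show ?thesis by (simp add: kc)
      qed
      have cont: "(\<lambda>n. f (of_real (\<rho> n) * (of_real r * cis x))) \<longlonglongrightarrow> f (of_real r * cis x)" for x
        using r by (intro tendsto_dilation hol \<rho>(3)) (simp add: norm_mult)
      have "(\<lambda>n. ennreal (cmod (f (of_real (\<rho> n) * (of_real r * cis (\<alpha> + t))) - f (of_real (\<rho> n) * (of_real r * cis \<alpha>))))) \<longlonglongrightarrow> ennreal ?X"
        by (intro tendsto_ennrealI tendsto_intros cont)
      moreover have "(\<lambda>n. ennreal (2 * B) * h n + ennreal Q) \<longlonglongrightarrow> ennreal (2 * B) * 0 + ennreal Q"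
        using L1 unfolding h_def by (intro tendsto_add ennreal_tendsto_cmult tendsto_const) auto
      ultimately have "ennreal ?X \<le> ennreal (2 * B) * 0 + ennreal Q"
        by (rule LIMSEQ_le) (use step in auto)
      then show ?thesis using Q0 by (simp add: Q_def ennreal_le_iff)
    qed
    have "?X \<le> 2 * (B * (N powr p * \<bar>t\<bar>)) powr (1 / p)"
      using main B0 by (intro le_of_young_split p) auto
    also have "(B * (N powr p * \<bar>t\<bar>)) = N powr p * (2 * (\<bar>t\<bar> / (1 - r)))"
      by (simp add: B_def)
    also have "\<dots> powr (1 / p) = N * (2 * (\<bar>t\<bar> / (1 - r))) powr (1 / p)"
      using N0 p r by (intro powr_root_mult) auto
    also have "(2 * (\<bar>t\<bar> / (1 - r))) powr (1 / p) = 2 powr (1 / p) * (\<bar>t\<bar> / (1 - r)) powr (1 / p)"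
      by (rule powr_mult)
    also have "2 * (N * (2 powr (1 / p) * (\<bar>t\<bar> / (1 - r)) powr (1 / p))) \<le> 2 * (N * (2 * (\<bar>t\<bar> / (1 - r)) powr (1 / p)))"
      using N0 p powr_mono[of "1 / p" 1 "2::real"] by (intro mult_left_mono mult_right_mono) auto
    finally show ?thesis by (simp add: N_def mult_ac)
  qed
qed simp

lemma taylor_coeff_bound:
  assumes hol: "G holomorphic_on ball 0 R" and R: "1 < R"
  shows "ennreal (cmod (taylor_coeff G k)) \<le> (\<integral>\<^sup>+\<theta>. ennreal (cmod (G (cis \<theta>))) \<partial>circ)"
proof -
  have Gc: "continuous_on UNIV (\<lambda>\<theta>. G (cis \<theta>))"
    using continuous_on_circle_function[OF hol, of 1] R by simp
  have "continuous_on (cball 0 1) G" "G holomorphic_on ball 0 1"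
    using hol R by (auto intro!: holomorphic_on_imp_continuous_on elim: holomorphic_on_subset)
  then have "((\<lambda>u. G u / (u - 0) ^ Suc k) has_contour_integral ((2 * pi * \<i>) / fact k * (deriv ^^ k) G 0)) (circlepath 0 1)"
    by (rule Cauchy_has_contour_integral_higher_derivative_circlepath) simp
  then have "ennreal (cmod ((2 * pi * \<i>) / fact k * (deriv ^^ k) G 0))
      \<le> ennreal (2 * pi * 1) * (\<integral>\<^sup>+\<theta>. ennreal (cmod (G (of_real 1 * cis \<theta>) / (of_real 1 * cis \<theta> - 0) ^ Suc k)) \<partial>circ)"
    by (rule contour_circlepath_bound) (use Gc in \<open>auto intro!: continuous_intros\<close>)
  also have "\<dots> = ennreal (2 * pi) * (\<integral>\<^sup>+\<theta>. ennreal (cmod (G (cis \<theta>))) \<partial>circ)"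
    by (simp add: norm_divide norm_mult norm_power)
  also have "cmod ((2 * pi * \<i>) / fact k * (deriv ^^ k) G 0) = 2 * pi * cmod (taylor_coeff G k)"
    by (simp add: taylor_coeff_def norm_mult norm_divide)
  finally have "ennreal (2 * pi) * ennreal (cmod (taylor_coeff G k)) \<le> ennreal (2 * pi) * (\<integral>\<^sup>+\<theta>. ennreal (cmod (G (cis \<theta>))) \<partial>circ)"
    by (simp add: ennreal_mult)
  then show ?thesis
    by (subst (asm) ennreal_mult_le_mult_iff) auto
qed

text \<open>
  Rotation by \<open>pi / k\<close> changes the sign of the \<open>k\<close>-th coefficient, so \<open>2 |a\<^sub>k|\<close> is the size of a
  coefficient of the increment of \<open>f\<close> under this rotation.
\<close>
lemma mean_lipschitz_coeff_bound:
  assumes f: "f \<in> mean_lipschitz p" and p: "1 < p" and k: "0 < k"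
  shows "cmod (taylor_coeff f k) \<le> mean_lipschitz_norm p f * (pi / real k) powr (1 / p)"
proof -
  have fh: "f \<in> hardy_space p" using f by (simp add: mean_lipschitz_def)
  have hol: "f holomorphic_on ball 0 1" by (rule hardy_space_imp_holomorphic[OF fh])
  define N where "N = mean_lipschitz_norm p f"
  have N0: "0 \<le> N" unfolding N_def by (rule mean_lipschitz_norm_parts[OF f p])
  define t where "t = pi / real k"
  have t: "0 < \<bar>t\<bar>" "\<bar>t\<bar> \<le> pi" using k by (auto simp: t_def field_simps)
  have "cis t ^ k = -1" using k by (simp add: Complex.DeMoivre t_def)
  show ?thesis
  proof (rule hardy_boundary_value_L1[OF fh p])
    fix \<rho> :: "nat \<Rightarrow> real"
    assume \<rho>: "\<And>n. 0 < \<rho> n" "\<And>n. \<rho> n < 1" "\<rho> \<longlonglongrightarrow> 1"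
      and L1: "(\<lambda>n. \<integral>\<^sup>+\<theta>. ennreal (cmod (f (of_real (\<rho> n) * cis \<theta>) - boundary_value f \<theta>)) \<partial>circ) \<longlonglongrightarrow> 0"
    define h where "h n = (\<integral>\<^sup>+\<theta>. ennreal (cmod (f (of_real (\<rho> n) * cis \<theta>) - boundary_value f \<theta>)) \<partial>circ)" for n
    have main: "2 * cmod (taylor_coeff f k) \<le> l + l powr (1 - p) * (1 * (N powr p * \<bar>t\<bar>))" if l: "0 < l" for l
    proof -
      define Q where "Q = l + l powr (1 - p) * (1 * (N powr p * \<bar>t\<bar>))"
      have Q0: "0 \<le> Q" unfolding Q_def using l by simp
      have step: "ennreal (\<rho> n ^ k * (2 * cmod (taylor_coeff f k))) \<le> ennreal (2 * 1) * h n + ennreal Q" for n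
      proof -
        define G where "G w = f (of_real (\<rho> n) * cis t * w) - f (of_real (\<rho> n) * w)" for w
        define R where "R = 1 / \<rho> n"
        have R: "1 < R" unfolding R_def using \<rho>(1,2)[of n] by simp
        have sub: "u * w \<in> ball 0 1" if "w \<in> ball 0 R" "cmod u = \<rho> n" for u w
          using that \<rho>(1)[of n] by (auto simp: R_def norm_mult field_simps)
        have holc: "(\<lambda>w. f (u * w)) holomorphic_on ball 0 R" if "cmod u = \<rho> n" for u
          using that \<rho>(1)[of n] by (intro holomorphic_on_dilation[OF hol]) (simp add: R_def)
        have nu: "cmod (of_real (\<rho> n) * cis t) = \<rho> n" "cmod (of_real (\<rho> n)) = \<rho> n"
          using \<rho>(1)[of n] by (auto simp: norm_mult)
        have holG: "G holomorphic_on ball 0 R"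
          unfolding G_def by (intro holomorphic_intros holc nu)
        have d: "(deriv ^^ k) (\<lambda>w. f (u * w)) 0 = u ^ k * (deriv ^^ k) f 0" if "cmod u = \<rho> n" for u
          using higher_deriv_compose_linear[OF hol, of "ball 0 R" 0 u k] sub that R by auto
        have "(deriv ^^ k) G 0 = (deriv ^^ k) (\<lambda>w. f (of_real (\<rho> n) * cis t * w)) 0 - (deriv ^^ k) (\<lambda>w. f (of_real (\<rho> n) * w)) 0"
          unfolding G_def using R by (intro higher_deriv_diff[OF holc[OF nu(1)] holc[OF nu(2)]]) auto
        also have "\<dots> = - 2 * of_real (\<rho> n) ^ k * (deriv ^^ k) f 0"
          unfolding d[OF nu(1)] d[OF nu(2)] using \<open>cis t ^ k = -1\<close> by (simp add: power_mult_distrib)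
        finally have "taylor_coeff G k = - 2 * of_real (\<rho> n) ^ k * taylor_coeff f k"
          by (simp add: taylor_coeff_def)
        then have "cmod (taylor_coeff G k) = \<rho> n ^ k * (2 * cmod (taylor_coeff f k))"
          using \<rho>(1)[of n] by (simp add: norm_mult norm_power)
        then have "ennreal (\<rho> n ^ k * (2 * cmod (taylor_coeff f k))) \<le> (\<integral>\<^sup>+\<theta>. ennreal (cmod (G (cis \<theta>))) \<partial>circ)"
          using taylor_coeff_bound[OF holG R, of k] by simp
        also have "\<dots> = (\<integral>\<^sup>+\<theta>. 1 * ennreal (cmod (f (of_real (\<rho> n) * cis (0 + \<theta> + t)) - f (of_real (\<rho> n) * cis (0 + \<theta>)))) \<partial>circ)"
          by (simp add: G_def cis_mult[symmetric] mult_ac)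
        also have "\<dots> \<le> ennreal (2 * 1) * h n + ennreal Q"
          unfolding h_def Q_def N_def
          by (rule mean_increment_bound[OF f p t \<rho>(1,2)]) (use l in auto)
        finally show ?thesis .
      qed
      have "(\<lambda>n. ennreal (\<rho> n ^ k * (2 * cmod (taylor_coeff f k)))) \<longlonglongrightarrow> ennreal (1 ^ k * (2 * cmod (taylor_coeff f k)))"
        by (intro tendsto_ennrealI tendsto_intros \<rho>(3))
      moreover have "(\<lambda>n. ennreal (2 * 1) * h n + ennreal Q) \<longlonglongrightarrow> ennreal (2 * 1) * 0 + ennreal Q"
        using L1 unfolding h_def by (intro tendsto_add ennreal_tendsto_cmult tendsto_const) auto
      ultimately have "ennreal (1 ^ k * (2 * cmod (taylor_coeff f k))) \<le> ennreal (2 * 1) * 0 + ennreal Q"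
        by (rule LIMSEQ_le) (use step in auto)
      then show ?thesis using Q0 by (simp add: Q_def ennreal_le_iff)
    qed
    have "2 * cmod (taylor_coeff f k) \<le> 2 * (1 * (N powr p * \<bar>t\<bar>)) powr (1 / p)"
      using main by (intro le_of_young_split p) auto
    also have "(1 * (N powr p * \<bar>t\<bar>)) powr (1 / p) = N * t powr (1 / p)"
      using powr_root_mult[OF N0 _ p, of t] t k by (simp add: t_def)
    finally show ?thesis by (simp add: N_def t_def)
  qed
qed

lemma hardy_value_at_0:
  assumes f: "f \<in> hardy_space p" and p: "1 < p"
  shows "cmod (f 0) \<le> 2 * hardy_norm p f"
proof -
  have hol: "f holomorphic_on ball 0 1" by (rule hardy_space_imp_holomorphic[OF f])
  define H where "H = hardy_norm p f"
  have H0: "0 \<le> H" unfolding H_def by (rule hardy_norm_nonneg[OF f])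
  define k where "k w = f (of_real (1/2) * w)" for w
  have holk: "k holomorphic_on ball 0 2" unfolding k_def
    by (intro holomorphic_on_dilation[OF hol]) (simp add: norm_divide)
  define u where "u s = cmod (f (of_real (1/2) * cis s))" for s
  have "(\<lambda>\<theta>. f (of_real (1/2) * cis \<theta>)) \<in> borel_measurable borel"
    by (intro circle_function_measurable hol) auto
  then have [measurable]: "u \<in> borel_measurable borel" unfolding u_def by measurable
  have "cmod (f 0) \<le> l + l powr (1 - p) * H powr p" if l: "0 < l" for l
  proof -
    have "ennreal (cmod (f 0)) \<le> (\<integral>\<^sup>+s. ennreal (poisson_kernel 0 s) * ennreal (cmod (k (cis (0 + s)))) \<partial>circ)"
      using poisson_bound[OF holk, of 0 0] by (simp add: k_def)
    also have "\<dots> = (\<integral>\<^sup>+s. ennreal (u s) \<partial>circ)"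
      by (simp add: poisson_kernel_def k_def u_def)
    also have "\<dots> \<le> (\<integral>\<^sup>+s. ennreal l + ennreal (l powr (1 - p)) * ennreal (u s powr p) \<partial>circ)"
    proof (rule nn_integral_mono)
      fix s
      have "u s \<le> l + l powr (1 - p) * u s powr p"
        using l p unfolding u_def by (intro young_split) auto
      then have "ennreal (u s) \<le> ennreal (l + l powr (1 - p) * u s powr p)"
        by (rule ennreal_leI)
      also have "\<dots> = ennreal l + ennreal (l powr (1 - p)) * ennreal (u s powr p)"
        using l by (simp add: ennreal_mult ennreal_plus)
      finally show "ennreal (u s) \<le> ennreal l + ennreal (l powr (1 - p)) * ennreal (u s powr p)" .
    qed
    also have "\<dots> = ennreal l + ennreal (l powr (1 - p)) * (\<integral>\<^sup>+s. ennreal (u s powr p) \<partial>circ)"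
      by (simp add: nn_integral_add nn_integral_cmult)
    also have "\<dots> \<le> ennreal l + ennreal (l powr (1 - p)) * ennreal (H powr p)"
      unfolding H_def u_def using p by (intro add_left_mono mult_left_mono hardy_nn_integral_le f) auto
    also have "\<dots> = ennreal (l + l powr (1 - p) * H powr p)"
      using l by (simp flip: ennreal_mult ennreal_plus)
    finally show ?thesis using l by (subst (asm) ennreal_le_iff) auto
  qed
  then have "cmod (f 0) \<le> 2 * (H powr p) powr (1 / p)" by (intro le_of_young_split p) auto
  then show ?thesis using H0 p by (simp add: powr_powr H_def)
qed


lemma nn_integral_circ_abs_powr:
  fixes a d :: real
  assumes a: "0 < a" "a < 1" and d: "0 < d"
  shows "(\<integral>\<^sup>+s. ennreal ((d + \<bar>s\<bar>) powr (a - 2)) \<partial>circ) \<le> ennreal (d powr (a - 1) / (1 - a))"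
proof -
  define \<phi> where "\<phi> s = ennreal ((d + \<bar>s\<bar>) powr (a - 2))" for s
  have [measurable]: "\<phi> \<in> borel_measurable borel" unfolding \<phi>_def by measurable
  define J where "J = (\<integral>\<^sup>+s. \<phi> s * indicator {0..pi} s \<partial>lborel)"
  have Jle: "J \<le> ennreal (d powr (a - 1) / (1 - a))"
  proof -
    have "J = (\<integral>\<^sup>+s. ennreal ((d + s) powr (a - 2)) * indicator {0..pi} s \<partial>lborel)"
      unfolding J_def \<phi>_def by (intro nn_integral_cong) (auto split: split_indicator)
    also have "\<dots> = ennreal ((d + pi) powr (a - 1) / (a - 1) - (d + 0) powr (a - 1) / (a - 1))"
    proof (rule nn_integral_FTC_Icc[where F = "\<lambda>s. (d + s) powr (a - 1) / (a - 1)"])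
      fix x assume "x \<in> {0..pi}"
      then have x: "0 \<le> x" "x \<le> pi" by auto
      have "((\<lambda>s. (d + s) powr (a - 1) / (a - 1)) has_real_derivative (a - 1) * (d + x) powr (a - 1 - 1) / (a - 1)) (at x)"
        using x d by (auto intro!: derivative_eq_intros)
      then show "((\<lambda>s. (d + s) powr (a - 1) / (a - 1)) has_real_derivative (d + x) powr (a - 2)) (at x)"
        using a by simp
    qed auto
    also have "\<dots> \<le> ennreal (d powr (a - 1) / (1 - a))"
    proof (rule ennreal_leI)
      have "(d + pi) powr (a - 1) / (a - 1) \<le> 0" using a by (intro divide_nonneg_neg) auto
      moreover have "- ((d + 0) powr (a - 1) / (a - 1)) = d powr (a - 1) / (1 - a)"
        using minus_divide_right[of "d powr (a - 1)" "a - 1"] by simp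
      ultimately show "(d + pi) powr (a - 1) / (a - 1) - (d + 0) powr (a - 1) / (a - 1) \<le> d powr (a - 1) / (1 - a)"
        by linarith
    qed
    finally show ?thesis .
  qed
  have "(\<integral>\<^sup>+s. \<phi> s * indicator {-pi..pi} s \<partial>lborel) = (\<integral>\<^sup>+s. \<phi> s * indicator {0..pi} \<bar>s\<bar> \<partial>lborel)"
    by (intro nn_integral_cong) (auto simp: abs_le_iff split: split_indicator)
  also have "\<dots> \<le> 2 * J"
    unfolding J_def by (rule nn_integral_even_le) (auto simp: \<phi>_def)
  finally have two: "(\<integral>\<^sup>+s. \<phi> s * indicator {-pi..pi} s \<partial>lborel) \<le> 2 * J" .
  have "(\<integral>\<^sup>+s. \<phi> s \<partial>circ) = ennreal (1 / (2 * pi)) * (\<integral>\<^sup>+s. \<phi> s * indicator {-pi..pi} s \<partial>lborel)"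
    by (rule nn_integral_circ) measurable
  also have "\<dots> \<le> ennreal (1 / 2) * (2 * J)"
    using pi_gt3 by (intro mult_mono two ennreal_leI) (auto simp: field_simps)
  also have "\<dots> = ennreal (1 / 2 * 2) * J" by (subst ennreal_mult) (simp_all add: mult.assoc)
  finally show ?thesis using Jle unfolding \<phi>_def by simp
qed

text \<open>
  Cauchy's formula for the derivative on the circle of radius \<open>\<rho> = (1 + |z|) / 2\<close>, after subtracting the
  value of \<open>f\<close> at the point of that circle nearest to \<open>z\<close>. At angular distance \<open>s\<close> from it, the
  remaining values are \<open>O(N (|s|/d)\<^sup>1\<^sup>/\<^sup>p)\<close> with \<open>d = \<rho> - |z|\<close>, and since \<open>1/p < 1\<close> the integral against
  \<open>1 / (d + |s|)\<^sup>2\<close> is \<open>O(N / d)\<close>.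
\<close>
lemma mean_lipschitz_deriv_bound:
  assumes f: "f \<in> mean_lipschitz p" and p: "1 < p" and z: "cmod z < 1"
  shows "cmod (deriv f z) \<le> 18432 * p / (p - 1) * mean_lipschitz_norm p f / (1 - cmod z)"
proof -
  have fh: "f \<in> hardy_space p" using f by (simp add: mean_lipschitz_def)
  have hol: "f holomorphic_on ball 0 1" by (rule hardy_space_imp_holomorphic[OF fh])
  define N where "N = mean_lipschitz_norm p f"
  have N0: "0 \<le> N" unfolding N_def by (rule mean_lipschitz_norm_parts[OF f p])
  define r where "r = cmod z"
  define \<alpha> where "\<alpha> = Arg z"
  have zp: "z = of_real r * cis \<alpha>" unfolding r_def \<alpha>_def using rcis_cmod_Arg[of z] by (simp add: rcis_def)
  have r: "0 \<le> r" "r < 1" using z by (auto simp: r_def)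
  define \<rho> where "\<rho> = (1 + r) / 2"
  define d where "d = (1 - r) / 2"
  have \<rho>: "1 / 2 \<le> \<rho>" "\<rho> < 1" "r < \<rho>" using r by (auto simp: \<rho>_def field_simps)
  have d: "0 < d" "\<rho> - r = d" "1 - \<rho> = d" using r by (auto simp: \<rho>_def d_def field_simps)
  define F where "F w = f (cis \<alpha> * w) - f (of_real \<rho> * cis \<alpha>)" for w
  have holF: "F holomorphic_on ball 0 1"
    unfolding F_def
    by (intro holomorphic_intros holomorphic_on_dilation[OF hol]) auto
  have Fb: "cmod (F (of_real \<rho> * cis s)) \<le> 4 * N * (\<bar>s\<bar> / d) powr (1 / p)" if "\<bar>s\<bar> \<le> pi" for s
  proof -
    have "cmod (f (of_real \<rho> * cis (\<alpha> + s)) - f (of_real \<rho> * cis \<alpha>)) \<le> 4 * mean_lipschitz_norm p f * (\<bar>s\<bar> / (1 - \<rho>)) powr (1 / p)"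
      by (rule rotation_increment[OF f p that]) (use \<rho> in auto)
    then show ?thesis unfolding F_def N_def d by (simp add: cis_mult[symmetric] mult_ac)
  qed
  have dist: "(d + \<bar>s\<bar>) / 48 \<le> cmod (of_real \<rho> * cis s - of_real r)" if s: "\<bar>s\<bar> \<le> pi" for s
  proof -
    have "(1 - r / \<rho> + \<bar>- s\<bar>) / 24 \<le> cmod (1 - of_real (r / \<rho>) * cis (- s))"
      using r \<rho> s pi_gt3 by (intro norm_one_minus_polar_ge) (auto simp: field_simps)
    then have "\<rho> * ((1 - r / \<rho> + \<bar>s\<bar>) / 24) \<le> \<rho> * cmod (1 - of_real (r / \<rho>) * cis (- s))"
      using \<rho> by (intro mult_left_mono) auto
    also have "\<rho> * cmod (1 - of_real (r / \<rho>) * cis (- s)) = cmod (of_real \<rho> * cis s * (1 - of_real (r / \<rho>) * cis (- s)))"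
      using \<rho> by (simp add: norm_mult)
    also have "of_real \<rho> * cis s * (1 - of_real (r / \<rho>) * cis (- s)) = of_real \<rho> * cis s - of_real r"
      using \<rho> cis_mult[of s "- s"] by (simp add: algebra_simps)
    also have "\<rho> * ((1 - r / \<rho> + \<bar>s\<bar>) / 24) = (d + \<rho> * \<bar>s\<bar>) / 24"
      using \<rho> d by (simp add: field_simps)
    finally have "(d + \<rho> * \<bar>s\<bar>) / 24 \<le> cmod (of_real \<rho> * cis s - of_real r)" .
    moreover have "(1 / 2) * \<bar>s\<bar> \<le> \<rho> * \<bar>s\<bar>" using \<rho> by (intro mult_right_mono) auto
    ultimately show ?thesis using d(1) by (simp add: field_simps)
  qed
  have "F holomorphic_on cball 0 \<rho>" using holF \<rho> by (auto elim: holomorphic_on_subset)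
  then have "continuous_on (cball 0 \<rho>) F" "F holomorphic_on ball 0 \<rho>"
    by (auto intro: holomorphic_on_imp_continuous_on elim: holomorphic_on_subset)
  then have "((\<lambda>u. F u / (u - of_real r) ^ Suc 1) has_contour_integral ((2 * pi * \<i>) / fact 1 * (deriv ^^ 1) F (of_real r))) (circlepath 0 \<rho>)"
    by (rule Cauchy_has_contour_integral_higher_derivative_circlepath) (use r \<rho> in auto)
  then have 1: "((\<lambda>u. F u / (u - of_real r)\<^sup>2) has_contour_integral (2 * pi * \<i> * deriv F (of_real r))) (circlepath 0 \<rho>)"
    by (simp add: numeral_2_eq_2)
  have nz: "of_real \<rho> * cis s - of_real r \<noteq> 0" for s
  proof
    assume "of_real \<rho> * cis s - of_real r = 0"
    then have "cmod (of_real \<rho> * cis s) = cmod (of_real r)" by simp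
    then show False using \<rho> r by (simp add: norm_mult)
  qed
  have Fc: "continuous_on UNIV (\<lambda>s. F (of_real \<rho> * cis s))"
    using continuous_on_circle_function[OF holF, of \<rho>] \<rho> by simp
  have c: "continuous_on UNIV (\<lambda>s. F (of_real \<rho> * cis s) / (of_real \<rho> * cis s - of_real r)\<^sup>2)"
    using nz by (intro continuous_intros Fc) auto
  define K where "K = 4 * N * 2304 * d powr (- (1 / p))"
  have K0: "0 \<le> K" using N0 by (simp add: K_def)
  have "ennreal (cmod (2 * pi * \<i> * deriv F (of_real r)))
     \<le> ennreal (2 * pi * \<rho>) * (\<integral>\<^sup>+s. ennreal (cmod (F (of_real \<rho> * cis s) / (of_real \<rho> * cis s - of_real r)\<^sup>2)) \<partial>circ)"
    using 1 by (rule contour_circlepath_bound) (use \<rho> c in auto)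
  also have "\<dots> \<le> ennreal (2 * pi * 1) * (\<integral>\<^sup>+s. ennreal K * ennreal ((d + \<bar>s\<bar>) powr (1 / p - 2)) \<partial>circ)"
  proof (rule mult_mono)
    show "(\<integral>\<^sup>+s. ennreal (cmod (F (of_real \<rho> * cis s) / (of_real \<rho> * cis s - of_real r)\<^sup>2)) \<partial>circ)
        \<le> (\<integral>\<^sup>+s. ennreal K * ennreal ((d + \<bar>s\<bar>) powr (1 / p - 2)) \<partial>circ)"
    proof (rule nn_integral_mono_AE)
    show "AE s in circ. ennreal (cmod (F (of_real \<rho> * cis s) / (of_real \<rho> * cis s - of_real r)\<^sup>2)) \<le> ennreal K * ennreal ((d + \<bar>s\<bar>) powr (1 / p - 2))"
      using AE_circ_bounds
    proof eventually_elim
      case (elim s)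
      then have s: "\<bar>s\<bar> \<le> pi" by auto
      have ds: "0 < d + \<bar>s\<bar>" using d by simp
      have "cmod (F (of_real \<rho> * cis s) / (of_real \<rho> * cis s - of_real r)\<^sup>2)
          = cmod (F (of_real \<rho> * cis s)) / (cmod (of_real \<rho> * cis s - of_real r))\<^sup>2"
        by (simp add: norm_divide norm_power)
      also have "\<dots> \<le> (4 * N * ((d + \<bar>s\<bar>) / d) powr (1 / p)) / ((d + \<bar>s\<bar>) / 48)\<^sup>2"
      proof (rule frac_le)
        have "(\<bar>s\<bar> / d) powr (1 / p) \<le> ((d + \<bar>s\<bar>) / d) powr (1 / p)"
          using d p by (intro powr_mono2 divide_right_mono) auto
        then show "cmod (F (of_real \<rho> * cis s)) \<le> 4 * N * ((d + \<bar>s\<bar>) / d) powr (1 / p)"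
          using Fb[OF s] N0 by (meson mult_left_mono order_trans mult_nonneg_nonneg zero_le_numeral)
        show "((d + \<bar>s\<bar>) / 48)\<^sup>2 \<le> (cmod (of_real \<rho> * cis s - of_real r))\<^sup>2"
          using dist[OF s] ds by (intro power_mono) auto
      qed (use ds N0 in auto)
      also have "\<dots> = K * ((d + \<bar>s\<bar>) powr (1 / p) / (d + \<bar>s\<bar>)\<^sup>2)"
        using d ds by (simp add: K_def powr_divide powr_minus power_divide field_simps)
      also have "(d + \<bar>s\<bar>) powr (1 / p) / (d + \<bar>s\<bar>)\<^sup>2 = (d + \<bar>s\<bar>) powr (1 / p - 2)"
        using ds by (simp add: powr_diff)
      finally show ?case using K0 by (simp add: ennreal_leI flip: ennreal_mult)
    qed
    qed
    show "ennreal (2 * pi * \<rho>) \<le> ennreal (2 * pi * 1)" using \<rho> by (intro ennreal_leI) simp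
  qed auto
  also have "\<dots> = ennreal (2 * pi) * (ennreal K * (\<integral>\<^sup>+s. ennreal ((d + \<bar>s\<bar>) powr (1 / p - 2)) \<partial>circ))"
    by (simp add: nn_integral_cmult)
  also have "\<dots> \<le> ennreal (2 * pi) * (ennreal K * ennreal (d powr (1 / p - 1) / (1 - 1 / p)))"
    using p d by (intro mult_left_mono nn_integral_circ_abs_powr) auto
  also have "\<dots> = ennreal (2 * pi * (K * (d powr (1 / p - 1) / (1 - 1 / p))))"
    using K0 p by (subst ennreal_mult[symmetric], simp, simp)+ simp
  finally have "cmod (2 * pi * \<i> * deriv F (of_real r)) \<le> 2 * pi * (K * (d powr (1 / p - 1) / (1 - 1 / p)))"
    using K0 p by (subst (asm) ennreal_le_iff) auto
  then have "2 * pi * cmod (deriv F (of_real r)) \<le> 2 * pi * (K * (d powr (1 / p - 1) / (1 - 1 / p)))"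
    by (simp only: norm_mult) simp
  then have "cmod (deriv F (of_real r)) \<le> K * (d powr (1 / p - 1) / (1 - 1 / p))"
    by (rule mult_left_le_imp_le) simp
  also have "K * (d powr (1 / p - 1) / (1 - 1 / p)) = 9216 * N * (d powr (- (1 / p)) * d powr (1 / p - 1)) / (1 - 1 / p)"
    by (simp add: K_def)
  also have "d powr (- (1 / p)) * d powr (1 / p - 1) = 1 / d"
  proof -
    have "d powr (- (1 / p)) * d powr (1 / p - 1) = d powr (- (1 / p) + (1 / p - 1))"
      by (rule powr_add[symmetric])
    also have "- (1 / p) + (1 / p - 1) = - 1" by simp
    also have "d powr (- 1) = 1 / d" using d by (simp add: powr_minus_divide)
    finally show ?thesis .
  qed
  also have "9216 * N * (1 / d) / (1 - 1 / p) = 18432 * p / (p - 1) * N / (1 - r)"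
    using p r by (simp add: d_def field_simps)
  also have "deriv F (of_real r) = cis \<alpha> * deriv f z"
  proof -
    have "(f has_field_derivative deriv f z) (at (cis \<alpha> * of_real r))"
      using holomorphic_derivI[OF hol, of z] z by (simp add: zp mult.commute)
    then have "(F has_field_derivative deriv f z * cis \<alpha>) (at (of_real r))"
      unfolding F_def by (auto intro!: derivative_eq_intros DERIV_chain2[where f = f])
    then show ?thesis by (simp add: DERIV_imp_deriv mult.commute)
  qed
  finally show ?thesis by (simp add: norm_mult N_def r_def)
qed

lemma mean_lipschitz_log_growth:
  assumes f: "f \<in> mean_lipschitz p" and p: "1 < p" and t: "0 \<le> t" "t < 1"
  shows "cmod (f (of_real t)) \<le> 18432 * p / (p - 1) * mean_lipschitz_norm p f * (1 + ln (1 / (1 - t)))"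
proof -
  have fh: "f \<in> hardy_space p" using f by (simp add: mean_lipschitz_def)
  have hol: "f holomorphic_on ball 0 1" by (rule hardy_space_imp_holomorphic[OF fh])
  define N where "N = mean_lipschitz_norm p f"
  have N0: "0 \<le> N" unfolding N_def by (rule mean_lipschitz_norm_parts[OF f p])
  define K where "K = 18432 * p / (p - 1) * N"
  have "2 \<le> 18432 * p / (p - 1)" using p by (simp add: field_simps)
  then have K2: "2 * N \<le> K" unfolding K_def using N0 by (rule mult_right_mono)
  have f0: "cmod (f 0) \<le> K"
    using hardy_value_at_0[OF fh p] mean_lipschitz_norm_parts(2)[OF f p] K2 unfolding N_def by linarith
  have fd: "((\<lambda>x. f (of_real x)) has_vector_derivative deriv f (of_real x)) (at x)" if "0 \<le> x" "x < 1" for x :: real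
    using holomorphic_derivI[OF hol, of "of_real x"] that
    by (intro has_vector_derivative_real_field) auto
  have "norm (f (of_real t) - f (of_real 0)) \<le> K * - ln (1 - t) - K * - ln (1 - 0)"
  proof (cases "t = 0")
    case False
    show ?thesis
    proof (rule differentiable_bound_general[where f' = "\<lambda>x. deriv f (of_real x)" and \<phi>' = "\<lambda>x. K / (1 - x)"])
      show "0 < t" using t False by simp
      show "continuous_on {0..t} (\<lambda>x. f (of_real x))"
      proof (intro continuous_at_imp_continuous_on ballI)
        fix x assume "x \<in> {0..t}"
        then show "isCont (\<lambda>x. f (of_real x)) x"
          using t by (intro has_vector_derivative_continuous[OF fd]) auto
      qed
      show "continuous_on {0..t} (\<lambda>x. K * - ln (1 - x))"
        using t by (intro continuous_intros) auto
      fix x assume x: "0 < x" "x < t"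
      show "((\<lambda>x. f (of_real x)) has_vector_derivative deriv f (of_real x)) (at x)"
        using fd x t by auto
      show "((\<lambda>x. K * - ln (1 - x)) has_vector_derivative K / (1 - x)) (at x)"
        unfolding has_real_derivative_iff_has_vector_derivative[symmetric]
        using x t by (auto intro!: derivative_eq_intros)
      show "norm (deriv f (of_real x)) \<le> K / (1 - x)"
        using mean_lipschitz_deriv_bound[OF f p, of "of_real x"] x t by (simp add: K_def N_def)
    qed
  qed simp
  then have "cmod (f (of_real t) - f 0) \<le> K * ln (1 / (1 - t))" using t by (simp add: ln_div)
  then have "cmod (f (of_real t)) \<le> K + K * ln (1 / (1 - t))"
    using f0 norm_triangle_sub[of "f (of_real t)" "f 0"] by linarith
  also have "\<dots> = K * (1 + ln (1 / (1 - t)))" by (simp add: algebra_simps)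
  finally show ?thesis by (simp add: K_def N_def)
qed

section \<open>Functions with a logarithmic singularity belong to the mean Lipschitz space\<close>

lemma radial_derivative:
  assumes "F holomorphic_on ball 0 1" "0 \<le> r" "r < 1"
  shows "((\<lambda>r. F (of_real r * cis x)) has_vector_derivative deriv F (of_real r * cis x) * cis x) (at r)"
proof -
  have "(F has_field_derivative deriv F (of_real r * cis x)) (at (of_real r * cis x))"
    using holomorphic_derivI[OF assms(1), of "of_real r * cis x"] assms by (simp add: norm_mult)
  then have "((\<lambda>w. F (w * cis x)) has_field_derivative deriv F (of_real r * cis x) * cis x) (at (of_real r))"
    by (auto intro!: derivative_eq_intros DERIV_chain2[where f = F])
  then show ?thesis by (rule has_vector_derivative_real_field)
qed

lemma angular_derivative:
  assumes "F holomorphic_on ball 0 1" "0 \<le> r" "r < 1"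
  shows "((\<lambda>x. F (of_real r * cis x)) has_vector_derivative deriv F (of_real r * cis x) * (of_real r * (\<i> * cis x))) (at x)"
proof -
  have "(F has_field_derivative deriv F (of_real r * cis x)) (at (of_real r * cis x))"
    using holomorphic_derivI[OF assms(1), of "of_real r * cis x"] assms by (simp add: norm_mult)
  moreover have "((\<lambda>w. of_real r * exp (\<i> * w)) has_field_derivative of_real r * (\<i> * cis x)) (at (of_real x))"
    by (auto intro!: derivative_eq_intros simp: cis_conv_exp)
  ultimately have "((\<lambda>w. F (of_real r * exp (\<i> * w))) has_field_derivative deriv F (of_real r * cis x) * (of_real r * (\<i> * cis x))) (at (of_real x))"
    by (intro DERIV_chain2[where f = F]) (simp_all add: cis_conv_exp)
  then have "((\<lambda>x. F (of_real r * exp (\<i> * of_real x))) has_vector_derivative deriv F (of_real r * cis x) * (of_real r * (\<i> * cis x))) (at x)"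
    by (rule has_vector_derivative_real_field)
  then show ?thesis by (simp add: cis_conv_exp)
qed

lemma arc_increment_le:
  assumes hol: "F holomorphic_on ball 0 1" and r: "0 \<le> r" "r < 1" and ab: "a \<le> b"
    and B: "\<And>x. a \<le> x \<Longrightarrow> x \<le> b \<Longrightarrow> cmod (deriv F (of_real r * cis x)) \<le> B"
  shows "cmod (F (of_real r * cis b) - F (of_real r * cis a)) \<le> B * (b - a)"
proof (cases "a = b")
  case False
  have "norm (F (of_real r * cis b) - F (of_real r * cis a)) \<le> B * b - B * a"
  proof (rule differentiable_bound_general[where f' = "\<lambda>x. deriv F (of_real r * cis x) * (of_real r * (\<i> * cis x))" and \<phi>' = "\<lambda>x. B"])
    show "a < b" using False ab by simp
    show "continuous_on {a..b} (\<lambda>x. F (of_real r * cis x))"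
      using continuous_on_circle_function[OF hol, of r] r by simp
    show "continuous_on {a..b} (\<lambda>x. B * x)" by (intro continuous_intros)
    fix x assume x: "a < x" "x < b"
    show "((\<lambda>x. F (of_real r * cis x)) has_vector_derivative deriv F (of_real r * cis x) * (of_real r * (\<i> * cis x))) (at x)"
      by (rule angular_derivative[OF hol r])
    show "((\<lambda>x. B * x) has_vector_derivative B) (at x)"
      unfolding has_real_derivative_iff_has_vector_derivative[symmetric]
      by (auto intro!: derivative_eq_intros)
    have "cmod (deriv F (of_real r * cis x)) * r \<le> B * 1"
      using B[of x] x r order_trans[OF norm_ge_zero B[of x]] by (intro mult_mono) auto
    then show "norm (deriv F (of_real r * cis x) * (of_real r * (\<i> * cis x))) \<le> B"
      using r by (simp add: norm_mult)
  qed
  then show ?thesis by (simp add: algebra_simps)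
qed simp

lemma nn_integral_abs_inv_sqrt:
  assumes c: "0 \<le> c"
  shows "(\<integral>\<^sup>+x. ennreal (\<bar>x\<bar> powr (- (1 / 2))) * indicator {-c..c} x \<partial>lborel) \<le> ennreal (4 * c powr (1 / 2))"
proof -
  define J where "J = (\<integral>\<^sup>+x. ennreal (\<bar>x\<bar> powr (- (1 / 2))) * indicator {0..c} x \<partial>lborel)"
  have "((\<lambda>x. x powr (- (1 / 2))) has_integral (c powr (- (1 / 2) + 1) / (- (1 / 2) + 1))) {0..c}"
    by (rule has_integral_powr_from_0) (use c in auto)
  then have "((\<lambda>x. \<bar>x\<bar> powr (- (1 / 2))) has_integral (2 * c powr (1 / 2))) {0..c}"
    by (rule has_integral_eq_rhs[OF has_integral_eq[rotated]]) auto
  then have J: "J = ennreal (2 * c powr (1 / 2))"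
    unfolding J_def by (intro nn_integral_has_integral_lebesgue') auto
  have "(\<integral>\<^sup>+x. ennreal (\<bar>x\<bar> powr (- (1 / 2))) * indicator {-c..c} x \<partial>lborel)
      = (\<integral>\<^sup>+x. ennreal (\<bar>x\<bar> powr (- (1 / 2))) * indicator {0..c} \<bar>x\<bar> \<partial>lborel)"
    by (intro nn_integral_cong) (auto simp: abs_le_iff split: split_indicator)
  also have "\<dots> \<le> 2 * J"
    unfolding J_def by (rule nn_integral_even_le) auto
  also have "\<dots> = ennreal (4 * c powr (1 / 2))"
    unfolding J using ennreal_mult[of 2 "2 * c powr (1 / 2)"] by simp
  finally show ?thesis .
qed

lemma tail_powr_integral:
  fixes p t :: real
  assumes p: "1 < p" and t: "0 < t" "t \<le> 1 / 2"
  shows "(\<integral>\<^sup>+x. ennreal (\<bar>x\<bar> powr (- p)) * indicator ({x. 2 * t \<le> \<bar>x\<bar>} \<inter> {-pi..pi}) x \<partial>lborel) \<le> ennreal (2 * t powr (1 - p) / (p - 1))"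
proof -
  define J where "J = (\<integral>\<^sup>+x. ennreal (\<bar>x\<bar> powr (- p)) * indicator {2 * t..pi} x \<partial>lborel)"
  have Jle: "J \<le> ennreal (t powr (1 - p) / (p - 1))"
  proof -
    have "J = ennreal (pi powr (1 - p) / (1 - p) - (2 * t) powr (1 - p) / (1 - p))"
      unfolding J_def
    proof (rule nn_integral_FTC_Icc[where F = "\<lambda>x. x powr (1 - p) / (1 - p)"])
      fix x assume x: "x \<in> {2 * t..pi}"
      have "((\<lambda>x. x powr (1 - p) / (1 - p)) has_real_derivative (1 - p) * x powr (1 - p - 1) / (1 - p)) (at x)"
        using x t by (auto intro!: derivative_eq_intros)
      then show "((\<lambda>x. x powr (1 - p) / (1 - p)) has_real_derivative \<bar>x\<bar> powr (- p)) (at x)"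
        using x t p by simp
    qed (use t pi_gt3 in auto)
    also have "\<dots> \<le> ennreal (t powr (1 - p) / (p - 1))"
    proof (rule ennreal_leI)
      have "pi powr (1 - p) / (1 - p) \<le> 0" using p by (intro divide_nonneg_neg) auto
      moreover have "- ((2 * t) powr (1 - p) / (1 - p)) = (2 * t) powr (1 - p) / (p - 1)"
        using minus_divide_right[of "(2 * t) powr (1 - p)" "1 - p"] by simp
      moreover have "(2 * t) powr (1 - p) / (p - 1) \<le> t powr (1 - p) / (p - 1)"
        using p t by (intro divide_right_mono powr_mono2') auto
      ultimately show "pi powr (1 - p) / (1 - p) - (2 * t) powr (1 - p) / (1 - p) \<le> t powr (1 - p) / (p - 1)"
        by linarith
    qed
    finally show ?thesis .
  qed
  have "(\<integral>\<^sup>+x. ennreal (\<bar>x\<bar> powr (- p)) * indicator ({x. 2 * t \<le> \<bar>x\<bar>} \<inter> {-pi..pi}) x \<partial>lborel)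
      = (\<integral>\<^sup>+x. ennreal (\<bar>x\<bar> powr (- p)) * indicator {2 * t..pi} \<bar>x\<bar> \<partial>lborel)"
    by (intro nn_integral_cong) (auto simp: abs_le_iff split: split_indicator)
  also have "\<dots> \<le> 2 * J"
    unfolding J_def by (rule nn_integral_even_le) auto
  also have "\<dots> \<le> 2 * ennreal (t powr (1 - p) / (p - 1))"
    by (intro mult_left_mono Jle) auto
  also have "\<dots> = ennreal (2 * t powr (1 - p) / (p - 1))"
    using p ennreal_mult[of 2 "t powr (1 - p) / (p - 1)"] by simp
  finally show ?thesis .
qed

text \<open>
  The summand with \<open>2 / (p - 1)\<close> is the contribution of the angles far from the singularity, through
  the tail integral of \<open>|x|\<^sup>-\<^sup>p\<close>; the others come from the Hardy norm and the angles near \<open>1\<close>.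
\<close>
definition lipschitz_const :: "real \<Rightarrow> real" where
  "lipschitz_const p = 36 + 17280 * p + 216 * p * (16 + 2 / (p - 1))"

text \<open>
  On the disc \<open>|1 - z|\<close> is comparable to \<open>(1 - r) + |x|\<close> for \<open>z = r e\<^sup>i\<^sup>x\<close>, and the hypothesis is used
  through this form (\<open>deriv_polar_le\<close>). It holds for \<open>-log (1 - z)\<close> and for Hankel images alike.
\<close>
locale log_singular =
  fixes F :: "complex \<Rightarrow> complex" and C :: real
  assumes hol: "F holomorphic_on ball 0 1" and C0: "0 \<le> C"
    and dF: "\<And>z. cmod z < 1 \<Longrightarrow> cmod (deriv F z) \<le> C / cmod (1 - z)"
begin

lemma deriv_polar_le:
  assumes r: "0 \<le> r" "r < 1" and x: "\<bar>x\<bar> \<le> 5 * pi / 3"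
  shows "cmod (deriv F (of_real r * cis x)) \<le> 24 * C / (1 - r + \<bar>x\<bar>)"
proof -
  have "cmod (deriv F (of_real r * cis x)) \<le> C / cmod (1 - of_real r * cis x)"
    using r by (intro dF) (simp add: norm_mult)
  also have "\<dots> \<le> C / ((1 - r + \<bar>x\<bar>) / 24)"
    using norm_one_minus_polar_ge[of r x] r x C0 by (intro divide_left_mono) (auto intro!: mult_pos_pos simp: one_minus_polar_nonzero)
  finally show ?thesis by (simp add: mult.commute)
qed

lemma radial_increment_le:
  assumes rs: "0 \<le> r" "r \<le> s" "s < 1" and x: "\<bar>x\<bar> \<le> 5 * pi / 3" "x \<noteq> 0"
  shows "cmod (F (of_real s * cis x) - F (of_real r * cis x)) \<le> 24 * C * (ln (1 - r + \<bar>x\<bar>) - ln (1 - s + \<bar>x\<bar>))"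
proof (cases "r = s")
  case False
  \<comment> \<open>A primitive of the bound in \<open>deriv_polar_le\<close>.\<close>
  define \<phi> where "\<phi> u = - (24 * C * ln (1 - u + \<bar>x\<bar>))" for u
  have "norm (F (of_real s * cis x) - F (of_real r * cis x)) \<le> \<phi> s - \<phi> r"
  proof (rule differentiable_bound_general[where f' = "\<lambda>u. deriv F (of_real u * cis x) * cis x" and \<phi>' = "\<lambda>u. 24 * C / (1 - u + \<bar>x\<bar>)"])
    show "r < s" using False rs by simp
    have "isCont (\<lambda>u. F (of_real u * cis x)) u" if "u \<in> {r..s}" for u
      using that rs by (intro has_vector_derivative_continuous[OF radial_derivative[OF hol]]) auto
    then show "continuous_on {r..s} (\<lambda>u. F (of_real u * cis x))"
      by (intro continuous_at_imp_continuous_on) auto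
    show "continuous_on {r..s} \<phi>" unfolding \<phi>_def
      using rs x by (intro continuous_intros) auto
    fix u assume u: "r < u" "u < s"
    show "((\<lambda>u. F (of_real u * cis x)) has_vector_derivative deriv F (of_real u * cis x) * cis x) (at u)"
      using u rs by (intro radial_derivative hol) auto
    show "(\<phi> has_vector_derivative 24 * C / (1 - u + \<bar>x\<bar>)) (at u)"
      unfolding has_real_derivative_iff_has_vector_derivative[symmetric] \<phi>_def
      using u rs by (auto intro!: derivative_eq_intros)
    show "norm (deriv F (of_real u * cis x) * cis x) \<le> 24 * C / (1 - u + \<bar>x\<bar>)"
      using deriv_polar_le[of u x] u rs x by (simp add: norm_mult)
  qed
  then show ?thesis by (simp add: \<phi>_def algebra_simps)
qed simp

text \<open>
  A power instead of the logarithm of \<open>radial_increment_le\<close>: for \<open>a = 1 / (2 p)\<close> its \<open>p\<close>-th power is a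
  multiple of \<open>|x|\<^sup>-\<^sup>1\<^sup>/\<^sup>2\<close> near \<open>0\<close>, which is integrable with the right scaling.
\<close>
lemma radial_increment_powr:
  assumes rs: "0 \<le> r" "r \<le> s" "s < 1" and x: "\<bar>x\<bar> \<le> 5 * pi / 3" "x \<noteq> 0" and a: "0 < a"
  shows "cmod (F (of_real s * cis x) - F (of_real r * cis x)) \<le> 24 * C / a * ((1 - r + \<bar>x\<bar>) / \<bar>x\<bar>) powr a"
proof -
  have "ln (1 - r + \<bar>x\<bar>) - ln (1 - s + \<bar>x\<bar>) \<le> ln (1 - r + \<bar>x\<bar>) - ln \<bar>x\<bar>"
    using rs x by simp
  also have "\<dots> = ln ((1 - r + \<bar>x\<bar>) / \<bar>x\<bar>)" using rs x by (simp add: ln_div)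
  also have "\<dots> \<le> ((1 - r + \<bar>x\<bar>) / \<bar>x\<bar>) powr a / a"
    using rs x a by (intro ln_powr_bound) auto
  finally have "24 * C * (ln (1 - r + \<bar>x\<bar>) - ln (1 - s + \<bar>x\<bar>)) \<le> 24 * C * (((1 - r + \<bar>x\<bar>) / \<bar>x\<bar>) powr a / a)"
    using C0 by (intro mult_left_mono) auto
  then show ?thesis using radial_increment_le[OF rs x] by simp
qed

text \<open>
  Away from \<open>1\<close> the derivative is bounded along the radius, so \<open>F\<close> is Lipschitz there and extends to
  its endpoint.
\<close>
lemma radial_limit:
  assumes x: "\<bar>x\<bar> \<le> 5 * pi / 3" "x \<noteq> 0"
  shows "((\<lambda>r. F (of_real r * cis x)) \<longlongrightarrow> boundary_value F x) (at_left 1)"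
proof -
  define B where "B = 24 * C / \<bar>x\<bar>"
  have B0: "0 \<le> B" using C0 by (simp add: B_def)
  have lip: "cmod (F (of_real s * cis x) - F (of_real r * cis x)) \<le> B * (s - r)" if rs: "0 \<le> r" "r \<le> s" "s < 1" for r s
  proof -
    have "ln ((1 - r + \<bar>x\<bar>) / (1 - s + \<bar>x\<bar>)) \<le> (1 - r + \<bar>x\<bar>) / (1 - s + \<bar>x\<bar>) - 1"
      using rs x by (intro ln_le_minus_one) auto
    also have "\<dots> = (s - r) / (1 - s + \<bar>x\<bar>)" using rs x by (simp add: field_simps)
    also have "\<dots> \<le> (s - r) / \<bar>x\<bar>" using rs x by (intro divide_left_mono) (auto intro!: mult_pos_pos)
    finally have "ln (1 - r + \<bar>x\<bar>) - ln (1 - s + \<bar>x\<bar>) \<le> (s - r) / \<bar>x\<bar>"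
      using rs x ln_div[of "1 - r + \<bar>x\<bar>" "1 - s + \<bar>x\<bar>"] by (smt (verit))
    then have "24 * C * (ln (1 - r + \<bar>x\<bar>) - ln (1 - s + \<bar>x\<bar>)) \<le> 24 * C * ((s - r) / \<bar>x\<bar>)"
      using C0 by (intro mult_left_mono) auto
    then show ?thesis using radial_increment_le[OF rs x] by (simp add: B_def)
  qed
  have lip': "dist (F (of_real s * cis x)) (F (of_real r * cis x)) \<le> B * dist s r" if "r \<in> {0..<1}" "s \<in> {0..<1}" for r s
    using lip[of r s] lip[of s r] that by (cases "r \<le> s") (auto simp: dist_norm norm_minus_commute)
  have "uniformly_continuous_on {0..<1} (\<lambda>r. F (of_real r * cis x))"
    by (rule lipschitz_on_uniformly_continuous[where L = B], rule lipschitz_onI)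
      (use lip' B0 in \<open>auto simp: dist_commute\<close>)
  moreover have "(1::real) \<in> closure {0..<1}" by simp
  ultimately obtain l where "((\<lambda>r. F (of_real r * cis x)) \<longlongrightarrow> l) (at 1 within {0..<1})"
    using uniformly_continuous_on_extension_at_closure by blast
  moreover have "at (1::real) within {0..<1} = at_left 1"
    by (rule at_within_nhd[where S = "{0<..}"]) auto
  ultimately have "((\<lambda>r. F (of_real r * cis x)) \<longlongrightarrow> l) (at_left 1)" by simp
  then show ?thesis using boundary_value_eq by metis
qed

lemma boundary_increment_powr:
  assumes r: "0 \<le> r" "r < 1" and x: "\<bar>x\<bar> \<le> 5 * pi / 3" "x \<noteq> 0" and a: "0 < a"
  shows "cmod (boundary_value F x - F (of_real r * cis x)) \<le> 24 * C / a * ((1 - r + \<bar>x\<bar>) / \<bar>x\<bar>) powr a"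
proof (rule tendsto_upperbound)
  show "((\<lambda>s. cmod (F (of_real s * cis x) - F (of_real r * cis x))) \<longlongrightarrow> cmod (boundary_value F x - F (of_real r * cis x))) (at_left 1)"
    by (intro tendsto_intros radial_limit x)
  have "\<forall>\<^sub>F s in at_left 1. s \<in> {r<..<1}" using r by (intro eventually_at_left_real) auto
  then show "\<forall>\<^sub>F s in at_left 1. cmod (F (of_real s * cis x) - F (of_real r * cis x)) \<le> 24 * C / a * ((1 - r + \<bar>x\<bar>) / \<bar>x\<bar>) powr a"
    by eventually_elim (use r x a radial_increment_powr in auto)
qed simp

text \<open>
  The arc from \<open>\<theta>\<close> to \<open>\<theta> + t\<close> stays at angular distance at least \<open>|\<theta>| / 2\<close> from \<open>1\<close>.
\<close>
lemma boundary_difference_far: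
  assumes \<theta>: "\<bar>\<theta>\<bar> \<le> pi" and t: "2 * \<bar>t\<bar> \<le> \<bar>\<theta>\<bar>" "\<theta> \<noteq> 0"
  shows "cmod (bv_diff F t \<theta>) \<le> 48 * C * \<bar>t\<bar> / \<bar>\<theta>\<bar>"
proof -
  have xb: "\<bar>x\<bar> \<le> 5 * pi / 3 \<and> \<bar>\<theta>\<bar> / 2 \<le> \<bar>x\<bar>" if "min \<theta> (\<theta> + t) \<le> x" "x \<le> max \<theta> (\<theta> + t)" for x
    using that \<theta> t pi_gt3 by (auto simp: min_def max_def abs_if split: if_splits)
  have step: "cmod (F (of_real r * cis (\<theta> + t)) - F (of_real r * cis \<theta>)) \<le> 48 * C / \<bar>\<theta>\<bar> * \<bar>t\<bar>" if r: "0 \<le> r" "r < 1" for r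
  proof -
    have d: "cmod (deriv F (of_real r * cis x)) \<le> 48 * C / \<bar>\<theta>\<bar>" if "min \<theta> (\<theta> + t) \<le> x" "x \<le> max \<theta> (\<theta> + t)" for x
    proof -
      have "cmod (deriv F (of_real r * cis x)) \<le> 24 * C / (1 - r + \<bar>x\<bar>)"
        using xb[OF that] r by (intro deriv_polar_le) auto
      also have "\<dots> \<le> 24 * C / (\<bar>\<theta>\<bar> / 2)"
        using xb[OF that] r t C0 by (intro divide_left_mono) (auto intro!: mult_pos_pos)
      finally show ?thesis by simp
    qed
    show ?thesis
    proof (cases "0 \<le> t")
      case True
      then show ?thesis using arc_increment_le[OF hol r, of \<theta> "\<theta> + t" "48 * C / \<bar>\<theta>\<bar>"] d by simp
    next
      case False
      then show ?thesis using arc_increment_le[OF hol r, of "\<theta> + t" \<theta> "48 * C / \<bar>\<theta>\<bar>"] d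
        by (simp add: norm_minus_commute)
    qed
  qed
  have 1: "\<bar>\<theta>\<bar> \<le> 5 * pi / 3" "\<theta> \<noteq> 0" "\<bar>\<theta> + t\<bar> \<le> 5 * pi / 3" "\<theta> + t \<noteq> 0"
    using xb[of "\<theta> + t"] \<theta> t by auto
  have "cmod (bv_diff F t \<theta>) \<le> 48 * C / \<bar>\<theta>\<bar> * \<bar>t\<bar>"
  proof (rule tendsto_upperbound)
    show "((\<lambda>s. cmod (F (of_real s * cis (\<theta> + t)) - F (of_real s * cis \<theta>))) \<longlongrightarrow> cmod (bv_diff F t \<theta>)) (at_left 1)"
      unfolding bv_diff_def by (intro tendsto_intros radial_limit 1)
    have "\<forall>\<^sub>F s in at_left 1. s \<in> {0<..<1::real}" by (intro eventually_at_left_real) auto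
    then show "\<forall>\<^sub>F s in at_left 1. cmod (F (of_real s * cis (\<theta> + t)) - F (of_real s * cis \<theta>)) \<le> 48 * C / \<bar>\<theta>\<bar> * \<bar>t\<bar>"
      by eventually_elim (use step in auto)
  qed simp
  then show ?thesis by simp
qed

text \<open>
  The path from the boundary point at angle \<open>x\<close> goes down the radius to the circle of radius \<open>1 - t\<close>,
  where the derivative is \<open>O(C / t)\<close>, and along this circle to the point \<open>1 - t\<close>.
\<close>
lemma boundary_value_near:
  assumes t: "0 < t" "t \<le> 1 / 2" and x: "\<bar>x\<bar> \<le> 3 * t" "x \<noteq> 0" and a: "0 < a" "a \<le> 1"
  shows "cmod (boundary_value F x - F (of_real (1 - t))) \<le> 27 * C / a * (4 * t / \<bar>x\<bar>) powr a"
proof -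
  have x53: "\<bar>x\<bar> \<le> 5 * pi / 3" using x t pi_gt3 by simp
  have "cmod (boundary_value F x - F (of_real (1 - t) * cis x)) \<le> 24 * C / a * ((1 - (1 - t) + \<bar>x\<bar>) / \<bar>x\<bar>) powr a"
    using t x a x53 by (intro boundary_increment_powr) auto
  also have "\<dots> \<le> 24 * C / a * (4 * t / \<bar>x\<bar>) powr a"
    using t x a C0 by (intro mult_left_mono powr_mono2 divide_right_mono) auto
  finally have 1: "cmod (boundary_value F x - F (of_real (1 - t) * cis x)) \<le> 24 * C / a * (4 * t / \<bar>x\<bar>) powr a" .
  have d: "cmod (deriv F (of_real (1 - t) * cis y)) \<le> C / t" for y
  proof -
    have "cmod (deriv F (of_real (1 - t) * cis y)) \<le> C / cmod (1 - of_real (1 - t) * cis y)"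
      using t by (intro dF) (simp only: norm_mult norm_of_real norm_cis, simp)
    also have "\<dots> \<le> C / t"
      using norm_one_minus_scaled(1)[of "1 - t" "cis y"] t C0
      by (intro divide_left_mono) (auto intro!: mult_pos_pos simp del: of_real_diff)
    finally show ?thesis .
  qed
  have "cmod (F (of_real (1 - t) * cis x) - F (of_real (1 - t) * cis 0)) \<le> C / t * \<bar>x\<bar>"
  proof (cases "0 \<le> x")
    case True
    then show ?thesis using arc_increment_le[OF hol, of "1 - t" 0 x "C / t"] d t by simp
  next
    case False
    then show ?thesis using arc_increment_le[OF hol, of "1 - t" x 0 "C / t"] d t
      by (simp add: norm_minus_commute)
  qed
  also have "\<dots> \<le> C / t * (3 * t)" using x t C0 by (intro mult_left_mono) auto
  also have "\<dots> = 3 * C * 1" using t by simp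
  also have "\<dots> \<le> 3 * C * ((1 / a) * (4 * t / \<bar>x\<bar>) powr a)"
  proof -
    have "1 \<le> (4 * t / \<bar>x\<bar>) powr a" using t x a by (intro ge_one_powr_ge_zero) (auto simp: field_simps)
    moreover have "1 \<le> 1 / a" using a by simp
    ultimately have "1 * 1 \<le> (1 / a) * (4 * t / \<bar>x\<bar>) powr a" using a by (intro mult_mono) auto
    then show ?thesis using C0 by (intro mult_left_mono) auto
  qed
  finally have 2: "cmod (F (of_real (1 - t) * cis x) - F (of_real (1 - t))) \<le> 3 * C / a * (4 * t / \<bar>x\<bar>) powr a" by simp
  have "cmod (boundary_value F x - F (of_real (1 - t))) \<le> 24 * C / a * (4 * t / \<bar>x\<bar>) powr a + 3 * C / a * (4 * t / \<bar>x\<bar>) powr a"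
    using norm_triangle_mono[OF 1 2] by simp
  also have "\<dots> = 27 * C / a * (4 * t / \<bar>x\<bar>) powr a"
    by (simp add: algebra_simps add_divide_distrib[symmetric])
  finally show ?thesis .
qed


lemma hardy_mean_le:
  assumes p: "1 < p" and r: "0 < r" "r < 1"
  shows "integral_mean p r F \<le> 4 * cmod (F 0) + 1920 * p * C"
proof -
  define a where "a = 1 / (2 * p)"
  have a: "0 < a" "a \<le> 1" "a * p = 1 / 2" using p by (auto simp: a_def field_simps)
  define A where "A = 120 * C / a"
  have A0: "0 \<le> A" using C0 a by (simp add: A_def)
  define Q where "Q = 2 powr p * (cmod (F 0) powr p + 2 * A powr p)"
  have pt: "cmod (F (of_real r * cis x)) powr p \<le> 2 powr p * (cmod (F 0) powr p + A powr p * \<bar>x\<bar> powr (- (1 / 2)))"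
    if x: "\<bar>x\<bar> \<le> pi" "x \<noteq> 0" for x
  proof -
    have "cmod (F (of_real r * cis x) - F (of_real 0 * cis x)) \<le> 24 * C / a * ((1 - 0 + \<bar>x\<bar>) / \<bar>x\<bar>) powr a"
      using r x a pi_gt3 by (intro radial_increment_powr) auto
    also have "((1 - 0 + \<bar>x\<bar>) / \<bar>x\<bar>) powr a = (1 + \<bar>x\<bar>) powr a * \<bar>x\<bar> powr (- a)"
      using x by (simp add: powr_divide powr_minus_divide)
    also have "24 * C / a * ((1 + \<bar>x\<bar>) powr a * \<bar>x\<bar> powr (- a)) \<le> 24 * C / a * (5 * \<bar>x\<bar> powr (- a))"
    proof (intro mult_left_mono mult_right_mono)
      have "(1 + \<bar>x\<bar>) powr a \<le> 5 powr a" using x a pi_less_4 by (intro powr_mono2) auto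
      also have "\<dots> \<le> 5 powr 1" using a by (intro powr_mono) auto
      finally show "(1 + \<bar>x\<bar>) powr a \<le> 5" by simp
    qed (use C0 a in auto)
    finally have "cmod (F (of_real r * cis x) - F 0) \<le> A * \<bar>x\<bar> powr (- a)" by (simp add: A_def)
    then have "cmod (F (of_real r * cis x)) \<le> cmod (F 0) + A * \<bar>x\<bar> powr (- a)"
      using norm_triangle_sub[of "F (of_real r * cis x)" "F 0"] by linarith
    then have "cmod (F (of_real r * cis x)) powr p \<le> (cmod (F 0) + A * \<bar>x\<bar> powr (- a)) powr p"
      using p by (intro powr_mono2) auto
    also have "\<dots> \<le> 2 powr p * (cmod (F 0) powr p + (A * \<bar>x\<bar> powr (- a)) powr p)"
      using p A0 by (intro powr_add_le) auto
    also have "(A * \<bar>x\<bar> powr (- a)) powr p = A powr p * \<bar>x\<bar> powr (- (1 / 2))"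
    proof -
      have e: "- a * p = - (1 / 2)" using a(3) by simp
      show ?thesis by (simp only: powr_mult powr_powr e)
    qed
    finally show ?thesis .
  qed
  have ae: "AE x in lborel. x \<noteq> (0::real)" by (rule AE_lborel_singleton)
  have "(\<integral>\<^sup>+x. ennreal (cmod (F (of_real r * cis x)) powr p) * indicator {-pi..pi} x \<partial>lborel)
     \<le> (\<integral>\<^sup>+x. ennreal (2 powr p * cmod (F 0) powr p) * indicator {-pi..pi} x
          + ennreal (2 powr p * A powr p) * (ennreal (\<bar>x\<bar> powr (- (1 / 2))) * indicator {-pi..pi} x) \<partial>lborel)"
  proof (rule nn_integral_mono_AE)
    show "AE x in lborel. ennreal (cmod (F (of_real r * cis x)) powr p) * indicator {-pi..pi} x
       \<le> ennreal (2 powr p * cmod (F 0) powr p) * indicator {-pi..pi} x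
          + ennreal (2 powr p * A powr p) * (ennreal (\<bar>x\<bar> powr (- (1 / 2))) * indicator {-pi..pi} x)"
      using ae
    proof eventually_elim
      case (elim x)
      show ?case
      proof (cases "\<bar>x\<bar> \<le> pi")
        case True
        have "ennreal (cmod (F (of_real r * cis x)) powr p) \<le> ennreal (2 powr p * cmod (F 0) powr p + 2 powr p * A powr p * \<bar>x\<bar> powr (- (1 / 2)))"
          using pt[OF True elim] by (intro ennreal_leI) (simp add: algebra_simps)
        also have "\<dots> = ennreal (2 powr p * cmod (F 0) powr p) + ennreal (2 powr p * A powr p) * ennreal (\<bar>x\<bar> powr (- (1 / 2)))"
          by (simp add: ennreal_mult ennreal_plus)
        finally show ?thesis using True by (simp add: indicator_def abs_le_iff)
      next
        case False
        then have "x \<notin> {-pi..pi}" by auto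
        then show ?thesis by simp
      qed
    qed
  qed
  also have "\<dots> = ennreal (2 powr p * cmod (F 0) powr p) * ennreal (2 * pi)
      + ennreal (2 powr p * A powr p) * (\<integral>\<^sup>+x. ennreal (\<bar>x\<bar> powr (- (1 / 2))) * indicator {-pi..pi} x \<partial>lborel)"
    by (simp add: nn_integral_add nn_integral_cmult nn_integral_cmult_indicator)
  also have "\<dots> \<le> ennreal (2 powr p * cmod (F 0) powr p) * ennreal (2 * pi) + ennreal (2 powr p * A powr p) * ennreal (4 * pi powr (1 / 2))"
    by (intro add_left_mono mult_left_mono nn_integral_abs_inv_sqrt) auto
  also have "\<dots> = ennreal (2 powr p * cmod (F 0) powr p * (2 * pi) + 2 powr p * A powr p * (4 * pi powr (1 / 2)))"
    by (simp add: ennreal_mult ennreal_plus)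
  also have "\<dots> \<le> ennreal (2 * pi * Q)"
  proof (rule ennreal_leI)
    have "pi powr (1 / 2) \<le> pi powr 1" using pi_gt3 by (intro powr_mono) auto
    then have "2 powr p * A powr p * (4 * pi powr (1 / 2)) \<le> 2 powr p * A powr p * (4 * pi)"
      by (intro mult_left_mono) auto
    then show "2 powr p * cmod (F 0) powr p * (2 * pi) + 2 powr p * A powr p * (4 * pi powr (1 / 2)) \<le> 2 * pi * Q"
      unfolding Q_def by (simp add: algebra_simps)
  qed
  finally have "integral_mean p r F \<le> Q powr (1 / p)"
    unfolding integral_mean_def using p by (intro circle_norm_le_of_nn_integral) (auto simp: Q_def)
  also have "\<dots> \<le> (2 powr p * (2 * (cmod (F 0) + 2 * A)) powr p) powr (1 / p)"
  proof (intro powr_mono2)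
    have "cmod (F 0) powr p \<le> (cmod (F 0) + 2 * A) powr p" using A0 p by (intro powr_mono2) auto
    moreover have "2 * A powr p \<le> (cmod (F 0) + 2 * A) powr p"
    proof -
      have "2 * A powr p \<le> 2 powr p * A powr p"
        using powr_mono[of 1 p "2::real"] p by (intro mult_right_mono) auto
      also have "\<dots> = (2 * A) powr p" by (simp add: powr_mult)
      also have "\<dots> \<le> (cmod (F 0) + 2 * A) powr p" using A0 p by (intro powr_mono2) auto
      finally show ?thesis .
    qed
    ultimately have "cmod (F 0) powr p + 2 * A powr p \<le> 2 * (cmod (F 0) + 2 * A) powr p" by simp
    also have "\<dots> \<le> 2 powr p * (cmod (F 0) + 2 * A) powr p"
      using powr_mono[of 1 p "2::real"] p by (intro mult_right_mono) auto
    also have "\<dots> = (2 * (cmod (F 0) + 2 * A)) powr p" by (simp only: powr_mult)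
    finally show "Q \<le> 2 powr p * (2 * (cmod (F 0) + 2 * A)) powr p"
      unfolding Q_def by (intro mult_left_mono) auto
  qed (use p in \<open>auto simp: Q_def\<close>)
  also have "\<dots> = 2 * ((2 * (cmod (F 0) + 2 * A)) powr p) powr (1 / p)"
    using p by (intro powr_root_mult) auto
  also have "((2 * (cmod (F 0) + 2 * A)) powr p) powr (1 / p) = 2 * (cmod (F 0) + 2 * A)"
    using p A0 by (simp add: powr_powr)
  finally show ?thesis by (simp add: A_def a_def mult_ac)
qed

lemma in_hardy_space:
  assumes p: "1 < p"
  shows "F \<in> hardy_space p" "hardy_norm p F \<le> 4 * cmod (F 0) + 1920 * p * C"
proof -
  show "F \<in> hardy_space p"
    unfolding hardy_space_def using hol hardy_mean_le[OF p] by (auto intro!: bdd_aboveI2)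
  show "hardy_norm p F \<le> 4 * cmod (F 0) + 1920 * p * C"
    unfolding hardy_norm_def by (rule cSUP_least) (use hardy_mean_le[OF p] in auto)
qed


text \<open>
  For \<open>|\<theta>| < 2 |t|\<close> both boundary values are compared with \<open>F(1 - |t|)\<close>, otherwise they are compared
  with each other. Each of the three terms on the right has an integral \<open>O(|t|)\<close>.
\<close>
lemma bv_diff_pointwise:
  fixes p t :: real
  assumes p: "1 < p" and t: "t \<noteq> 0" "\<bar>t\<bar> \<le> 1 / 2"
    and \<theta>: "\<bar>\<theta>\<bar> \<le> pi" "\<theta> \<noteq> 0" "\<theta> + t \<noteq> 0"
  defines "D \<equiv> 216 * p * C"
  shows "cmod (bv_diff F t \<theta>) powr p \<le> D powr p *
     (\<bar>t\<bar> powr (1 / 2) * (\<bar>\<theta>\<bar> powr (- (1 / 2)) * indicator {- (3 * \<bar>t\<bar>)..3 * \<bar>t\<bar>} \<theta>)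
      + \<bar>t\<bar> powr (1 / 2) * (\<bar>\<theta> + t\<bar> powr (- (1 / 2)) * indicator {- (3 * \<bar>t\<bar>)..3 * \<bar>t\<bar>} (\<theta> + t))
      + \<bar>t\<bar> powr p * (\<bar>\<theta>\<bar> powr (- p) * indicator {x. 2 * \<bar>t\<bar> \<le> \<bar>x\<bar>} \<theta>))"
    (is "_ \<le> D powr p * (?A + ?B + ?E)")
proof -
  have nn: "0 \<le> ?A" "0 \<le> ?B" "0 \<le> ?E" by (auto intro!: mult_nonneg_nonneg)
  have D0: "0 \<le> D" using p C0 by (simp add: D_def)
  show ?thesis
  proof (cases "2 * \<bar>t\<bar> \<le> \<bar>\<theta>\<bar>")
    case True
    have "cmod (bv_diff F t \<theta>) \<le> 48 * C * \<bar>t\<bar> / \<bar>\<theta>\<bar>"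
      using \<theta> True by (intro boundary_difference_far) auto
    also have "\<dots> \<le> D * \<bar>t\<bar> / \<bar>\<theta>\<bar>"
    proof (intro divide_right_mono mult_right_mono)
      have "48 * C * 1 \<le> 216 * C * p" using p C0 by (intro mult_mono) auto
      then show "48 * C \<le> D" by (simp add: D_def mult_ac)
    qed auto
    finally have "cmod (bv_diff F t \<theta>) powr p \<le> (D * \<bar>t\<bar> / \<bar>\<theta>\<bar>) powr p" using p by (intro powr_mono2) auto
    also have "\<dots> = D powr p * ?E" using True \<theta> D0
      by (simp add: powr_mult powr_divide powr_minus_divide)
    also have "\<dots> \<le> D powr p * (?A + ?B + ?E)" using nn by (intro mult_left_mono) auto
    finally show ?thesis .
  next
    case False
    define a where "a = 1 / (2 * p)"
    have a: "0 < a" "a \<le> 1" and ap: "a * p = 1 / 2" using p by (auto simp: a_def field_simps)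
    have pw: "(27 * C / a * (4 * \<bar>t\<bar> / \<bar>x\<bar>) powr a) powr p = (27 * C / a) powr p * 2 * (\<bar>t\<bar> powr (1 / 2) * \<bar>x\<bar> powr (- (1 / 2)))" for x
    proof -
      have "(27 * C / a * (4 * \<bar>t\<bar> / \<bar>x\<bar>) powr a) powr p = (27 * C / a) powr p * (4 * \<bar>t\<bar> / \<bar>x\<bar>) powr (1 / 2)"
        by (simp only: powr_mult powr_powr ap)
      also have "(4 * \<bar>t\<bar> / \<bar>x\<bar>) powr (1 / 2) = 2 * (\<bar>t\<bar> powr (1 / 2) * \<bar>x\<bar> powr (- (1 / 2)))"
        by (simp add: powr_divide powr_mult powr_minus_divide powr_half_sqrt)
      finally show ?thesis by simp
    qed
    have x3: "\<bar>\<theta>\<bar> \<le> 3 * \<bar>t\<bar>" "\<bar>\<theta> + t\<bar> \<le> 3 * \<bar>t\<bar>" using False by auto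
    define G where "G = F (of_real (1 - \<bar>t\<bar>))"
    have "cmod (bv_diff F t \<theta>) \<le> cmod (boundary_value F (\<theta> + t) - G) + cmod (boundary_value F \<theta> - G)"
      unfolding bv_diff_def using norm_triangle_ineq4[of "boundary_value F (\<theta> + t) - G" "boundary_value F \<theta> - G"] by simp
    also have "\<dots> \<le> 27 * C / a * (4 * \<bar>t\<bar> / \<bar>\<theta> + t\<bar>) powr a + 27 * C / a * (4 * \<bar>t\<bar> / \<bar>\<theta>\<bar>) powr a"
      unfolding G_def using t x3 \<theta> a by (intro add_mono boundary_value_near) auto
    finally have "cmod (bv_diff F t \<theta>) powr p \<le> (27 * C / a * (4 * \<bar>t\<bar> / \<bar>\<theta> + t\<bar>) powr a + 27 * C / a * (4 * \<bar>t\<bar> / \<bar>\<theta>\<bar>) powr a) powr p"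
      using p by (intro powr_mono2) auto
    also have "\<dots> \<le> 2 powr p * ((27 * C / a * (4 * \<bar>t\<bar> / \<bar>\<theta> + t\<bar>) powr a) powr p + (27 * C / a * (4 * \<bar>t\<bar> / \<bar>\<theta>\<bar>) powr a) powr p)"
      using p a C0 by (intro powr_add_le) auto
    also have "\<dots> = 2 powr p * (27 * C / a) powr p * 2 * (?A + ?B)"
      unfolding pw using x3 by (simp add: algebra_simps abs_le_iff)
    also have "\<dots> \<le> D powr p * (?A + ?B + ?E)"
    proof (rule mult_mono)
      have "2 powr p * (27 * C / a) powr p * 2 \<le> 2 powr p * (27 * C / a) powr p * 2 powr p"
        using powr_mono[of 1 p "2::real"] p by (intro mult_left_mono) auto
      also have "\<dots> = (2 * (27 * C / a) * 2) powr p" by (simp only: powr_mult)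
      also have "2 * (27 * C / a) * 2 = D" unfolding D_def a_def by simp
      finally show "2 powr p * (27 * C / a) powr p * 2 \<le> D powr p" .
    qed (use nn in auto)
    finally show ?thesis .
  qed
qed

lemma bv_diff_small:
  fixes p t :: real
  assumes p: "1 < p" and t: "t \<noteq> 0" "\<bar>t\<bar> \<le> 1 / 2"
  shows "circle_norm p (bv_diff F t) \<le> 216 * p * C * (16 + 2 / (p - 1)) * \<bar>t\<bar> powr (1 / p)"
proof -
  define D where "D = 216 * p * C"
  have D0: "0 \<le> D" using p C0 by (simp add: D_def)
  define E where "E = 16 + 2 / (p - 1)"
  have E: "1 \<le> E" using p by (simp add: E_def)
  define u where "u x = ennreal (\<bar>x\<bar> powr (- (1 / 2))) * indicator {- (3 * \<bar>t\<bar>)..3 * \<bar>t\<bar>} x" for x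
  define v where "v x = ennreal (\<bar>x\<bar> powr (- p)) * indicator ({x. 2 * \<bar>t\<bar> \<le> \<bar>x\<bar>} \<inter> {-pi..pi}) x" for x
  have [measurable]: "u \<in> borel_measurable borel" "v \<in> borel_measurable borel"
    unfolding u_def v_def by measurable
  have ul: "(\<integral>\<^sup>+x. u x \<partial>lborel) \<le> ennreal (8 * \<bar>t\<bar> powr (1 / 2))"
  proof -
    have "(\<integral>\<^sup>+x. u x \<partial>lborel) \<le> ennreal (4 * (3 * \<bar>t\<bar>) powr (1 / 2))"
      unfolding u_def by (rule nn_integral_abs_inv_sqrt) simp
    also have "\<dots> \<le> ennreal (4 * (4 * \<bar>t\<bar>) powr (1 / 2))"
      by (intro ennreal_leI mult_left_mono powr_mono2) auto
    also have "4 * (4 * \<bar>t\<bar>) powr (1 / 2) = 8 * \<bar>t\<bar> powr (1 / 2)"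
      by (simp add: powr_mult powr_half_sqrt)
    finally show ?thesis .
  qed
  have vl: "(\<integral>\<^sup>+x. v x \<partial>lborel) \<le> ennreal (2 * \<bar>t\<bar> powr (1 - p) / (p - 1))"
    unfolding v_def using p t by (intro tail_powr_integral) auto
  have ae: "AE x in lborel. x \<noteq> c" for c :: real by (rule AE_lborel_singleton)
  define Th where "Th = ennreal (\<bar>t\<bar> powr (1 / 2))"
  have "(\<integral>\<^sup>+\<theta>. ennreal (norm (bv_diff F t \<theta>) powr p) * indicator {-pi..pi} \<theta> \<partial>lborel)
      \<le> (\<integral>\<^sup>+\<theta>. ennreal (D powr p) * (Th * u \<theta> + Th * u (\<theta> + t) + ennreal (\<bar>t\<bar> powr p) * v \<theta>) \<partial>lborel)"
  proof (rule nn_integral_mono_AE)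
    show "AE \<theta> in lborel. ennreal (norm (bv_diff F t \<theta>) powr p) * indicator {-pi..pi} \<theta>
       \<le> ennreal (D powr p) * (Th * u \<theta> + Th * u (\<theta> + t) + ennreal (\<bar>t\<bar> powr p) * v \<theta>)"
      using ae[of 0] ae[of "- t"]
    proof eventually_elim
      case (elim \<theta>)
      show ?case
      proof (cases "\<theta> \<in> {-pi..pi}")
        case True
        then have \<theta>: "\<bar>\<theta>\<bar> \<le> pi" "\<theta> \<noteq> 0" "\<theta> + t \<noteq> 0" using elim by auto
        have ind: "ennreal (indicator A x) = indicator A x" for A :: "real set" and x by (simp add: indicator_def)
        have "ennreal (cmod (bv_diff F t \<theta>) powr p) \<le> ennreal (D powr p *
     (\<bar>t\<bar> powr (1 / 2) * (\<bar>\<theta>\<bar> powr (- (1 / 2)) * indicator {- (3 * \<bar>t\<bar>)..3 * \<bar>t\<bar>} \<theta>)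
      + \<bar>t\<bar> powr (1 / 2) * (\<bar>\<theta> + t\<bar> powr (- (1 / 2)) * indicator {- (3 * \<bar>t\<bar>)..3 * \<bar>t\<bar>} (\<theta> + t))
      + \<bar>t\<bar> powr p * (\<bar>\<theta>\<bar> powr (- p) * indicator {x. 2 * \<bar>t\<bar> \<le> \<bar>x\<bar>} \<theta>)))"
          unfolding D_def by (intro ennreal_leI bv_diff_pointwise p t \<theta>)
        also have "\<dots> = ennreal (D powr p) * (Th * u \<theta> + Th * u (\<theta> + t) + ennreal (\<bar>t\<bar> powr p) * v \<theta>)"
          using True unfolding u_def v_def Th_def
          by (simp add: ennreal_mult ennreal_plus ind indicator_inter_arith)
        finally show ?thesis using True by simp
      qed simp
    qed
  qed
  also have "\<dots> = ennreal (D powr p) * (Th * (\<integral>\<^sup>+\<theta>. u \<theta> \<partial>lborel) + Th * (\<integral>\<^sup>+\<theta>. u (\<theta> + t) \<partial>lborel) + ennreal (\<bar>t\<bar> powr p) * (\<integral>\<^sup>+\<theta>. v \<theta> \<partial>lborel))"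
    by (simp add: nn_integral_cmult nn_integral_add)
  also have "(\<integral>\<^sup>+\<theta>. u (\<theta> + t) \<partial>lborel) = (\<integral>\<^sup>+\<theta>. u \<theta> \<partial>lborel)"
    by (rule nn_integral_lborel_translate) measurable
  also have "ennreal (D powr p) * (Th * (\<integral>\<^sup>+\<theta>. u \<theta> \<partial>lborel) + Th * (\<integral>\<^sup>+\<theta>. u \<theta> \<partial>lborel) + ennreal (\<bar>t\<bar> powr p) * (\<integral>\<^sup>+\<theta>. v \<theta> \<partial>lborel))
     \<le> ennreal (D powr p) * (Th * ennreal (8 * \<bar>t\<bar> powr (1 / 2)) + Th * ennreal (8 * \<bar>t\<bar> powr (1 / 2)) + ennreal (\<bar>t\<bar> powr p) * ennreal (2 * \<bar>t\<bar> powr (1 - p) / (p - 1)))"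
    by (intro mult_left_mono add_mono ul vl) auto
  also have "\<dots> = ennreal (D powr p * (\<bar>t\<bar> powr (1 / 2) * (8 * \<bar>t\<bar> powr (1 / 2)) + \<bar>t\<bar> powr (1 / 2) * (8 * \<bar>t\<bar> powr (1 / 2)) + \<bar>t\<bar> powr p * (2 * \<bar>t\<bar> powr (1 - p) / (p - 1))))"
    unfolding Th_def using p by (simp only: ennreal_mult'' ennreal_plus mult_nonneg_nonneg add_nonneg_nonneg powr_ge_zero divide_nonneg_nonneg zero_le_numeral less_imp_le diff_ge_0_iff_ge)
  also have "D powr p * (\<bar>t\<bar> powr (1 / 2) * (8 * \<bar>t\<bar> powr (1 / 2)) + \<bar>t\<bar> powr (1 / 2) * (8 * \<bar>t\<bar> powr (1 / 2)) + \<bar>t\<bar> powr p * (2 * \<bar>t\<bar> powr (1 - p) / (p - 1))) = D powr p * (E * \<bar>t\<bar>)"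
  proof -
    have "\<bar>t\<bar> powr (1 / 2) * \<bar>t\<bar> powr (1 / 2) = \<bar>t\<bar>" using t by (simp flip: powr_add)
    moreover have "\<bar>t\<bar> powr p * \<bar>t\<bar> powr (1 - p) = \<bar>t\<bar>" using t by (simp flip: powr_add)
    ultimately show ?thesis unfolding E_def by (simp add: algebra_simps)
  qed
  also have "ennreal (D powr p * (E * \<bar>t\<bar>)) \<le> ennreal (2 * pi * (D powr p * (E * \<bar>t\<bar>)))"
  proof (rule ennreal_leI)
    have "1 * (D powr p * (E * \<bar>t\<bar>)) \<le> 2 * pi * (D powr p * (E * \<bar>t\<bar>))"
      using E pi_gt3 by (intro mult_right_mono) auto
    then show "D powr p * (E * \<bar>t\<bar>) \<le> 2 * pi * (D powr p * (E * \<bar>t\<bar>))" by simp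
  qed
  finally have "circle_norm p (bv_diff F t) \<le> (D powr p * (E * \<bar>t\<bar>)) powr (1 / p)"
    using p E by (intro circle_norm_le_of_nn_integral) auto
  also have "\<dots> = D * (E * \<bar>t\<bar>) powr (1 / p)" using D0 E p by (intro powr_root_mult) auto
  also have "(E * \<bar>t\<bar>) powr (1 / p) = E powr (1 / p) * \<bar>t\<bar> powr (1 / p)" by (rule powr_mult)
  also have "D * (E powr (1 / p) * \<bar>t\<bar> powr (1 / p)) \<le> D * (E * \<bar>t\<bar> powr (1 / p))"
    using powr_mono[of "1 / p" 1 E] E p D0 by (intro mult_left_mono mult_right_mono) auto
  finally show ?thesis by (simp add: D_def E_def mult_ac)
qed

text \<open>
  For \<open>|t| > 1/2\<close> the bound follows from the Hardy norm, as then \<open>|t|\<^sup>1\<^sup>/\<^sup>p \<ge> 1/2\<close>.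
\<close>
lemma bv_diff_le:
  fixes p t :: real
  assumes p: "1 < p" and t: "t \<noteq> 0" "\<bar>t\<bar> \<le> pi"
  shows "circle_norm p (bv_diff F t) \<le> (8 * (4 * cmod (F 0) + 1920 * p * C) + 216 * p * C * (16 + 2 / (p - 1))) * \<bar>t\<bar> powr (1 / p)"
proof (cases "\<bar>t\<bar> \<le> 1 / 2")
  case True
  have "216 * p * C * (16 + 2 / (p - 1)) * \<bar>t\<bar> powr (1 / p) \<le> (8 * (4 * cmod (F 0) + 1920 * p * C) + 216 * p * C * (16 + 2 / (p - 1))) * \<bar>t\<bar> powr (1 / p)"
    using p C0 by (intro mult_right_mono) auto
  then show ?thesis using bv_diff_small[OF p t(1) True] by linarith
next
  case False
  define H where "H = 4 * cmod (F 0) + 1920 * p * C"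
  have H0: "0 \<le> H" using p C0 by (simp add: H_def)
  have "circle_norm p (bv_diff F t) \<le> (2 powr p * (2 * hardy_norm p F powr p)) powr (1 / p)"
    by (rule bv_diff_circle_norm_le[OF in_hardy_space(1)[OF p] p])
  also have "\<dots> \<le> (2 powr p * (2 powr p * H powr p)) powr (1 / p)"
  proof (intro powr_mono2 mult_left_mono mult_mono)
    show "2 \<le> 2 powr p" using powr_mono[of 1 p "2::real"] p by simp
    show "hardy_norm p F \<le> H" unfolding H_def by (rule in_hardy_space(2)[OF p])
    show "0 \<le> hardy_norm p F" by (rule hardy_norm_nonneg[OF in_hardy_space(1)[OF p]])
  qed (use p in auto)
  also have "2 powr p * (2 powr p * H powr p) = (4 * H) powr p" by (simp flip: powr_mult)
  also have "((4 * H) powr p) powr (1 / p) = 4 * H" using H0 p by (simp add: powr_powr)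
  also have "4 * H * 1 \<le> 4 * H * (2 * \<bar>t\<bar> powr (1 / p))"
  proof (intro mult_left_mono)
    have "(1 / 2) powr 1 \<le> (1 / 2) powr (1 / p)" using p by (intro powr_mono') auto
    also have "\<dots> \<le> \<bar>t\<bar> powr (1 / p)" using False p by (intro powr_mono2) auto
    finally show "1 \<le> 2 * \<bar>t\<bar> powr (1 / p)" by simp
  qed (use H0 in auto)
  then have "4 * H \<le> 8 * H * \<bar>t\<bar> powr (1 / p)" by simp
  also have "8 * H * \<bar>t\<bar> powr (1 / p) \<le> (8 * H + 216 * p * C * (16 + 2 / (p - 1))) * \<bar>t\<bar> powr (1 / p)"
    using p C0 by (intro mult_right_mono) auto
  finally show ?thesis unfolding H_def .
qed

theorem mean_lipschitz:
  assumes p: "1 < p"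
  shows "F \<in> mean_lipschitz p" "mean_lipschitz_norm p F \<le> lipschitz_const p * (cmod (F 0) + C)"
proof -
  define H where "H = 4 * cmod (F 0) + 1920 * p * C"
  have H0: "0 \<le> H" using p C0 by (simp add: H_def)
  define L where "L = 8 * H + 216 * p * C * (16 + 2 / (p - 1))"
  have L0: "0 \<le> L" unfolding L_def using H0 p C0 by simp
  have mod: "Lp_modulus p \<delta> F \<le> L * \<delta> powr (1 / p)" if d: "0 < \<delta>" "\<delta> \<le> pi" for \<delta>
  proof (rule Lp_modulus_le[OF d(1)])
    fix t assume t: "0 < \<bar>t\<bar>" "\<bar>t\<bar> \<le> \<delta>"
    have "circle_norm p (bv_diff F t) \<le> L * \<bar>t\<bar> powr (1 / p)"
      unfolding L_def H_def using t d by (intro bv_diff_le p) auto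
    also have "\<dots> \<le> L * \<delta> powr (1 / p)" using t L0 p by (intro mult_left_mono powr_mono2) auto
    finally show "circle_norm p (bv_diff F t) \<le> L * \<delta> powr (1 / p)" .
  qed
  have Fh: "F \<in> hardy_space p" by (rule in_hardy_space(1)[OF p])
  have "(\<lambda>\<delta>. Lp_modulus p \<delta> F) \<in> O[at_right 0](\<lambda>\<delta>. \<delta> powr (1 / p))"
  proof (rule bigoI[where c = L])
    have "\<forall>\<^sub>F \<delta> in at_right 0. \<delta> \<in> {0<..<pi}" by (intro eventually_at_right_real) auto
    then show "\<forall>\<^sub>F \<delta> in at_right 0. norm (Lp_modulus p \<delta> F) \<le> L * norm (\<delta> powr (1 / p))"
      by eventually_elim (use mod Lp_modulus_nonneg[OF Fh p] in auto)
  qed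
  then show "F \<in> mean_lipschitz p" using Fh by (simp add: mean_lipschitz_def)
  have "(SUP \<delta>\<in>{0<..pi}. Lp_modulus p \<delta> F / \<delta> powr (1 / p)) \<le> L"
    by (rule cSUP_least) (use mod in \<open>auto simp: field_simps\<close>)
  then have "mean_lipschitz_norm p F \<le> H + L"
    unfolding mean_lipschitz_norm_def using in_hardy_space(2)[OF p] unfolding H_def by linarith
  also have "\<dots> = 36 * cmod (F 0) + 17280 * p * C + 216 * p * (16 + 2 / (p - 1)) * C"
    unfolding L_def H_def by simp
  also have "\<dots> \<le> lipschitz_const p * (cmod (F 0) + C)"
  proof -
    have "36 * cmod (F 0) \<le> lipschitz_const p * cmod (F 0)"
      unfolding lipschitz_const_def using p by (intro mult_right_mono) auto
    moreover have "(17280 * p + 216 * p * (16 + 2 / (p - 1))) * C \<le> lipschitz_const p * C"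
      unfolding lipschitz_const_def using C0 by (intro mult_right_mono) auto
    ultimately show ?thesis by (simp only: distrib_left distrib_right)
  qed
  finally show "mean_lipschitz_norm p F \<le> lipschitz_const p * (cmod (F 0) + C)" .
qed

end

section \<open>The logarithmic Carleson condition on the radius\<close>

locale interval_measure = finite_measure M for M :: "real measure" +
  assumes sets_M: "sets M = sets (restrict_space borel {0..<1})"
begin

lemma space_M: "space M = {0..<1}"
  using sets_eq_imp_space_eq[OF sets_M] by (simp add: space_restrict_space)

lemma measurable_M: "g \<in> borel_measurable borel \<Longrightarrow> g \<in> borel_measurable M"
  unfolding measurable_cong_sets[OF sets_M refl] by (rule measurable_restrict_space1)

lemma interval_sets: "{1 - x..<1} \<in> sets M" if "x \<le> 1" for x
  using that by (simp add: sets_M sets_restrict_space_iff)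

definition tail_mass :: "real \<Rightarrow> real" where
  "tail_mass x = measure M {1 - x..<1}"

lemma tail_mass_nonneg: "0 \<le> tail_mass x"
  by (simp add: tail_mass_def)

lemma emeasure_tail: "x \<le> 1 \<Longrightarrow> emeasure M {1 - x..<1} = ennreal (tail_mass x)"
  by (simp add: tail_mass_def emeasure_eq_measure)

lemma tail_mass_le: "tail_mass x \<le> measure M (space M)"
  unfolding tail_mass_def by (rule bounded_measure)

text \<open>
  The logarithmic Carleson condition on \<open>[0, 1)\<close> with \<open>x = 1 - t\<close>.
\<close>
definition log_tail_bound :: "real \<Rightarrow> bool" where
  "log_tail_bound C \<longleftrightarrow> 0 < C \<and> (\<forall>x. 0 < x \<longrightarrow> x \<le> 1 \<longrightarrow> tail_mass x * ln (1 / x) \<le> C * x)"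

text \<open>
  The box over the closed arc centred at \<open>1\<close> meets the radius in \<open>[1 - x, 1)\<close>. As the trace on the
  disc of a compact set it is Borel.
\<close>
lemma log_carleson_imp_tail:
  assumes "log_carleson (disc_measure M)"
  obtains C where "log_tail_bound C"
proof -
  obtain C where C: "C > 0" "\<And>I l. arc_of_length I l \<Longrightarrow>
      emeasure (disc_measure M) (carleson_box I l) * ennreal (ln (2 * pi / l)) \<le> ennreal (C * l)"
    using assms unfolding log_carleson_def by auto
  have "tail_mass x * ln (1 / x) \<le> C * (2 * pi) * x" if x: "0 < x" "x \<le> 1" for x
  proof -
    define l where "l = 2 * pi * x"
    have l: "0 < l" "l \<le> 2 * pi" "l / (2 * pi) = x" "2 * pi / l = 1 / x" using x by (auto simp: l_def)
    define I where "I = cis ` {- l / 2..l / 2}"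
    have arc: "arc_of_length I l"
      unfolding arc_of_length_def I_def using l by (auto intro!: exI[of _ "- l / 2"] image_mono)
    define K where "K = (\<lambda>(r, t). complex_of_real r * cis t) ` ({1 - x..1} \<times> {- l / 2..l / 2})"
    have "compact K" unfolding K_def case_prod_beta
      by (intro compact_continuous_image compact_Times continuous_intros) auto
    have box: "carleson_box I l = K \<inter> ball 0 1"
    proof (intro set_eqI iffI)
      fix z assume "z \<in> carleson_box I l"
      then obtain r t where z: "z = of_real r * cis t" "cis t \<in> I" "1 - x \<le> r" "r < 1"
        unfolding carleson_box_def l(3) by auto
      then obtain t' where "cis t = cis t'" "t' \<in> {- l / 2..l / 2}" unfolding I_def by auto
      then show "z \<in> K \<inter> ball 0 1" using z x by (auto simp: K_def norm_mult)
    next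
      fix z assume "z \<in> K \<inter> ball 0 1"
      then obtain r t where "z = of_real r * cis t" "r \<in> {1 - x..1}" "t \<in> {- l / 2..l / 2}" "cmod z < 1"
        by (auto simp: K_def)
      then show "z \<in> carleson_box I l" using x unfolding carleson_box_def l(3) I_def
        by (intro CollectI exI[of _ r] exI[of _ t]) (auto simp: norm_mult)
    qed
    have "emeasure (disc_measure M) (carleson_box I l) = emeasure M {t \<in> {0..<1}. complex_of_real t \<in> carleson_box I l}"
      unfolding box
    proof (rule emeasure_disc_measure[OF sets_M])
      show "K \<inter> ball 0 1 \<in> sets borel"
        using \<open>compact K\<close> by (intro sets.Int borel_closed compact_imp_closed borel_open) auto
    qed simp
    also have "{t \<in> {0..<1}. complex_of_real t \<in> carleson_box I l} \<supseteq> {1 - x..<1}"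
    proof
      fix t assume t: "t \<in> {1 - x..<1}"
      have "cis 0 \<in> I" unfolding I_def using l by (intro imageI) auto
      then have "complex_of_real t \<in> carleson_box I l" using t unfolding carleson_box_def l(3)
        by (intro CollectI exI[of _ t] exI[of _ 0]) auto
      then show "t \<in> {t \<in> {0..<1}. complex_of_real t \<in> carleson_box I l}" using t x by auto
    qed
    then have "emeasure M {1 - x..<1} \<le> emeasure M {t \<in> {0..<1}. complex_of_real t \<in> carleson_box I l}"
    proof (rule emeasure_mono)
      have "complex_of_real -` (K \<inter> ball 0 1) \<in> sets borel"
      proof (rule measurable_sets_borel)
        show "complex_of_real \<in> borel_measurable borel" by (rule borel_measurable_of_real)
        show "K \<inter> ball 0 1 \<in> sets borel"
          using \<open>compact K\<close> by (intro sets.Int borel_closed compact_imp_closed borel_open) auto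
      qed
      moreover have "{t \<in> {0..<1}. complex_of_real t \<in> carleson_box I l} = complex_of_real -` (K \<inter> ball 0 1) \<inter> {0..<1}"
        unfolding box by auto
      ultimately show "{t \<in> {0..<1}. complex_of_real t \<in> carleson_box I l} \<in> sets M"
        by (simp add: sets_M sets_restrict_space_iff)
    qed
    finally have "ennreal (tail_mass x) * ennreal (ln (1 / x)) \<le> emeasure (disc_measure M) (carleson_box I l) * ennreal (ln (2 * pi / l))"
      unfolding l(4) using x by (intro mult_right_mono) (auto simp: emeasure_tail)
    also have "\<dots> \<le> ennreal (C * l)" by (rule C(2)[OF arc])
    finally have "ennreal (tail_mass x * ln (1 / x)) \<le> ennreal (C * l)"
      using x tail_mass_nonneg[of x] by (simp add: ennreal_mult)
    then show ?thesis using C(1) l(1) by (subst (asm) ennreal_le_iff) (auto simp: l_def mult_ac)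
  qed
  then show ?thesis using that[of "C * (2 * pi)"] C(1) by (auto simp: log_tail_bound_def)
qed

text \<open>
  Every box lies in the annulus \<open>1 - x \<le> |z| < 1\<close>, which meets the radius in \<open>[1 - x, 1)\<close>.
\<close>
lemma tail_imp_log_carleson:
  assumes C: "log_tail_bound C"
  shows "log_carleson (disc_measure M)"
  unfolding log_carleson_def
proof (intro exI[of _ "C / (2 * pi)"] conjI allI impI)
  show "C / (2 * pi) > 0" using C by (simp add: log_tail_bound_def)
  fix I l assume arc: "arc_of_length I l"
  define x where "x = l / (2 * pi)"
  have l: "0 < l" "l \<le> 2 * pi" using arc by (auto simp: arc_of_length_def)
  have x: "0 < x" "x \<le> 1" "2 * pi / l = 1 / x" using l by (auto simp: x_def field_simps)
  define A where "A = {z :: complex. 1 - x \<le> cmod z \<and> cmod z < 1}"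
  have A: "A \<in> sets borel" unfolding A_def by measurable
  have Ab: "A \<subseteq> ball 0 1" by (auto simp: A_def)
  have sub: "carleson_box I l \<subseteq> A"
    using x unfolding carleson_box_def A_def x_def[symmetric] by (auto simp: norm_mult)
  have "A \<in> sets (disc_measure M)"
    using A Ab by (simp add: disc_measure_def sets_restrict_space_iff)
  then have "emeasure (disc_measure M) (carleson_box I l) \<le> emeasure (disc_measure M) A"
    by (rule emeasure_mono[OF sub])
  also have "\<dots> = emeasure M {t \<in> {0..<1}. complex_of_real t \<in> A}"
    by (rule emeasure_disc_measure[OF sets_M A Ab])
  also have "{t \<in> {0..<1}. complex_of_real t \<in> A} = {1 - x..<1}"
    using x by (auto simp: A_def)
  also have "emeasure M {1 - x..<1} = ennreal (tail_mass x)" using x by (simp add: emeasure_tail)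
  finally have "emeasure (disc_measure M) (carleson_box I l) * ennreal (ln (2 * pi / l)) \<le> ennreal (tail_mass x) * ennreal (ln (1 / x))"
    unfolding x(3) by (rule mult_right_mono) simp
  also have "\<dots> = ennreal (tail_mass x * ln (1 / x))"
    using x tail_mass_nonneg by (simp add: ennreal_mult)
  also have "\<dots> \<le> ennreal (C * x)"
    using C x unfolding log_tail_bound_def by (intro ennreal_leI) auto
  also have "C * x = C / (2 * pi) * l" by (simp add: x_def)
  finally show "emeasure (disc_measure M) (carleson_box I l) * ennreal (ln (2 * pi / l)) \<le> ennreal (C / (2 * pi) * l)" .
qed

text \<open>
  The logarithm is bounded below for \<open>x \<le> 1/2\<close>; for larger \<open>x\<close> finiteness of the measure suffices.
\<close>
lemma tail_mass_linear:
  assumes C: "log_tail_bound C" and x: "0 < x" "x \<le> 1"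
  shows "tail_mass x \<le> (2 * C + 2 * measure M (space M)) * x"
proof (cases "x \<le> 1 / 2")
  case True
  have "1 / 2 \<le> ln (2::real)" using ln_2_less_1 ln2_ge_two_thirds by simp
  also have "ln 2 \<le> ln (1 / x)" using True x by (simp add: field_simps)
  finally have "tail_mass x * (1 / 2) \<le> tail_mass x * ln (1 / x)"
    by (intro mult_left_mono tail_mass_nonneg)
  also have "\<dots> \<le> C * x" using C x by (simp add: log_tail_bound_def)
  finally have "tail_mass x \<le> 2 * C * x" by simp
  also have "\<dots> \<le> (2 * C + 2 * measure M (space M)) * x" using x by (intro mult_right_mono) auto
  finally show ?thesis .
next
  case False
  have "tail_mass x \<le> measure M (space M) * 1" using tail_mass_le by simp
  also have "\<dots> \<le> measure M (space M) * (2 * x)" using False by (intro mult_left_mono) auto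
  also have "\<dots> \<le> (2 * C + 2 * measure M (space M)) * x"
    using C x by (simp add: log_tail_bound_def algebra_simps)
  finally show ?thesis .
qed

text \<open>
  Since \<open>log 2 \<le> 1\<close>, the weight at \<open>t\<close> exceeds \<open>1 + log (1/x)\<close> by at most the number of \<open>j\<close> with
  \<open>1 - t \<le> x / 2\<^sup>j\<close>. Integrating, the first part is controlled by the logarithmic condition at \<open>x\<close> and
  the count by the sum of the masses of \<open>[1 - x/2\<^sup>j, 1)\<close>, which is geometric.
\<close>
lemma log_weight_tail:
  assumes C: "log_tail_bound C" and x: "0 < x" "x \<le> 1"
  defines "C' \<equiv> 2 * C + 2 * measure M (space M)"
  shows "(\<integral>\<^sup>+t. ennreal (1 + ln (1 / (1 - t))) * indicator {t. 1 - t \<le> x} t \<partial>M) \<le> ennreal ((3 * C' + C) * x)"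
proof -
  have C0: "0 < C" using C by (simp add: log_tail_bound_def)
  have C'0: "0 < C'" using C0 by (simp add: C'_def add_pos_nonneg)
  define S where "S y = {t::real. 1 - t \<le> y}" for y
  have Sm: "S y \<in> sets borel" for y
    unfolding S_def by measurable
  have Smeas: "(\<integral>\<^sup>+t. indicator (S y) t \<partial>M) = ennreal (tail_mass y)" if "y \<le> 1" for y
  proof -
    have "(\<integral>\<^sup>+t. indicator (S y) t \<partial>M) = (\<integral>\<^sup>+t. indicator {1 - y..<1} t \<partial>M)"
      using that by (intro nn_integral_cong) (auto simp: S_def space_M split: split_indicator)
    then show ?thesis using interval_sets[OF that] emeasure_tail[OF that] by simp
  qed
  have ind[measurable]: "(indicator (S y) :: real \<Rightarrow> ennreal) \<in> borel_measurable M" for y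
    using Sm by (intro measurable_M) auto
  have pt: "ennreal (1 + ln (1 / (1 - t))) * indicator (S x) t
     \<le> ennreal (1 + ln (1 / x)) * indicator (S x) t + (\<Sum>j. indicator (S (x / 2 ^ j)) t)" if t: "t \<in> space M" for t
  proof (cases "t \<in> S x")
    case True
    define y where "y = 1 - t"
    have y: "0 < y" "y \<le> x" using t True by (auto simp: y_def space_M S_def)
    have "\<exists>n. x / 2 ^ Suc n < y"
    proof -
      obtain n where "x / y < 2 ^ n" using real_arch_pow[of 2 "x / y"] by auto
      then have "x < 2 ^ n * y" using y by (simp add: field_simps)
      also have "\<dots> \<le> 2 ^ Suc n * y" using y by simp
      finally show ?thesis by (auto simp: field_simps intro!: exI[of _ n])
    qed
    then obtain n where n: "x / 2 ^ Suc n < y" and nmin: "\<And>i. i < n \<Longrightarrow> \<not> x / 2 ^ Suc i < y"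
      using exists_least_iff[of "\<lambda>n. x / 2 ^ Suc n < y"] by auto
    have mem: "y \<le> x / 2 ^ j" if "j \<le> n" for j
    proof (cases j)
      case 0
      then show ?thesis using y by simp
    next
      case (Suc i)
      then show ?thesis using nmin[of i] that by simp
    qed
    have "x / y < 2 ^ Suc n" using n y by (simp add: field_simps)
    then have "ln (x / y) < ln (2 ^ Suc n)" using x y by (subst ln_less_cancel_iff) simp_all
    also have "\<dots> = real (Suc n) * ln 2" by (rule ln_realpow)
    also have "\<dots> \<le> real (Suc n) * 1" using ln_2_less_1 by (intro mult_left_mono) auto
    finally have "ln (1 / y) \<le> ln (1 / x) + real (Suc n)" using x y by (simp add: ln_div)
    then have "ennreal (1 + ln (1 / y)) \<le> ennreal ((1 + ln (1 / x)) + real (Suc n))"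
      by (intro ennreal_leI) simp
    also have "\<dots> = ennreal (1 + ln (1 / x)) + ennreal (real (Suc n))"
      using x by (intro ennreal_plus) auto
    also have "ennreal (real (Suc n)) = (\<Sum>j\<in>{..n}. indicator (S (x / 2 ^ j)) t)"
    proof -
      have "(\<Sum>j\<in>{..n}. indicator (S (x / 2 ^ j)) t :: ennreal) = (\<Sum>j\<in>{..n}. 1)"
        using mem by (intro sum.cong) (auto simp: S_def y_def)
      then show ?thesis by (simp add: ennreal_of_nat_eq_real_of_nat)
    qed
    also have "\<dots> \<le> (\<Sum>j. indicator (S (x / 2 ^ j)) t)" by (intro sum_le_suminf) auto
    finally show ?thesis using True by (simp add: y_def add_left_mono)
  qed simp
  have "(\<integral>\<^sup>+t. ennreal (1 + ln (1 / (1 - t))) * indicator (S x) t \<partial>M)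
     \<le> (\<integral>\<^sup>+t. ennreal (1 + ln (1 / x)) * indicator (S x) t + (\<Sum>j. indicator (S (x / 2 ^ j)) t) \<partial>M)"
    by (intro nn_integral_mono pt)
  also have "\<dots> = ennreal (1 + ln (1 / x)) * (\<integral>\<^sup>+t. indicator (S x) t \<partial>M) + (\<Sum>j. \<integral>\<^sup>+t. indicator (S (x / 2 ^ j)) t \<partial>M)"
    by (subst nn_integral_add) (auto simp: nn_integral_cmult nn_integral_suminf intro!: borel_measurable_times_ennreal ind borel_measurable_suminf)
  also have "(\<lambda>j. \<integral>\<^sup>+t. indicator (S (x / 2 ^ j)) t \<partial>M) = (\<lambda>j. ennreal (tail_mass (x / 2 ^ j)))"
  proof
    fix j
    have "x / 2 ^ j \<le> x / 1" using x by (intro divide_left_mono) auto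
    then have "x / 2 ^ j \<le> 1" using x by linarith
    then show "(\<integral>\<^sup>+t. indicator (S (x / 2 ^ j)) t \<partial>M) = ennreal (tail_mass (x / 2 ^ j))"
      by (rule Smeas)
  qed
  also have "(\<integral>\<^sup>+t. indicator (S x) t \<partial>M) = ennreal (tail_mass x)" by (rule Smeas[OF x(2)])
  also have "(\<Sum>j. ennreal (tail_mass (x / 2 ^ j))) \<le> (\<Sum>j. ennreal (C' * x * (1 / 2) ^ j))"
  proof (intro suminf_le ennreal_leI)
    fix j
    have "x / 2 ^ j \<le> x / 1" using x by (intro divide_left_mono) auto
    then have "x / 2 ^ j \<le> 1" "0 < x / 2 ^ j" using x by (linarith, simp)
    then have "tail_mass (x / 2 ^ j) \<le> C' * (x / 2 ^ j)"
      unfolding C'_def by (intro tail_mass_linear[OF C])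
    then show "tail_mass (x / 2 ^ j) \<le> C' * x * (1 / 2) ^ j" by (simp add: power_divide)
  qed auto
  also have "\<dots> = ennreal (C' * x * 2)"
    using C'0 x by (intro suminf_ennreal_eq sums_mult) (auto intro!: geometric_sums[of "1/2::real", simplified])
  also have "ennreal (1 + ln (1 / x)) * ennreal (tail_mass x) \<le> ennreal (C' * x + C * x)"
  proof -
    have "(1 + ln (1 / x)) * tail_mass x = tail_mass x + tail_mass x * ln (1 / x)" by (simp add: algebra_simps)
    also have "\<dots> \<le> C' * x + C * x"
      using tail_mass_linear[OF C x] C x unfolding C'_def log_tail_bound_def by (intro add_mono) auto
    finally have "ennreal ((1 + ln (1 / x)) * tail_mass x) \<le> ennreal (C' * x + C * x)" by (rule ennreal_leI)
    then show ?thesis using x tail_mass_nonneg[of x] by (subst ennreal_mult[symmetric]) simp_all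
  qed
  also have "ennreal (C' * x + C * x) + ennreal (C' * x * 2) = ennreal ((3 * C' + C) * x)"
    using C0 C'0 x by (simp add: algebra_simps flip: ennreal_plus)
  finally show ?thesis by (simp add: S_def add_right_mono)
qed


definition log_weight :: "real \<Rightarrow> real" where
  "log_weight t = 1 + ln (1 / (1 - t))"

lemma log_weight_ge_1: "0 \<le> t \<Longrightarrow> t < 1 \<Longrightarrow> 1 \<le> log_weight t"
  by (simp add: log_weight_def)

lemma log_weight_measurable [measurable]: "log_weight \<in> borel_measurable M"
  unfolding log_weight_def by (intro measurable_M) measurable

definition tail_const :: "real \<Rightarrow> real" where
  "tail_const C = 3 * (2 * C + 2 * measure M (space M)) + C"

lemma tail_const_pos: "0 < C \<Longrightarrow> 0 < tail_const C"
  by (simp add: tail_const_def add_pos_nonneg add_nonneg_pos)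

lemma log_weight_kernel:
  assumes C: "log_tail_bound C" and d: "0 < d"
  shows "(\<integral>\<^sup>+t. ennreal (log_weight t * (1 / (d + (1 - t))\<^sup>2)) \<partial>M) \<le> ennreal (8 * tail_const C / d)"
proof -
  have C0: "0 < C" using C by (simp add: log_tail_bound_def)
  have K0: "0 < tail_const C" by (rule tail_const_pos[OF C0])
  have [measurable]: "(\<lambda>t. 1 - t) \<in> borel_measurable M" "(\<lambda>t. ennreal (1 / (d + (1 - t))\<^sup>2)) \<in> borel_measurable M"
    by (intro measurable_M; measurable)+
  have [measurable]: "(\<lambda>t. ennreal (log_weight t)) \<in> borel_measurable M" by measurable
  define \<nu> where "\<nu> = density M (\<lambda>t. ennreal (log_weight t))"
  have dist: "emeasure \<nu> {t \<in> space \<nu>. 1 - t \<le> x} \<le> ennreal (tail_const C * x)" if x: "0 < x" for x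
  proof -
    have set: "{t \<in> space M. 1 - t \<le> x} \<in> sets M" by measurable
    have "emeasure \<nu> {t \<in> space \<nu>. 1 - t \<le> x} = (\<integral>\<^sup>+t. ennreal (log_weight t) * indicator {t \<in> space M. 1 - t \<le> x} t \<partial>M)"
      unfolding \<nu>_def using set by (simp add: emeasure_density)
    also have "\<dots> = (\<integral>\<^sup>+t. ennreal (log_weight t) * indicator {t. 1 - t \<le> min x 1} t \<partial>M)"
      by (intro nn_integral_cong) (auto simp: space_M split: split_indicator)
    also have "\<dots> \<le> ennreal (tail_const C * min x 1)"
      using log_weight_tail[OF C, of "min x 1"] x unfolding tail_const_def log_weight_def by simp
    also have "\<dots> \<le> ennreal (tail_const C * x)" using K0 by (intro ennreal_leI mult_left_mono) auto
    finally show ?thesis .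
  qed
  have "(\<integral>\<^sup>+t. ennreal (log_weight t * (1 / (d + (1 - t))\<^sup>2)) \<partial>M) = (\<integral>\<^sup>+t. ennreal (log_weight t) * ennreal (1 / (d + (1 - t))\<^sup>2) \<partial>M)"
    using log_weight_ge_1 by (intro nn_integral_cong ennreal_mult) (auto simp: space_M intro: order_trans[OF zero_le_one])
  also have "\<dots> = (\<integral>\<^sup>+t. ennreal (1 / (d + (1 - t))\<^sup>2) \<partial>\<nu>)"
    unfolding \<nu>_def by (rule nn_integral_density[symmetric]) measurable
  also have "\<dots> \<le> ennreal (8 * tail_const C / d)"
    by (rule dyadic_kernel_bound) (use dist d K0 in \<open>auto simp: \<nu>_def space_M\<close>)
  finally show ?thesis .
qed

lemma log_weight_integrable:
  assumes C: "log_tail_bound C"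
  shows "integrable M log_weight" "(LINT t|M. log_weight t) \<le> tail_const C"
proof -
  have C0: "0 < C" using C by (simp add: log_tail_bound_def)
  have "(\<integral>\<^sup>+t. ennreal (log_weight t) \<partial>M) = (\<integral>\<^sup>+t. ennreal (1 + ln (1 / (1 - t))) * indicator {t. 1 - t \<le> 1} t \<partial>M)"
    by (intro nn_integral_cong) (auto simp: space_M log_weight_def split: split_indicator)
  also have "\<dots> \<le> ennreal (tail_const C)"
    using log_weight_tail[OF C, of 1] by (simp add: tail_const_def)
  finally have le: "(\<integral>\<^sup>+t. ennreal (log_weight t) \<partial>M) \<le> ennreal (tail_const C)" .
  have nn: "AE t in M. 0 \<le> log_weight t"
    using log_weight_ge_1 by (intro AE_I2) (auto simp: space_M intro: order_trans[OF zero_le_one])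
  show int: "integrable M log_weight"
    using nn le_less_trans[OF le ennreal_less_top] by (intro integrableI_nonneg) auto
  have "ennreal (LINT t|M. log_weight t) \<le> ennreal (tail_const C)"
    using le nn_integral_eq_integral[OF int nn] by simp
  then show "(LINT t|M. log_weight t) \<le> tail_const C"
    using tail_const_pos[OF C0] by (subst (asm) ennreal_le_iff) auto
qed

text \<open>
  With \<open>u = m (1 - t)\<close> one has \<open>t\<^sup>m \<le> e\<^sup>-\<^sup>u\<close> and \<open>e\<^sup>u \<ge> (1 + u)\<^sup>2 / 2\<close>.
\<close>
lemma power_le_kernel:
  assumes t: "0 \<le> t" "t < 1" and m: "0 < m"
  shows "t ^ m \<le> 2 / (real m)\<^sup>2 * (1 / (1 / real m + (1 - t))\<^sup>2)"
proof -
  define u where "u = real m * (1 - t)"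
  have u: "0 \<le> u" using t by (simp add: u_def)
  have "t \<le> exp (- (1 - t))" using exp_ge_add_one_self[of "- (1 - t)"] by simp
  then have "t ^ m \<le> exp (- (1 - t)) ^ m" using t by (intro power_mono) auto
  also have "\<dots> = exp (- u)" by (simp add: u_def algebra_simps flip: exp_of_nat_mult)
  also have "\<dots> = 1 / exp u" by (simp add: exp_minus inverse_eq_divide)
  also have "\<dots> \<le> 1 / ((1 + u)\<^sup>2 / 2)"
  proof (rule divide_left_mono)
    have "1 + u + u\<^sup>2 / 2 \<le> exp u" using exp_lower_Taylor_quadratic[OF u] .
    then show "(1 + u)\<^sup>2 / 2 \<le> exp u" by (simp add: power2_eq_square field_simps)
  qed (use u in auto)
  also have "1 + u = real m * (1 / real m + (1 - t))" using m by (simp add: u_def field_simps)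
  also have "1 / ((real m * (1 / real m + (1 - t)))\<^sup>2 / 2) = 2 / (real m)\<^sup>2 * (1 / (1 / real m + (1 - t))\<^sup>2)"
    by (simp add: power_mult_distrib)
  finally show ?thesis .
qed

lemma moment_integrable: "integrable M (\<lambda>t. t ^ n)"
proof (rule integrable_const_bound[where B = 1])
  show "AE t in M. norm (t ^ n) \<le> 1" by (intro AE_I2) (auto simp: space_M power_le_one)
  show "(\<lambda>t. t ^ n) \<in> borel_measurable M" by (intro measurable_M) measurable
qed

lemma moment_nonneg: "0 \<le> moment M n"
  unfolding moment_def by (intro integral_nonneg_AE AE_I2) (auto simp: space_M)

lemma moment_antimono: "m \<le> n \<Longrightarrow> moment M n \<le> moment M m"
  unfolding moment_def by (intro integral_mono moment_integrable) (auto simp: space_M power_decreasing)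

text \<open>
  By \<open>power_le_kernel\<close> the function \<open>t\<^sup>m\<close> lives on the scale \<open>d = 1 / m\<close>; since the weight is at
  least \<open>1\<close>, the kernel estimate for the weighted measure applies.
\<close>
lemma moment_decay:
  assumes C: "log_tail_bound C" and m: "0 < m"
  shows "moment M m \<le> 16 * tail_const C / real m"
proof -
  have C0: "0 < C" using C by (simp add: log_tail_bound_def)
  have K0: "0 < tail_const C" by (rule tail_const_pos[OF C0])
  have "ennreal (moment M m) = (\<integral>\<^sup>+t. ennreal (t ^ m) \<partial>M)"
    unfolding moment_def by (intro nn_integral_eq_integral[symmetric] moment_integrable AE_I2) (auto simp: space_M)
  also have "\<dots> \<le> (\<integral>\<^sup>+t. ennreal (2 / (real m)\<^sup>2) * ennreal (log_weight t * (1 / (1 / real m + (1 - t))\<^sup>2)) \<partial>M)"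
  proof (rule nn_integral_mono)
    fix t assume "t \<in> space M"
    then have t: "0 \<le> t" "t < 1" by (auto simp: space_M)
    have "t ^ m \<le> 2 / (real m)\<^sup>2 * (1 / (1 / real m + (1 - t))\<^sup>2)" by (rule power_le_kernel[OF t m])
    also have "\<dots> \<le> 2 / (real m)\<^sup>2 * (log_weight t * (1 / (1 / real m + (1 - t))\<^sup>2))"
      using log_weight_ge_1[OF t] mult_right_mono[of 1 "log_weight t" "1 / (1 / real m + (1 - t))\<^sup>2"]
      by (intro mult_left_mono) auto
    finally have "ennreal (t ^ m) \<le> ennreal (2 / (real m)\<^sup>2 * (log_weight t * (1 / (1 / real m + (1 - t))\<^sup>2)))"
      by (rule ennreal_leI)
    also have "\<dots> = ennreal (2 / (real m)\<^sup>2) * ennreal (log_weight t * (1 / (1 / real m + (1 - t))\<^sup>2))"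
      using log_weight_ge_1[OF t] by (intro ennreal_mult) auto
    finally show "ennreal (t ^ m) \<le> ennreal (2 / (real m)\<^sup>2) * ennreal (log_weight t * (1 / (1 / real m + (1 - t))\<^sup>2))" .
  qed
  also have "\<dots> = ennreal (2 / (real m)\<^sup>2) * (\<integral>\<^sup>+t. ennreal (log_weight t * (1 / (1 / real m + (1 - t))\<^sup>2)) \<partial>M)"
  proof (rule nn_integral_cmult)
    have [measurable]: "(\<lambda>t. 1 / (1 / real m + (1 - t))\<^sup>2) \<in> borel_measurable M" by (intro measurable_M) measurable
    show "(\<lambda>t. ennreal (log_weight t * (1 / (1 / real m + (1 - t))\<^sup>2))) \<in> borel_measurable M" by measurable
  qed
  also have "\<dots> \<le> ennreal (2 / (real m)\<^sup>2) * ennreal (8 * tail_const C / (1 / real m))"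
    using m by (intro mult_left_mono log_weight_kernel C) auto
  also have "\<dots> = ennreal (2 / (real m)\<^sup>2 * (8 * tail_const C / (1 / real m)))"
    using K0 by (intro ennreal_mult[symmetric]) auto
  also have "2 / (real m)\<^sup>2 * (8 * tail_const C / (1 / real m)) = 16 * tail_const C / real m"
    using m by (simp add: power2_eq_square)
  finally show ?thesis using K0 by (subst (asm) ennreal_le_iff) auto
qed


section \<open>Sufficiency\<close>

lemma norm_one_minus_scaled_ge:
  fixes z :: complex
  assumes t: "0 \<le> t" "t \<le> 1" and z: "cmod z < 1"
  shows "(cmod (1 - z) / 2 + (1 - t)) / 2 \<le> cmod (1 - of_real t * z)"
  using norm_one_minus_scaled[of t z] t z by (simp add: field_simps)

lemma mean_lipschitz_growth:
  assumes f: "f \<in> mean_lipschitz p" and p: "1 < p" and t: "t \<in> space M"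
  shows "cmod (f (of_real t)) \<le> 18432 * p / (p - 1) * mean_lipschitz_norm p f * log_weight t"
  using mean_lipschitz_log_growth[OF f p, of t] t unfolding log_weight_def by (simp add: space_M)

lemma holomorphic_real_measurable:
  assumes "f holomorphic_on ball 0 1"
  shows "(\<lambda>t. f (of_real t)) \<in> borel_measurable M"
proof -
  have "continuous_on {0..<1} (\<lambda>t::real. f (of_real t))"
    by (rule continuous_on_compose2[OF holomorphic_on_imp_continuous_on[OF assms]])
      (auto intro!: continuous_intros)
  then show ?thesis unfolding measurable_cong_sets[OF sets_M refl]
    by (rule borel_measurable_continuous_on_restrict)
qed

text \<open>
  Moments are \<open>O(1/k)\<close> and Taylor coefficients \<open>O(k\<^sup>-\<^sup>1\<^sup>/\<^sup>p)\<close>, so the series converges absolutely and may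
  be exchanged with the integral.
\<close>
lemma hankel_coeff_integral:
  assumes C: "log_tail_bound C" and f: "f \<in> mean_lipschitz p" and p: "1 < p"
  shows "(\<lambda>k. of_real (moment M (n + k)) * taylor_coeff f k) sums (LINT t|M. of_real (t ^ n) * f (of_real t))"
proof -
  have hol: "f holomorphic_on ball 0 1" using f by (auto simp: mean_lipschitz_def intro: hardy_space_imp_holomorphic)
  define N where "N = mean_lipschitz_norm p f"
  have N0: "0 \<le> N" unfolding N_def by (rule mean_lipschitz_norm_parts[OF f p])
  have C0: "0 < C" using C by (simp add: log_tail_bound_def)
  define K where "K = tail_const C"
  have K0: "0 < K" unfolding K_def by (rule tail_const_pos[OF C0])
  define u where "u k t = of_real (t ^ (n + k)) * taylor_coeff f k" for k and t :: real
  have ui: "integrable M (u k)" for k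
    unfolding u_def by (intro integrable_mult_left integrable_of_real moment_integrable)
  have uI: "integral\<^sup>L M (u k) = of_real (moment M (n + k)) * taylor_coeff f k" for k
    unfolding u_def moment_def by (simp only: integral_mult_left_zero integral_complex_of_real)
  have usum: "(\<lambda>k. u k t) sums (of_real (t ^ n) * f (of_real t))" if t: "t \<in> space M" for t
  proof -
    have "(\<lambda>k. (deriv ^^ k) f 0 / fact k * (of_real t - 0) ^ k) sums f (of_real t)"
      using t by (intro holomorphic_power_series[OF hol]) (auto simp: space_M)
    then have "(\<lambda>k. of_real (t ^ n) * ((deriv ^^ k) f 0 / fact k * (of_real t - 0) ^ k)) sums (of_real (t ^ n) * f (of_real t))"
      by (rule sums_mult)
    then show ?thesis by (simp add: u_def taylor_coeff_def power_add mult_ac)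
  qed
  have unorm: "(LINT t|M. norm (u k t)) = moment M (n + k) * cmod (taylor_coeff f k)" for k
  proof -
    have "(LINT t|M. norm (u k t)) = (LINT t|M. t ^ (n + k) * cmod (taylor_coeff f k))"
      by (intro Bochner_Integration.integral_cong) (auto simp: u_def norm_mult norm_power space_M)
    then show ?thesis by (simp add: moment_def)
  qed
  have sn: "summable (\<lambda>k. LINT t|M. norm (u k t))"
  proof (rule summable_comparison_test')
    have "summable (\<lambda>k. real k powr (- 1 - 1 / p))" using p by (subst summable_real_powr_iff) auto
    then show "summable (\<lambda>k. 16 * K * (N * pi powr (1 / p)) * real k powr (- 1 - 1 / p))" by (rule summable_mult)
    fix k :: nat assume k: "1 \<le> k"
    have "moment M (n + k) \<le> moment M k" by (intro moment_antimono) simp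
    also have "\<dots> \<le> 16 * K / real k" unfolding K_def using k by (intro moment_decay C) simp
    finally have "moment M (n + k) * cmod (taylor_coeff f k) \<le> 16 * K / real k * (N * (pi / real k) powr (1 / p))"
      using mean_lipschitz_coeff_bound[OF f p, of k] k K0 unfolding N_def by (intro mult_mono) auto
    also have "\<dots> = 16 * K * (N * pi powr (1 / p)) * real k powr (- 1 - 1 / p)"
      using k by (simp add: powr_divide powr_diff powr_minus_divide field_simps)
    finally show "norm (LINT t|M. norm (u k t)) \<le> 16 * K * (N * pi powr (1 / p)) * real k powr (- 1 - 1 / p)"
      unfolding unorm using moment_nonneg by simp
  qed
  have ae: "AE t in M. summable (\<lambda>k. norm (u k t))"
  proof (rule AE_I2)
    fix t assume t: "t \<in> space M"
    have t1: "0 \<le> t" "t < 1" using t by (auto simp: space_M)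
    define s where "s = (1 + t) / 2"
    have s: "0 < s" "s < 1" "t < s" using t1 by (auto simp: s_def field_simps)
    have "(\<lambda>k. (deriv ^^ k) f 0 / fact k * (of_real s - 0) ^ k) sums f (of_real s)"
      using s by (intro holomorphic_power_series[OF hol]) auto
    then have "summable (\<lambda>k. taylor_coeff f k * of_real s ^ k)"
      by (auto simp: taylor_coeff_def sums_iff)
    then have "summable (\<lambda>k. norm (taylor_coeff f k * of_real t ^ k))"
      by (rule powser_insidea) (use s t1 in auto)
    then have "summable (\<lambda>k. t ^ n * norm (taylor_coeff f k * of_real t ^ k))" by (rule summable_mult)
    then show "summable (\<lambda>k. norm (u k t))"
      using t1 by (simp add: u_def norm_mult norm_power power_add mult_ac)
  qed
  have "(\<lambda>k. integral\<^sup>L M (u k)) sums (LINT t|M. (\<Sum>k. u k t))"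
    using ui ae sn by (rule sums_integral)
  moreover have "(LINT t|M. (\<Sum>k. u k t)) = (LINT t|M. of_real (t ^ n) * f (of_real t))"
    using usum by (intro Bochner_Integration.integral_cong) (auto simp: sums_iff)
  ultimately show ?thesis by (simp only: uI)
qed

text \<open>
  \<open>A\<close> bounds the integral of \<open>|f|\<close>, hence every coefficient of the image. The derivative of the image
  is the integral of \<open>t f(t) / (1 - t z)\<^sup>2\<close>; the factor \<open>64\<close> collects \<open>4\<close> from \<open>|1 - t z| \<ge> (d + (1 - t)) / 2\<close>,
  \<open>8\<close> from \<open>log_weight_kernel\<close> and \<open>2\<close> from \<open>d = |1 - z| / 2\<close>.
\<close>
lemma hankel_log_singular:
  assumes C: "log_tail_bound C" and f: "f \<in> mean_lipschitz p" and p: "1 < p"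
  defines "A \<equiv> 18432 * p / (p - 1) * mean_lipschitz_norm p f * tail_const C"
  shows "hankel_defined M f" "log_singular (hankel_op M f) (64 * A)" "cmod (hankel_op M f 0) \<le> A"
proof -
  have hol: "f holomorphic_on ball 0 1" using f by (auto simp: mean_lipschitz_def intro: hardy_space_imp_holomorphic)
  note fm[measurable] = holomorphic_real_measurable[OF hol]
  define N where "N = 18432 * p / (p - 1) * mean_lipschitz_norm p f"
  have N0: "0 \<le> N" unfolding N_def using p mean_lipschitz_norm_parts(1)[OF f p] by simp
  have C0: "0 < C" using C by (simp add: log_tail_bound_def)
  have K0: "0 < tail_const C" by (rule tail_const_pos[OF C0])
  have A0: "0 \<le> A" unfolding A_def N_def[symmetric] using N0 K0 by simp
  have growth: "cmod (f (of_real t)) \<le> N * log_weight t" if "t \<in> space M" for t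
    unfolding N_def by (rule mean_lipschitz_growth[OF f p that])
  have fi: "integrable M (\<lambda>t. f (of_real t))"
    by (rule Bochner_Integration.integrable_bound[OF integrable_mult_right[OF log_weight_integrable(1)[OF C], of N]])
      (auto intro!: AE_I2 order_trans[OF growth])
  have fI: "(LINT t|M. cmod (f (of_real t))) \<le> A"
  proof -
    have "(LINT t|M. cmod (f (of_real t))) \<le> (LINT t|M. N * log_weight t)"
      by (intro integral_mono integrable_norm fi integrable_mult_right log_weight_integrable(1)[OF C] growth)
    also have "\<dots> = N * (LINT t|M. log_weight t)" by simp
    also have "\<dots> \<le> N * tail_const C" using log_weight_integrable(2)[OF C] N0 by (intro mult_left_mono) auto
    finally show ?thesis by (simp add: A_def N_def)
  qed
  define b where "b n = (LINT t|M. of_real (t ^ n) * f (of_real t))" for n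
  have hc: "hankel_coeff M f n = b n" for n
    unfolding hankel_coeff_def b_def using hankel_coeff_integral[OF C f p, of n] by (rule sums_unique[symmetric])
  have tfi: "integrable M (\<lambda>t. of_real (t ^ n) * f (of_real t))" for n
  proof (rule Bochner_Integration.integrable_bound[OF fi])
    have "(\<lambda>t. complex_of_real (t ^ n)) \<in> borel_measurable M" by (intro measurable_M) measurable
    then show "(\<lambda>t. of_real (t ^ n) * f (of_real t)) \<in> borel_measurable M" by measurable
    show "AE t in M. norm (of_real (t ^ n) * f (of_real t)) \<le> norm (f (of_real t))"
      by (intro AE_I2) (auto simp: norm_mult norm_power space_M power_le_one mult_left_le_one_le)
  qed
  have tfn: "(LINT t|M. cmod (of_real (t ^ n) * f (of_real t))) \<le> A" for n
  proof -
    have "(LINT t|M. cmod (of_real (t ^ n) * f (of_real t))) \<le> (LINT t|M. cmod (f (of_real t)))"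
      by (intro integral_mono integrable_norm tfi fi)
        (auto simp: norm_mult norm_power space_M power_le_one mult_left_le_one_le)
    then show ?thesis using fI by simp
  qed
  have bA: "cmod (b n) \<le> A" for n
    unfolding b_def by (rule order_trans[OF integral_norm_bound tfn])
  have bs: "summable (\<lambda>n. b n * z ^ n)" if z: "cmod z < 1" for z
  proof (rule summable_comparison_test')
    show "summable (\<lambda>n. A * cmod z ^ n)" using z by (intro summable_mult summable_geometric) auto
    show "norm (b n * z ^ n) \<le> A * cmod z ^ n" for n
      using bA[of n] by (simp add: norm_mult norm_power mult_right_mono)
  qed
  have op: "hankel_op M f z = (\<Sum>n. b n * z ^ n)" for z
    unfolding hankel_op_def hc ..
  have der: "(hankel_op M f has_field_derivative (\<Sum>n. diffs b n * z ^ n)) (at z)" if z: "cmod z < 1" for z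
    unfolding op[abs_def] by (rule termdiffs_strong'[OF bs z])
  have holF: "hankel_op M f holomorphic_on ball 0 1"
    using der by (intro holomorphic_onI) (auto simp: field_differentiable_def intro: has_field_derivative_at_within)
  show "hankel_defined M f"
    unfolding hankel_defined_def
    using hankel_coeff_integral[OF C f p] bs holF by (auto simp: hc sums_iff)
  show "cmod (hankel_op M f 0) \<le> A"
    using bA[of 0] powser_zero[of b] by (simp add: op)
  show "log_singular (hankel_op M f) (64 * A)"
  proof
    show "hankel_op M f holomorphic_on ball 0 1" by (rule holF)
    show "0 \<le> 64 * A" using A0 by simp
    fix z :: complex assume z: "cmod z < 1"
    define d where "d = cmod (1 - z) / 2"
    have d: "0 < d" using z by (auto simp: d_def)
    define u where "u n t = of_nat (Suc n) * (of_real (t ^ Suc n) * f (of_real t)) * z ^ n" for n and t :: real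
    have ui: "integrable M (u n)" for n
      unfolding u_def by (intro integrable_mult_left integrable_mult_right tfi)
    have uI: "integral\<^sup>L M (u n) = diffs b n * z ^ n" for n
      unfolding u_def diffs_def b_def by simp
    have un: "(LINT t|M. norm (u n t)) \<le> A * (real (Suc n) * cmod z ^ n)" for n
    proof -
      have "(LINT t|M. norm (u n t)) = (LINT t|M. (real (Suc n) * cmod z ^ n) * cmod (of_real (t ^ Suc n) * f (of_real t)))"
        unfolding u_def by (intro Bochner_Integration.integral_cong) (simp_all add: norm_mult norm_power del: of_nat_Suc)
      also have "\<dots> = (real (Suc n) * cmod z ^ n) * (LINT t|M. cmod (of_real (t ^ Suc n) * f (of_real t)))"
        by (rule integral_mult_right_zero)
      also have "\<dots> \<le> (real (Suc n) * cmod z ^ n) * A" by (intro mult_left_mono tfn) auto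
      finally show ?thesis by (simp add: mult_ac)
    qed
    have gs: "summable (\<lambda>n. real (Suc n) * cmod z ^ n)"
      using geometric_deriv_sums[of "cmod z"] z by (auto simp: sums_iff)
    have sn: "summable (\<lambda>n. LINT t|M. norm (u n t))"
    proof (rule summable_comparison_test')
      show "summable (\<lambda>n. A * (real (Suc n) * cmod z ^ n))" by (rule summable_mult[OF gs])
      show "norm (LINT t|M. norm (u n t)) \<le> A * (real (Suc n) * cmod z ^ n)" for n
        using un[of n] by (simp add: integral_nonneg_AE del: of_nat_Suc)
    qed
    have usum: "(\<lambda>n. u n t) sums (of_real t * f (of_real t) / (1 - of_real t * z)\<^sup>2)" if t: "t \<in> space M" for t
    proof -
      have "cmod (of_real t * z) < 1" using t z by (auto simp: space_M norm_mult intro: le_less_trans[OF mult_left_le_one_le])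
      then have "(\<lambda>n. of_nat (Suc n) * (of_real t * z) ^ n) sums (1 / (1 - of_real t * z)\<^sup>2)"
        by (rule geometric_deriv_sums)
      then have "(\<lambda>n. (of_real t * f (of_real t)) * (of_nat (Suc n) * (of_real t * z) ^ n)) sums ((of_real t * f (of_real t)) * (1 / (1 - of_real t * z)\<^sup>2))"
        by (rule sums_mult)
      then show ?thesis by (simp add: u_def power_mult_distrib mult_ac del: of_nat_Suc)
    qed
    have ae: "AE t in M. summable (\<lambda>n. norm (u n t))"
    proof (rule AE_I2)
      fix t assume t: "t \<in> space M"
      show "summable (\<lambda>n. norm (u n t))"
      proof (rule summable_comparison_test')
        show "summable (\<lambda>n. cmod (f (of_real t)) * (real (Suc n) * cmod z ^ n))" by (rule summable_mult[OF gs])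
        fix n
        have "norm (u n t) = (t ^ Suc n * cmod (f (of_real t))) * (real (Suc n) * cmod z ^ n)"
          using t by (simp add: u_def norm_mult norm_power space_M mult_ac del: of_nat_Suc power_Suc)
        also have "\<dots> \<le> (1 * cmod (f (of_real t))) * (real (Suc n) * cmod z ^ n)"
          using t by (intro mult_right_mono power_le_one) (auto simp: space_M)
        finally show "norm (norm (u n t)) \<le> cmod (f (of_real t)) * (real (Suc n) * cmod z ^ n)" by simp
      qed
    qed
    have "(\<Sum>n. diffs b n * z ^ n) = (LINT t|M. (\<Sum>n. u n t))"
      unfolding uI[symmetric] by (rule integral_suminf[symmetric, OF ui ae sn])
    also have "\<dots> = (LINT t|M. of_real t * f (of_real t) / (1 - of_real t * z)\<^sup>2)"
      using usum by (intro Bochner_Integration.integral_cong) (auto simp: sums_iff)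
    finally have dz: "deriv (hankel_op M f) z = (LINT t|M. of_real t * f (of_real t) / (1 - of_real t * z)\<^sup>2)"
      using der[OF z] by (simp add: DERIV_imp_deriv)
    have "cmod (deriv (hankel_op M f) z) \<le> (LINT t|M. cmod (of_real t * f (of_real t) / (1 - of_real t * z)\<^sup>2))"
      unfolding dz by (rule integral_norm_bound)
    also have "\<dots> \<le> 4 * N * (8 * tail_const C / d)"
    proof (rule integral_real_bounded)
      have "(\<integral>\<^sup>+t. ennreal (cmod (of_real t * f (of_real t) / (1 - of_real t * z)\<^sup>2)) \<partial>M)
         \<le> (\<integral>\<^sup>+t. ennreal (4 * N) * ennreal (log_weight t * (1 / (d + (1 - t))\<^sup>2)) \<partial>M)"
      proof (rule nn_integral_mono)
        fix t assume tM: "t \<in> space M"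
        then have t: "0 \<le> t" "t < 1" by (auto simp: space_M)
        have ds: "0 < d + (1 - t)" using d t by simp
        have "((d + (1 - t)) / 2)\<^sup>2 \<le> (cmod (1 - of_real t * z))\<^sup>2"
          using norm_one_minus_scaled_ge[of t z] t z ds unfolding d_def by (intro power_mono) auto
        moreover have "t * cmod (f (of_real t)) \<le> 1 * (N * log_weight t)"
          using t growth[OF tM] by (intro mult_mono) auto
        ultimately have "t * cmod (f (of_real t)) / (cmod (1 - of_real t * z))\<^sup>2 \<le> (N * log_weight t) / ((d + (1 - t)) / 2)\<^sup>2"
          using ds t N0 log_weight_ge_1[OF t] by (intro frac_le) auto
        also have "\<dots> = (4 * N) * (log_weight t * (1 / (d + (1 - t))\<^sup>2))" by (simp add: power_divide)
        also have "t * cmod (f (of_real t)) / (cmod (1 - of_real t * z))\<^sup>2 = cmod (of_real t * f (of_real t) / (1 - of_real t * z)\<^sup>2)"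
          using t by (simp add: norm_mult norm_divide norm_power)
        finally have "ennreal (cmod (of_real t * f (of_real t) / (1 - of_real t * z)\<^sup>2)) \<le> ennreal ((4 * N) * (log_weight t * (1 / (d + (1 - t))\<^sup>2)))"
          by (rule ennreal_leI)
        also have "\<dots> = ennreal (4 * N) * ennreal (log_weight t * (1 / (d + (1 - t))\<^sup>2))"
          using N0 log_weight_ge_1[OF t] by (intro ennreal_mult) auto
        finally show "ennreal (cmod (of_real t * f (of_real t) / (1 - of_real t * z)\<^sup>2)) \<le> ennreal (4 * N) * ennreal (log_weight t * (1 / (d + (1 - t))\<^sup>2))" .
      qed
      also have "\<dots> = ennreal (4 * N) * (\<integral>\<^sup>+t. ennreal (log_weight t * (1 / (d + (1 - t))\<^sup>2)) \<partial>M)"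
      proof (rule nn_integral_cmult)
        have [measurable]: "(\<lambda>t. 1 / (d + (1 - t))\<^sup>2) \<in> borel_measurable M" by (intro measurable_M) measurable
        show "(\<lambda>t. ennreal (log_weight t * (1 / (d + (1 - t))\<^sup>2))) \<in> borel_measurable M" by measurable
      qed
      also have "\<dots> \<le> ennreal (4 * N) * ennreal (8 * tail_const C / d)"
        by (intro mult_left_mono log_weight_kernel C d) auto
      also have "\<dots> = ennreal (4 * N * (8 * tail_const C / d))"
        using N0 K0 d by (intro ennreal_mult[symmetric]) auto
      finally show "(\<integral>\<^sup>+t. ennreal (cmod (of_real t * f (of_real t) / (1 - of_real t * z)\<^sup>2)) \<partial>M) \<le> ennreal (4 * N * (8 * tail_const C / d))" .
    qed (use N0 K0 d in auto)
    also have "\<dots> = 64 * A / cmod (1 - z)" by (simp add: A_def N_def d_def)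
    finally show "cmod (deriv (hankel_op M f) z) \<le> 64 * A / cmod (1 - z)" .
  qed
qed

lemma log_tail_imp_bounded:
  assumes C: "log_tail_bound C" and p: "1 < p"
  shows "hankel_well_defined_in M (mean_lipschitz p)" "hankel_bounded_on_mean_lipschitz M p"
proof -
  show "hankel_well_defined_in M (mean_lipschitz p)"
    unfolding hankel_well_defined_in_def using hankel_log_singular(1)[OF C _ p] by blast
  define K where "K = 18432 * p / (p - 1) * tail_const C"
  show "hankel_bounded_on_mean_lipschitz M p"
    unfolding hankel_bounded_on_mean_lipschitz_def
  proof (intro conjI exI[of _ "lipschitz_const p * (65 * K)"] ballI)
    fix f assume f: "f \<in> mean_lipschitz p"
    interpret log_singular "hankel_op M f" "64 * (18432 * p / (p - 1) * mean_lipschitz_norm p f * tail_const C)"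
      by (rule hankel_log_singular(2)[OF C f p])
    show "hankel_op M f \<in> mean_lipschitz p" by (rule mean_lipschitz(1)[OF p])
    have L: "0 \<le> lipschitz_const p" unfolding lipschitz_const_def using p by simp
    have "mean_lipschitz_norm p (hankel_op M f) \<le> lipschitz_const p * (cmod (hankel_op M f 0) + 64 * (18432 * p / (p - 1) * mean_lipschitz_norm p f * tail_const C))"
      by (rule mean_lipschitz(2)[OF p])
    also have "\<dots> \<le> lipschitz_const p * (18432 * p / (p - 1) * mean_lipschitz_norm p f * tail_const C + 64 * (18432 * p / (p - 1) * mean_lipschitz_norm p f * tail_const C))"
      by (intro mult_left_mono add_right_mono hankel_log_singular(3)[OF C f p] L)
    also have "\<dots> = lipschitz_const p * (65 * K) * mean_lipschitz_norm p f"
      unfolding K_def by simp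
    finally show "mean_lipschitz_norm p (hankel_op M f) \<le> lipschitz_const p * (65 * K) * mean_lipschitz_norm p f" .
  qed
qed


end

section \<open>Necessity\<close>

definition log_fun :: "complex \<Rightarrow> complex" where
  "log_fun z = - Ln (1 - z)"

lemma one_minus_notin_nonpos: "cmod z < 1 \<Longrightarrow> 1 - z \<notin> \<real>\<^sub>\<le>\<^sub>0"
  using complex_Re_le_cmod[of z] by (auto simp: complex_nonpos_Reals_iff)

lemma log_fun_derivative: "cmod z < 1 \<Longrightarrow> (log_fun has_field_derivative 1 / (1 - z)) (at z)"
  unfolding log_fun_def using one_minus_notin_nonpos[of z]
  by (auto intro!: derivative_eq_intros simp: divide_inverse)

lemma log_fun_log_singular: "log_singular log_fun 1"
proof
  show "log_fun holomorphic_on ball 0 1"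
    using log_fun_derivative by (intro holomorphic_onI)
      (auto simp: field_differentiable_def intro: has_field_derivative_at_within)
  show "cmod (deriv log_fun z) \<le> 1 / cmod (1 - z)" if "cmod z < 1" for z
    using log_fun_derivative[OF that] by (simp add: DERIV_imp_deriv norm_divide)
qed simp

text \<open>
  At \<open>k = 0\<close> both sides vanish, as division by zero yields zero.
\<close>
lemma taylor_coeff_log_fun: "taylor_coeff log_fun k = 1 / of_nat k"
proof -
  have hol: "log_fun holomorphic_on ball 0 1" using log_fun_log_singular by (simp add: log_singular_def)
  define F where "F = Abs_fps (\<lambda>n. (deriv ^^ n) log_fun 0 / fact n)"
  define G where "G = Abs_fps (\<lambda>n. 1 / of_nat n :: complex)"
  have nb: "\<forall>\<^sub>F z in nhds 0. z \<in> ball (0::complex) 1"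
    by (rule eventually_nhds_in_open) auto
  have "log_fun has_fps_expansion F"
  proof (rule has_fps_expansionI)
    show "\<forall>\<^sub>F u in nhds 0. (\<lambda>n. fps_nth F n * u ^ n) sums log_fun u"
      using nb
    proof eventually_elim
      case (elim u)
      then show ?case using holomorphic_power_series[OF hol, of u] by (simp add: F_def)
    qed
  qed
  moreover have "log_fun has_fps_expansion G"
  proof (rule has_fps_expansionI)
    show "\<forall>\<^sub>F u in nhds 0. (\<lambda>n. fps_nth G n * u ^ n) sums log_fun u"
      using nb
    proof eventually_elim
      case (elim u)
      then have "(\<lambda>n. - ((- (- u)) ^ n) / of_nat n) sums ln (1 + - u)" by (intro Ln_series') auto
      then have "(\<lambda>n. - (- ((- (- u)) ^ n) / of_nat n)) sums - ln (1 + - u)" by (rule sums_minus)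
      then show ?case by (simp add: G_def log_fun_def)
    qed
  qed
  ultimately have "F = G" by (rule fps_expansion_unique_complex)
  then have "fps_nth F k = fps_nth G k" by simp
  then show ?thesis by (simp add: F_def G_def taylor_coeff_def)
qed

text \<open>
  At the point \<open>r = 1 - 1/(2 N)\<close> the first \<open>N\<close> terms of the derivative are each at least
  \<open>(n + 1) \<beta>\<^sub>N / 2\<close>, since \<open>r\<^sup>N \<ge> 1/2\<close>, while the derivative is at most \<open>2 C N\<close>.
\<close>
lemma decreasing_coeff_bound:
  fixes \<beta> :: "nat \<Rightarrow> real" and F :: "complex \<Rightarrow> complex"
  assumes \<beta>0: "\<And>n. 0 \<le> \<beta> n" and dec: "\<And>m n. m \<le> n \<Longrightarrow> \<beta> n \<le> \<beta> m"
    and F: "\<And>z. cmod z < 1 \<Longrightarrow> summable (\<lambda>n. of_real (\<beta> n) * z ^ n)"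
       "\<And>z. F z = (\<Sum>n. of_real (\<beta> n) * z ^ n)"
    and dF: "\<And>z. cmod z < 1 \<Longrightarrow> cmod (deriv F z) \<le> C / (1 - cmod z)"
    and N: "0 < N"
  shows "\<beta> N \<le> 8 * C / real N"
proof -
  define r where "r = 1 - 1 / (2 * real N)"
  have r: "0 \<le> r" "r < 1" "1 - r = 1 / (2 * real N)" using N by (auto simp: r_def field_simps)
  have "1 + real N * (- (1 / (2 * real N))) \<le> (1 + - (1 / (2 * real N))) ^ N"
    using N by (intro Bernoulli_inequality) (simp add: field_simps)
  then have rN: "1 / 2 \<le> r ^ N" using N by (simp add: r_def)
  have nr: "cmod (of_real r) < 1" using r by simp
  have "(F has_field_derivative (\<Sum>n. diffs (\<lambda>n. complex_of_real (\<beta> n)) n * of_real r ^ n)) (at (of_real r))"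
    using termdiffs_strong'[OF F(1) nr] by (simp add: F(2)[abs_def])
  then have d: "deriv F (of_real r) = (\<Sum>n. diffs (\<lambda>n. complex_of_real (\<beta> n)) n * of_real r ^ n)"
    by (rule DERIV_imp_deriv)
  have diffs_real: "diffs (\<lambda>n. complex_of_real (\<beta> n)) n * of_real r ^ n = of_real (real (Suc n) * \<beta> (Suc n) * r ^ n)" for n
    by (simp add: diffs_def)
  have "summable (\<lambda>n. diffs (\<lambda>n. complex_of_real (\<beta> n)) n * of_real r ^ n)"
    by (rule termdiff_converges[where K = 1]) (use r F(1) in auto)
  then have "summable (\<lambda>n. complex_of_real (real (Suc n) * \<beta> (Suc n) * r ^ n))" unfolding diffs_real .
  then have sm: "summable (\<lambda>n. real (Suc n) * \<beta> (Suc n) * r ^ n)" by (simp only: summable_of_real_iff)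
  have nonneg: "0 \<le> real (Suc n) * \<beta> (Suc n) * r ^ n" for n using \<beta>0 r by simp
  have "deriv F (of_real r) = of_real (\<Sum>n. real (Suc n) * \<beta> (Suc n) * r ^ n)"
    unfolding d diffs_real by (rule suminf_of_real[OF sm, symmetric])
  then have "cmod (deriv F (of_real r)) = (\<Sum>n. real (Suc n) * \<beta> (Suc n) * r ^ n)"
    using suminf_nonneg[OF sm nonneg] by (simp only: norm_of_real abs_of_nonneg)
  then have "(\<Sum>n. real (Suc n) * \<beta> (Suc n) * r ^ n) \<le> C / (1 - r)"
    using dF[OF nr] r by simp
  moreover have "(\<Sum>n<N. real (Suc n) * \<beta> (Suc n) * r ^ n) \<le> (\<Sum>n. real (Suc n) * \<beta> (Suc n) * r ^ n)"
    by (rule sum_le_suminf[OF sm]) (use nonneg in auto)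
  moreover have "(\<Sum>n<N. real (Suc n) * (\<beta> N * (1 / 2))) \<le> (\<Sum>n<N. real (Suc n) * \<beta> (Suc n) * r ^ n)"
  proof (rule sum_mono)
    fix n assume n: "n \<in> {..<N}"
    have "1 / 2 \<le> r ^ n" using rN power_decreasing[of n N r] n r by simp
    then have "\<beta> N * (1 / 2) \<le> \<beta> (Suc n) * r ^ n" using dec[of "Suc n" N] n \<beta>0 by (intro mult_mono) auto
    then have "real (Suc n) * (\<beta> N * (1 / 2)) \<le> real (Suc n) * (\<beta> (Suc n) * r ^ n)" by (rule mult_left_mono) simp
    then show "real (Suc n) * (\<beta> N * (1 / 2)) \<le> real (Suc n) * \<beta> (Suc n) * r ^ n" by (simp only: mult.assoc)
  qed
  moreover have "(\<Sum>n<N. real (Suc n) * (\<beta> N * (1 / 2))) = (real N * (real N + 1) / 2) * (\<beta> N * (1 / 2))"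
  proof -
    have "(\<Sum>n<N. real (Suc n)) = real N * (real N + 1) / 2" by (induction N) (auto simp: field_simps)
    then show ?thesis by (simp only: sum_distrib_right[symmetric])
  qed
  moreover have "(real N * real N / 2) * (\<beta> N * (1 / 2)) \<le> (real N * (real N + 1) / 2) * (\<beta> N * (1 / 2))"
    using \<beta>0 by (intro mult_right_mono) (auto simp: field_simps)
  ultimately have "(real N * real N / 2) * (\<beta> N * (1 / 2)) \<le> C / (1 - r)" by linarith
  also have "\<dots> = 2 * real N * C" unfolding r(3) by simp
  finally have "real N * (real N * \<beta> N) \<le> real N * (8 * C)" by simp
  then have "real N * \<beta> N \<le> 8 * C" by (rule mult_left_le_imp_le) (use N in simp)
  then show ?thesis using N by (simp add: field_simps)
qed

context interval_measure
begin

lemma moment_ge_tail: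
  assumes x: "0 \<le> x" "x \<le> 1"
  shows "(1 - x) ^ n * tail_mass x \<le> moment M n"
proof -
  have s: "{1 - x..<1} \<in> sets M" by (rule interval_sets[OF x(2)])
  have "(1 - x) ^ n * tail_mass x = (LINT t|M. (1 - x) ^ n * indicator {1 - x..<1} t)"
    using s by (simp add: tail_mass_def Int_absorb1[OF sets.sets_into_space])
  also have "\<dots> \<le> (LINT t|M. t ^ n)"
  proof (rule integral_mono)
    show "integrable M (\<lambda>t. (1 - x) ^ n * indicator {1 - x..<1} t)"
      using s by (intro integrable_mult_right integrable_real_indicator) (auto simp: emeasure_eq_measure)
    fix t assume "t \<in> space M"
    then show "(1 - x) ^ n * indicator {1 - x..<1} t \<le> t ^ n"
      using x by (auto simp: space_M indicator_def intro!: power_mono)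
  qed (rule moment_integrable)
  finally show ?thesis by (simp add: moment_def)
qed

text \<open>
  The coefficient \<open>\<beta>\<^sub>N\<close> of the image is at least \<open>\<mu>\<^sub>2\<^sub>N\<close> times the \<open>N\<close>-th harmonic number, because moments
  decrease. For small \<open>x\<close>, take \<open>N\<close> of size \<open>1 / (4 x)\<close>: then \<open>(1 - x)\<^sup>2\<^sup>N \<ge> 1/2\<close>, so \<open>\<mu>\<^sub>2\<^sub>N\<close> is at least half
  the mass of \<open>[1 - x, 1)\<close>, and \<open>log N\<close> is comparable to \<open>log (1/x)\<close>.
\<close>
lemma bounded_imp_log_tail:
  assumes wd: "hankel_well_defined_in M (mean_lipschitz p)" and maps: "hankel_op M log_fun \<in> mean_lipschitz p"
    and p: "1 < p"
  obtains C where "log_tail_bound C"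
proof -
  have f: "log_fun \<in> mean_lipschitz p" by (rule log_singular.mean_lipschitz(1)[OF log_fun_log_singular p])
  then have def_f: "hankel_defined M log_fun" using wd by (simp add: hankel_well_defined_in_def)
  have "summable (\<lambda>k. of_real (moment M (n + k) / real k) :: complex)" for n
    using def_f unfolding hankel_defined_def taylor_coeff_log_fun by simp
  then have sm: "summable (\<lambda>k. moment M (n + k) / real k)" for n
    by (simp only: summable_of_real_iff)
  define \<beta> where "\<beta> n = (\<Sum>k. moment M (n + k) / real k)" for n
  have hc: "hankel_coeff M log_fun n = of_real (\<beta> n)" for n
  proof -
    have "hankel_coeff M log_fun n = (\<Sum>k. of_real (moment M (n + k) / real k))"
      unfolding hankel_coeff_def taylor_coeff_log_fun by simp
    then show ?thesis unfolding \<beta>_def by (simp only: suminf_of_real[OF sm])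
  qed
  have \<beta>0: "0 \<le> \<beta> n" for n unfolding \<beta>_def by (intro suminf_nonneg sm) (simp add: moment_nonneg)
  have dec: "\<beta> n \<le> \<beta> m" if "m \<le> n" for m n
    unfolding \<beta>_def using that by (intro suminf_le sm divide_right_mono moment_antimono) auto
  define D where "D = 18432 * p / (p - 1) * mean_lipschitz_norm p (hankel_op M log_fun)"
  have D0: "0 \<le> D" unfolding D_def using p mean_lipschitz_norm_parts(1)[OF maps p] by simp
  have \<beta>N: "\<beta> N \<le> 8 * D / real N" if N: "0 < N" for N
  proof (rule decreasing_coeff_bound[OF \<beta>0 dec _ _ _ N])
    show "summable (\<lambda>n. of_real (\<beta> n) * z ^ n)" if "cmod z < 1" for z
      using def_f that unfolding hankel_defined_def hc by simp
    show "hankel_op M log_fun z = (\<Sum>n. of_real (\<beta> n) * z ^ n)" for z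
      unfolding hankel_op_def hc ..
    show "cmod (deriv (hankel_op M log_fun) z) \<le> D / (1 - cmod z)" if "cmod z < 1" for z
      unfolding D_def by (rule mean_lipschitz_deriv_bound[OF maps p that])
  qed
  have low: "moment M (2 * N) * ln (real N + 1) \<le> \<beta> N" for N
  proof -
    have "moment M (2 * N) * ln (real N + 1) \<le> moment M (2 * N) * harm N"
      by (intro mult_left_mono ln_le_harm moment_nonneg)
    also have "\<dots> = (\<Sum>k=1..N. moment M (2 * N) / real k)"
      by (simp add: harm_def sum_distrib_left divide_inverse)
    also have "\<dots> \<le> (\<Sum>k=1..N. moment M (N + k) / real k)"
      by (intro sum_mono divide_right_mono moment_antimono) auto
    also have "\<dots> \<le> \<beta> N" unfolding \<beta>_def
      by (rule sum_le_suminf[OF sm]) (auto simp: moment_nonneg)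
    finally show ?thesis .
  qed
  define Mt where "Mt = measure M (space M)"
  have Mt0: "0 \<le> Mt" by (simp add: Mt_def)
  have "tail_mass x * ln (1 / x) \<le> (256 * D + 256 * Mt + 1) * x" if x: "0 < x" "x \<le> 1" for x
  proof (cases "x \<le> 1 / 16")
    case True
    define N where "N = nat \<lfloor>1 / (4 * x)\<rfloor>"
    have "4 \<le> 1 / (4 * x)" using True x by (simp add: field_simps)
    then have fl: "4 \<le> \<lfloor>1 / (4 * x)\<rfloor>" by (simp add: le_floor_iff)
    have N4: "4 \<le> N" using nat_mono[OF fl] unfolding N_def by (simp only: nat_numeral)
    have "0 \<le> \<lfloor>1 / (4 * x)\<rfloor>" using fl by linarith
    then have rN: "real N = of_int \<lfloor>1 / (4 * x)\<rfloor>" unfolding N_def by (rule of_nat_nat)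
    have N1: "real N \<le> 1 / (4 * x)" "1 / (4 * x) < real N + 1" unfolding rN by linarith+
    have "1 / (8 * x) = 1 / (4 * x) / 2" "4 \<le> real N" using N4 by simp_all
    then have N2: "1 / (8 * x) \<le> real N" using N1(2) by linarith
    have "1 + real (2 * N) * (- x) \<le> (1 + - x) ^ (2 * N)"
      using x by (intro Bernoulli_inequality) simp
    moreover have "real (2 * N) * x \<le> 1 / 2" using N1(1) x by (simp add: field_simps)
    ultimately have half: "1 / 2 \<le> (1 - x) ^ (2 * N)" by simp
    have "ln (1 / x) / 2 \<le> ln (real N + 1)"
    proof -
      have "(1 / x) powr (1 / 2) \<le> real N + 1"
      proof -
        \<comment> \<open>Here \<open>x \<le> 1/16\<close> makes \<open>1 / (4 x)\<close> dominate the square root of \<open>1 / x\<close>.\<close>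
        have "sqrt (1 / x) * 4 \<le> sqrt (1 / x) * sqrt (1 / x)"
        proof (rule mult_left_mono)
          have "sqrt 16 \<le> sqrt (1 / x)" using True x by (intro real_sqrt_le_mono) (simp add: field_simps)
          then show "4 \<le> sqrt (1 / x)" by simp
        qed (use x in simp)
        also have "\<dots> = 1 / x" using x by simp
        finally have "sqrt (1 / x) \<le> 1 / (4 * x)" by (simp add: field_simps)
        then show ?thesis using N1(2) x by (simp add: powr_half_sqrt)
      qed
      then have "ln ((1 / x) powr (1 / 2)) \<le> ln (real N + 1)" using x by (intro ln_mono) auto
      then show ?thesis using x by (simp add: ln_powr)
    qed
    then have "(1 / 2) * tail_mass x * (ln (1 / x) / 2) \<le> (1 - x) ^ (2 * N) * tail_mass x * ln (real N + 1)"
      using half tail_mass_nonneg x by (intro mult_mono) auto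
    also have "\<dots> \<le> moment M (2 * N) * ln (real N + 1)"
      using x by (intro mult_right_mono moment_ge_tail) auto
    also have "\<dots> \<le> 8 * D / real N" using low[of N] \<beta>N[of N] N4 by simp
    also have "\<dots> \<le> 8 * D / (1 / (8 * x))" using N2 x D0 N4 by (intro divide_left_mono) auto
    also have "\<dots> = 64 * D * x" by simp
    finally have "tail_mass x * ln (1 / x) \<le> 256 * D * x" by simp
    also have "\<dots> \<le> (256 * D + 256 * Mt + 1) * x" using x Mt0 by (intro mult_right_mono) auto
    finally show ?thesis .
  next
    case False
    have "ln (1 / x) \<le> 1 / x - 1" using x by (intro ln_le_minus_one) auto
    also have "\<dots> \<le> 16" using False x by (simp add: field_simps)
    finally have "tail_mass x * ln (1 / x) \<le> Mt * 16"
      using x Mt0 unfolding Mt_def by (intro mult_mono tail_mass_le) auto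
    also have "\<dots> \<le> Mt * (256 * x)" using False Mt0 by (intro mult_left_mono) auto
    also have "Mt * (256 * x) = 256 * Mt * x" by simp
    also have "\<dots> \<le> (256 * D + 256 * Mt + 1) * x" using x D0 by (intro mult_right_mono) auto
    finally show ?thesis .
  qed
  then show ?thesis using that[of "256 * D + 256 * Mt + 1"] D0 Mt0 by (auto simp: log_tail_bound_def)
qed

end

theorem corollary1p1:
  fixes M :: "real measure" and p :: real
  assumes "sets M = sets (restrict_space borel {0..<1})"
    and "finite_measure M"
    and "1 < p"
  shows "(hankel_well_defined_in M (mean_lipschitz p) \<and> hankel_bounded_on_mean_lipschitz M p)
           \<longleftrightarrow> log_carleson (disc_measure M)"
proof -
  interpret interval_measure M
    using assms(1,2) by (intro interval_measure.intro interval_measure_axioms.intro)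
  show ?thesis
  proof
    assume b: "hankel_well_defined_in M (mean_lipschitz p) \<and> hankel_bounded_on_mean_lipschitz M p"
    have "log_fun \<in> mean_lipschitz p"
      by (rule log_singular.mean_lipschitz(1)[OF log_fun_log_singular assms(3)])
    then have "hankel_op M log_fun \<in> mean_lipschitz p"
      using b by (simp add: hankel_bounded_on_mean_lipschitz_def)
    with b obtain C where "log_tail_bound C"
      using bounded_imp_log_tail assms(3) by blast
    then show "log_carleson (disc_measure M)" by (rule tail_imp_log_carleson)
  next
    assume "log_carleson (disc_measure M)"
    then obtain C where "log_tail_bound C" by (rule log_carleson_imp_tail)
    then show "hankel_well_defined_in M (mean_lipschitz p) \<and> hankel_bounded_on_mean_lipschitz M p"
      using log_tail_imp_bounded assms(3) by blast
  qed
qed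

end
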